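(* Consider a nilpotent orbit $\exp(\sum_{j=1}^k\ell(t_j)N_j)\cdot F$ on $\Delta^{*k}$, and for $I\subset\{1,\dots,k\}$ let $\mu_I:\Delta_I^*\to\mathbb{C}^{m_I}$ be the associated monomial map (defined in the context). For $I\subsetneqq J\subset\{1,\dots,k\}$, so that $\Delta_J^*\subset\overline{\Delta_I^*}$, the closure (in $\Delta_J^*$) of a level set of $\mu_I$ is contained in a level set of $\mu_J$. Moreover, the limit in $\Delta_J^*$ of level sets of $\mu_I$ in $\Delta_I^*$ is contained in a level set of $\mu_J$.
   Context: $\Delta=\{|t|<1\}$, $\Delta^*=\Delta\setminus\{0\}$, $\ell(t)=\log t/2\pi i$. $D$ is the period domain of weight $n$ polarized Hodge structures on $(V,Q)$ with fixed Hodge numbers and $\check D$ its compact dual. A nilpotent orbit is given by commuting nilpotent $N_1,\dots,N_k\in\mathfrak{g}=\operatorname{End}_Q(V)$ (the Lie algebra of $\operatorname{Aut}_Q(V)$) and $F\in\check D$ such that $N_iF^p\subset F^{p-1}$ for all $i,p$ and $\exp(\sum_j\ell(t_j)N_j)F\in D$ for all sufficiently small non-zero $t_j$. For $I\subset\{1,\dots,k\}$ with complement $I^c$ put $\Delta_I^*=\{t\in\Delta^k:t_i=0\text{ for }i\in I,\ t_j\neq0\text{ for }j\in I^c\}$ and $N_I=\sum_{i\in I}N_i$. Let $W_\bullet(N_I)\mathfrak{g}$ be the monodromy weight filtration on $\mathfrak{g}$ of the nilpotent operator $\operatorname{ad}N_I$, centered at $0$. Let $R_I=\{(a_j)_{j\in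 I^c}\in\mathbb{R}^{I^c}:\sum_{j\in I^c}a_jN_j\in W_{-1}(N_I)\mathfrak{g}\}$. The monomial map $\mu_I$ has as components the monomials $t^B=\prod_{j\in I^c}t_j^{b_j}$, where $B$ runs over a finite generating set of the monoid of vectors $B\in\mathbb{Z}_{\geq0}^{I^c}$ with $\sum_{j\in I^c}a_jb_j=0$ for all $(a_j)\in R_I$. (The level sets of $\mu_I$ describe, up to connected components, the fibres of the period mapping $\Phi_I$ on $\Delta_I^*$ given by the associated graded of the limiting mixed Hodge structures.) A point $s\in\Delta_J^*$ lies in a limit of level sets of $\mu_I$ along a sequence of values $c_\nu$ if $s=\lim t_\nu$ with $t_\nu\in\mu_I^{-1}(c_\nu)$; the assertion is that all points of $\Delta_J^*$ arising as limits along one and the same sequence of level sets lie in one level set of $\mu_J$. *)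

theory Defs
  imports "HOL-Analysis.Analysis"
begin

text \<open>
  Conventions. The real vector space \<open>V\<close> is \<open>real^'v\<close>, its complexification is \<open>complex^'v\<close>,
  endomorphisms are square matrices, and the index set \<open>{1,...,k}\<close> is the finite type \<open>'k\<close>.
  For \<open>I :: 'k set\<close> a vector indexed by the complement \<open>- I\<close> is represented by its extension
  by zero to \<open>'k\<close>.
\<close>

section \<open>Linear algebra\<close>

definition mat_power :: "'a::comm_ring_1^'v^'v \<Rightarrow> nat \<Rightarrow> 'a^'v^'v" where
  "mat_power A m = (((**) A) ^^ m) (mat 1)"

definition mat_nilpotent :: "'a::comm_ring_1^'v^'v \<Rightarrow> bool" where
  "mat_nilpotent A \<longleftrightarrow> (\<exists>m. mat_power A m = 0)"

definition mat_exp :: "complex^'v^'v \<Rightarrow> complex^'v^'v" where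
  "mat_exp A = (\<Sum>m. mat_power A m /\<^sub>R fact m)"

definition cvec_conj :: "complex^'v \<Rightarrow> complex^'v" where
  "cvec_conj x = (\<chi> i. cnj (x $ i))"

definition complexify :: "real^'v^'v \<Rightarrow> complex^'v^'v" where
  "complexify A = map_matrix complex_of_real A"

text \<open>The complex bilinear (not sesquilinear) extension of a real bilinear form.\<close>

definition bilinear_ext :: "(real^'v \<Rightarrow> real^'v \<Rightarrow> real) \<Rightarrow> complex^'v \<Rightarrow> complex^'v \<Rightarrow> complex" where
  "bilinear_ext Q x y =
     (\<Sum>i\<in>UNIV. \<Sum>j\<in>UNIV. x $ i * y $ j * complex_of_real (Q (axis i 1) (axis j 1)))"

section \<open>Monodromy weight filtration, centered at 0\<close>

text \<open>
  Finite increasing filtrations \<open>W\<close> of the real vector space \<open>U\<close> with \<open>T (W m) \<subseteq> W (m - 2)\<close>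
  such that \<open>T ^^ m\<close> induces an isomorphism from \<open>Gr m\<close> onto \<open>Gr (- m)\<close> for all \<open>m \<ge> 0\<close>;
  the last two clauses are injectivity and surjectivity of that induced map. For a nilpotent
  endomorphism \<open>T\<close> of a finite-dimensional \<open>U\<close> there is exactly one such filtration.
\<close>

definition is_weight_filtration ::
  "('a::real_vector \<Rightarrow> 'a) \<Rightarrow> 'a set \<Rightarrow> (int \<Rightarrow> 'a set) \<Rightarrow> bool" where
  "is_weight_filtration T U W \<longleftrightarrow>
     (\<forall>m. subspace (W m) \<and> W m \<subseteq> U) \<and>
     (\<forall>m. W m \<subseteq> W (m + 1)) \<and>
     (\<exists>m. W m = {0}) \<and> (\<exists>m. W m = U) \<and>
     (\<forall>m. T ` W m \<subseteq> W (m - 2)) \<and>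
     (\<forall>m::nat. \<forall>x\<in>W (int m). (T ^^ m) x \<in> W (- int m - 1) \<longrightarrow> x \<in> W (int m - 1)) \<and>
     (\<forall>m::nat. \<forall>y\<in>W (- int m). \<exists>x\<in>W (int m). y - (T ^^ m) x \<in> W (- int m - 1))"

definition weight_filtration :: "('a::real_vector \<Rightarrow> 'a) \<Rightarrow> 'a set \<Rightarrow> int \<Rightarrow> 'a set" where
  "weight_filtration T U = (THE W. is_weight_filtration T U W)"

section \<open>Period domains and nilpotent orbits\<close>

definition polarization_form :: "int \<Rightarrow> (real^'v \<Rightarrow> real^'v \<Rightarrow> real) \<Rightarrow> bool" where
  "polarization_form n Q \<longleftrightarrow>
     bilinear Q \<and> (\<forall>x y. Q y x = (-1) powi n * Q x y) \<and> (\<forall>x. (\<forall>y. Q x y = 0) \<longrightarrow> x = 0)"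

definition lie_algebra_Q :: "(real^'v \<Rightarrow> real^'v \<Rightarrow> real) \<Rightarrow> (real^'v^'v) set" where
  "lie_algebra_Q Q = {X. \<forall>x y. Q (X *v x) y + Q x (X *v y) = 0}"

definition ad :: "real^'v^'v \<Rightarrow> real^'v^'v \<Rightarrow> real^'v^'v" where
  "ad X Y = X ** Y - Y ** X"

text \<open>
  Points of the compact dual: finite decreasing filtrations of \<open>complex^'v\<close> with
  \<open>dim (F p / F (p + 1)) = h p (n - p)\<close> that satisfy the first Riemann bilinear relation.
\<close>

definition compact_dual ::
  "int \<Rightarrow> (real^'v \<Rightarrow> real^'v \<Rightarrow> real) \<Rightarrow> (int \<Rightarrow> int \<Rightarrow> nat) \<Rightarrow> (int \<Rightarrow> (complex^'v) set) set" where
  "compact_dual n Q h =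
     {F. (\<forall>p. vec.subspace (F p)) \<and> (\<forall>p. F (p + 1) \<subseteq> F p) \<and>
         (\<exists>p. F p = UNIV) \<and> (\<exists>p. F p = {0}) \<and>
         (\<forall>p. vec.dim (F p) = vec.dim (F (p + 1)) + h p (n - p)) \<and>
         (\<forall>p. \<forall>x\<in>F p. \<forall>y\<in>F (n - p + 1). bilinear_ext Q x y = 0)}"

text \<open>
  \<open>F\<close> lies in the period domain iff \<open>F p \<oplus> conj (F (n - p + 1))\<close> is the whole space for all \<open>p\<close>
  and the second Riemann bilinear relation holds on the spaces \<open>H\<^sup>p\<^sup>,\<^sup>q = F p \<inter> conj (F q)\<close>. The number
  whose real part is taken there is automatically real, because \<open>Q\<close> is \<open>(-1)^n\<close>-symmetric.
\<close>

definition period_domain ::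
  "int \<Rightarrow> (real^'v \<Rightarrow> real^'v \<Rightarrow> real) \<Rightarrow> (int \<Rightarrow> int \<Rightarrow> nat) \<Rightarrow> (int \<Rightarrow> (complex^'v) set) set" where
  "period_domain n Q h =
     {F \<in> compact_dual n Q h.
        (\<forall>p. F p \<inter> cvec_conj ` F (n - p + 1) = {0}) \<and>
        (\<forall>p z. \<exists>x\<in>F p. \<exists>y\<in>cvec_conj ` F (n - p + 1). z = x + y) \<and>
        (\<forall>p q. p + q = n \<longrightarrow>
           (\<forall>x \<in> F p \<inter> cvec_conj ` F q. x \<noteq> 0 \<longrightarrow>
              0 < Re (\<i> powi (p - q) * bilinear_ext Q x (cvec_conj x))))}"

text \<open>
  The branch of the logarithm is immaterial below: changing it translates the filtration by
  elements \<open>exp (m N\<^sub>j)\<close>, \<open>m\<close> an integer, of the real group \<open>Aut\<^sub>Q(V)\<close>, which preserves \<open>D\<close>.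
\<close>

definition ell :: "complex \<Rightarrow> complex" where
  "ell t = Ln t / (2 * complex_of_real pi * \<i>)"

definition nilpotent_orbit ::
  "int \<Rightarrow> (real^'v \<Rightarrow> real^'v \<Rightarrow> real) \<Rightarrow> (int \<Rightarrow> int \<Rightarrow> nat) \<Rightarrow>
   ('k::finite \<Rightarrow> real^'v^'v) \<Rightarrow> (int \<Rightarrow> (complex^'v) set) \<Rightarrow> bool" where
  "nilpotent_orbit n Q h N F \<longleftrightarrow>
     (\<forall>i. N i \<in> lie_algebra_Q Q \<and> mat_nilpotent (N i)) \<and>
     (\<forall>i j. N i ** N j = N j ** N i) \<and>
     F \<in> compact_dual n Q h \<and>
     (\<forall>i p. (*v) (complexify (N i)) ` F p \<subseteq> F (p - 1)) \<and>
     (\<exists>e>0. \<forall>t::complex^'k. (\<forall>j. 0 < norm (t $ j) \<and> norm (t $ j) < e) \<longrightarrow>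
        (\<lambda>p. (*v) (mat_exp (\<Sum>j\<in>UNIV. map_matrix ((*) (ell (t $ j))) (complexify (N j)))) ` F p)
          \<in> period_domain n Q h)"

section \<open>Monomial maps\<close>

definition punctured_stratum :: "'k::finite set \<Rightarrow> (complex^'k) set" where
  "punctured_stratum I = {t. (\<forall>j. norm (t $ j) < 1) \<and> (\<forall>j. t $ j = 0 \<longleftrightarrow> j \<in> I)}"

definition relation_space ::
  "(real^'v \<Rightarrow> real^'v \<Rightarrow> real) \<Rightarrow> ('k::finite \<Rightarrow> real^'v^'v) \<Rightarrow> 'k set \<Rightarrow> (real^'k) set" where
  "relation_space Q N I =
     {a. (\<forall>i\<in>I. a $ i = 0) \<and>
         (\<Sum>j\<in>- I. a $ j *\<^sub>R N j) \<in> weight_filtration (ad (\<Sum>i\<in>I. N i)) (lie_algebra_Q Q) (- 1)}"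

definition exponent_monoid ::
  "(real^'v \<Rightarrow> real^'v \<Rightarrow> real) \<Rightarrow> ('k::finite \<Rightarrow> real^'v^'v) \<Rightarrow> 'k set \<Rightarrow> (nat^'k) set" where
  "exponent_monoid Q N I =
     {b. (\<forall>i\<in>I. b $ i = 0) \<and>
         (\<forall>a\<in>relation_space Q N I. (\<Sum>j\<in>- I. a $ j * real (b $ j)) = 0)}"

inductive_set submonoid_generated :: "'a::comm_monoid_add set \<Rightarrow> 'a set" for S where
  zero: "0 \<in> submonoid_generated S"
| add: "x \<in> S \<Longrightarrow> y \<in> submonoid_generated S \<Longrightarrow> x + y \<in> submonoid_generated S"

text \<open>The finite generating set is given as a list \<open>Bs\<close>, so \<open>\<complex>\<^sup>m\<close> consists of lists of length \<open>m\<close>.\<close>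

definition monomial_map ::
  "'k::finite set \<Rightarrow> (nat^'k) list \<Rightarrow> complex^'k \<Rightarrow> complex list" where
  "monomial_map I Bs t = map (\<lambda>B. \<Prod>j\<in>- I. t $ j ^ (B $ j)) Bs"

definition level_set ::
  "'k::finite set \<Rightarrow> (nat^'k) list \<Rightarrow> complex list \<Rightarrow> (complex^'k) set" where
  "level_set I Bs c = {t \<in> punctured_stratum I. monomial_map I Bs t = c}"

definition limit_of_sets :: "(nat \<Rightarrow> 'a::topological_space set) \<Rightarrow> 'a set" where
  "limit_of_sets L = {s. \<exists>t. (\<forall>\<nu>. t \<nu> \<in> L \<nu>) \<and> t \<longlonglongrightarrow> s}"

end

theory Submission
  imports Defs
begin

text \<open>
  The key point is that the exponent monoid of \<open>J\<close> is contained in that of \<open>I\<close>; the monomials of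
  \<open>\<mu>\<^sub>J\<close> are then functions of those of \<open>\<mu>\<^sub>I\<close>, continuous on all of \<open>\<Delta>\<^sup>k\<close>.

  For \<open>X\<close> commuting with \<open>N\<^sub>I\<close> one has \<open>X \<in> W\<^sub>-\<^sub>1(N\<^sub>I)\<close> iff \<open>X \<in> [N\<^sub>I, \<gg>]\<close>, i.e. iff \<open>X\<close> is
  orthogonal, under the trace form, to the centralizer of \<open>N\<^sub>I\<close>. Write \<open>\<bar>X\<bar>\<^sub>y\<close> for the Hodge norm at
  \<open>exp (\<i> \<Sum>y\<^sub>jN\<^sub>j) F\<close>. The squared norm of an element commuting with \<open>N\<^sub>b = \<Sum>b\<^sub>jN\<^sub>j\<close> is
  logarithmically convex along \<open>y + l b\<close>, and a Riccati inequality for \<open>trace (J N\<^sub>b)\<close>, where \<open>J\<close>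
  is the infinitesimal Hodge operator, excludes exponential growth; so the norm is nonincreasing.
  Tensoring with the standard weight one orbit improves this to \<open>\<bar>X\<bar> \<rightarrow> 0\<close> along \<open>y + l 1\<^sub>I\<close> for
  \<open>X \<in> [N\<^sub>I, \<gg>]\<close> commuting with \<open>N\<^sub>I\<close>.

  Hence if \<open>X = \<Sum>a\<^sub>jN\<^sub>j\<close> is in \<open>[N\<^sub>I, \<gg>]\<close> and \<open>Z\<close> commutes with \<open>N\<^sub>J\<close>, then \<open>\<bar>trace (X Z)\<bar>\<close> is at
  most \<open>\<bar>X\<bar> \<bar>Z\<bar>\<close> at \<open>y + l 1\<^sub>J\<close>, hence at most \<open>\<bar>X\<bar>\<close> at \<open>y + l 1\<^sub>I\<close> times \<open>\<bar>Z\<bar>\<^sub>y\<close>, which tends to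
  zero; so \<open>X \<in> [N\<^sub>J, \<gg>]\<close>. This also applies to \<open>N\<^sub>j \<in> [N\<^sub>j, \<gg>]\<close> for \<open>j \<in> J\<close>, so the coordinates in
  \<open>J\<close> may be dropped.
\<close>

subsection \<open>Existence and uniqueness of the weight filtration\<close>

text \<open>Log convexity alone permits exponential growth, so the Hodge norm has to be controlled
  through the motion of the Hodge structure itself. Write N for \<open>N\<^sub>b\<close>, xi =
  [N, J] and eta = [J, xi]. Along the line J' = - eta, and the logarithmic derivative of a squared
  norm is at most 4 |xi| = 4 |eta|. The function g = trace (J N) has derivative - |eta|^2; since
  trace (J J) is constant and trace (N N) = 0, Cauchy-Schwarz gives g^2 <= - K g'. A negative g
  would run to minus infinity in finite time, so g >= 0 and |eta|^2 has finite integral: no positive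
  growth rate can persist. Monotonicity gives boundedness, not decay. For X = [N, Y] commuting with
  N, the twisted vector in the tensor product has squared norm |Y|^2 / l + l |X|^2; that this is
  nonincreasing forces |X|^2 = O(1 / l). Images of ad are what let norms enter: membership is tested
  by traces against the centralizer, and traces are bounded by products of Hodge norms.\<close>

locale nilpotent_on =
  fixes T :: "'a::real_vector \<Rightarrow> 'a" and U :: "'a set" and d :: nat
  assumes lin: "linear T" and sub: "subspace U" and inv: "T ` U \<subseteq> U"
    and nil: "\<And>x. (T ^^ d) x = 0"
begin

lemma T_pow_linear: "linear (T ^^ m)"
  by (induction m) (use linear_compose[OF _ lin] linear_id in \<open>simp_all add: o_def id_def\<close>)

lemma T_pow_U: "x \<in> U \<Longrightarrow> (T ^^ m) x \<in> U"
  by (induction m) (use inv in auto)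

lemma T_pow_zero [simp]: "(T ^^ m) 0 = 0"
  using T_pow_linear linear_0 by blast

lemma T_pow_nil: "m \<ge> d \<Longrightarrow> (T ^^ m) x = 0"
  by (metis T_pow_zero comp_apply funpow_add le_add_diff_inverse2 nil)

text \<open>The closed formula for the monodromy filtration: the top vector of a Jordan string of
  length a + 1 has weight a, and every application of \<open>T\<close> lowers the weight by
  2.\<close>

definition weight_gen :: "int \<Rightarrow> 'a set" where
  "weight_gen l = {(T ^^ b) x | a b x. x \<in> U \<and> (T ^^ Suc a) x = 0 \<and> int a - 2 * int b \<le> l}"

definition weight_span :: "int \<Rightarrow> 'a set" where
  "weight_span l = span (weight_gen l)"

lemma weight_genI: "x \<in> U \<Longrightarrow> (T ^^ Suc a) x = 0 \<Longrightarrow> int a - 2 * int b \<le> l \<Longrightarrow> (T ^^ b) x \<in> weight_gen l"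
  unfolding weight_gen_def by blast

text \<open>If b <= a, then a - 2b <= -k forces k <= b, so k of the b factors \<open>T\<close> split
  off, which raises the weight by 2k; if b > a, the generator is zero. Boundedness below and both
  isomorphism clauses rest on this inclusion.\<close>

lemma weight_span_minus: "weight_span (- int k) \<subseteq> (T ^^ k) ` weight_span (int k)"
proof -
  have "weight_gen (- int k) \<subseteq> (T ^^ k) ` weight_span (int k)"
  proof
    fix y assume "y \<in> weight_gen (- int k)"
    then obtain a b x where y: "y = (T ^^ b) x" "x \<in> U" "(T ^^ Suc a) x = 0" "int a - 2 * int b \<le> - int k"
      unfolding weight_gen_def by blast
    show "y \<in> (T ^^ k) ` weight_span (int k)"
    proof (cases "b \<le> a")
      case True
      then have kb: "k \<le> b" using y by linarith
      have "(T ^^ (b - k)) x \<in> weight_gen (int k)"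
        using y kb by (intro weight_genI[where a = a]) auto
      moreover have "y = (T ^^ k) ((T ^^ (b - k)) x)"
        using y kb by (metis comp_apply funpow_add le_add_diff_inverse)
      ultimately show ?thesis unfolding weight_span_def using span_base by blast
    next
      case False
      then have "y = (T ^^ (b - Suc a)) ((T ^^ Suc a) x)"
        using y by (metis Suc_leI comp_apply funpow_add le_add_diff_inverse2 not_le)
      then have "y = (T ^^ k) 0" using y(3) T_pow_zero by metis
      then show ?thesis unfolding weight_span_def using span_zero by (metis imageI)
    qed
  qed
  moreover have "subspace ((T ^^ k) ` weight_span (int k))"
    unfolding weight_span_def using T_pow_linear linear_subspace_image subspace_span by blast
  ultimately show ?thesis unfolding weight_span_def by (simp add: span_minimal)
qed

lemma weight_span_T: "T ` weight_span l \<subseteq> weight_span (l - 2)"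
proof -
  have "T ` weight_gen l \<subseteq> weight_gen (l - 2)"
  proof clarify
    fix y assume "y \<in> weight_gen l"
    then obtain a b x where y: "y = (T ^^ b) x" "x \<in> U" "(T ^^ Suc a) x = 0" "int a - 2 * int b \<le> l"
      unfolding weight_gen_def by blast
    have "(T ^^ Suc b) x \<in> weight_gen (l - 2)"
      using y by (intro weight_genI[where a = a]) auto
    then show "T y \<in> weight_gen (l - 2)" using y by simp
  qed
  then show ?thesis unfolding weight_span_def
    by (metis linear_span_image lin span_mono)
qed

lemma weight_span_mono: "k \<le> l \<Longrightarrow> weight_span k \<subseteq> weight_span l"
  unfolding weight_span_def weight_gen_def by (intro span_mono) force

lemma weight_span_U: "weight_span l \<subseteq> U"
  unfolding weight_span_def weight_gen_def by (rule span_minimal) (use sub T_pow_U in auto)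

lemma is_weight_filtration_span: "is_weight_filtration T U weight_span"
proof -
  have bot: "weight_span (- int d - 1) = {0}"
  proof -
    have "weight_span (- int (Suc d)) \<subseteq> (T ^^ Suc d) ` weight_span (int (Suc d))"
      by (rule weight_span_minus)
    also have "\<dots> \<subseteq> {0}" using T_pow_nil[of "Suc d"] by auto
    finally have "weight_span (- int (Suc d)) \<subseteq> {0}" .
    moreover have "- int (Suc d) = - int d - 1" by simp
    ultimately have "weight_span (- int d - 1) \<subseteq> {0}" by metis
    then show ?thesis unfolding weight_span_def using span_zero by blast
  qed
  have top: "weight_span (int d) = U"
  proof
    show "U \<subseteq> weight_span (int d)"
    proof
      fix x assume "x \<in> U"
      then have "(T ^^ 0) x \<in> weight_gen (int d)"
        by (intro weight_genI[where a = d] T_pow_nil) auto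
      then show "x \<in> weight_span (int d)" unfolding weight_span_def by (simp add: span_base)
    qed
  qed (rule weight_span_U)
  \<comment> \<open>Writing T^m x = T^(m+1) w with w of weight m + 1, the vector x - T w is killed
    by T^m, so it has weight at most m - 1, as does T w.\<close>
  have inj: "x \<in> weight_span (int m - 1)"
    if x: "x \<in> weight_span (int m)" and Tx: "(T ^^ m) x \<in> weight_span (- int m - 1)" for m x
  proof -
    have "- int m - 1 = - int (Suc m)" by simp
    then obtain w where w: "w \<in> weight_span (int (Suc m))" "(T ^^ m) x = (T ^^ Suc m) w"
      using Tx weight_span_minus by (metis (no_types, lifting) image_iff subsetD)
    have Tw: "T w \<in> weight_span (int m - 1)"
      using weight_span_T[of "int (Suc m)"] w(1) by (auto simp: algebra_simps)
    have z: "(T ^^ m) (x - T w) = 0"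
      using w(2) by (simp add: linear_diff[OF T_pow_linear] funpow_swap1)
    have "x - T w \<in> weight_span (int m - 1)"
    proof (cases m)
      case 0
      then show ?thesis using z by (simp add: weight_span_def span_zero)
    next
      case (Suc m')
      have "x - T w \<in> U" using x Tw weight_span_U sub subspace_diff by blast
      then have "(T ^^ 0) (x - T w) \<in> weight_gen (int m - 1)"
        using z Suc by (intro weight_genI[where a = m']) auto
      then show ?thesis unfolding weight_span_def by (simp add: span_base)
    qed
    then have "x - T w + T w \<in> weight_span (int m - 1)"
      using Tw unfolding weight_span_def by (intro span_add) auto
    then show ?thesis by simp
  qed
  have surj: "\<exists>x\<in>weight_span (int m). y - (T ^^ m) x \<in> weight_span (- int m - 1)"
    if y: "y \<in> weight_span (- int m)" for m y
  proof -
    obtain x where "x \<in> weight_span (int m)" "y = (T ^^ m) x"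
      using y weight_span_minus by blast
    then show ?thesis by (intro bexI[of _ x]) (auto simp: weight_span_def span_zero)
  qed
  show ?thesis
    unfolding is_weight_filtration_def
  proof (intro conjI)
    show "\<forall>m. subspace (weight_span m) \<and> weight_span m \<subseteq> U"
      using weight_span_U by (auto simp: weight_span_def)
    show "\<forall>m. weight_span m \<subseteq> weight_span (m + 1)"
      by (intro allI weight_span_mono) simp
    show "\<exists>m. weight_span m = {0}" using bot by fast
    show "\<exists>m. weight_span m = U" using top by fast
    show "\<forall>m. T ` weight_span m \<subseteq> weight_span (m - 2)" using weight_span_T by fast
    show "\<forall>m::nat. \<forall>x\<in>weight_span (int m). (T ^^ m) x \<in> weight_span (- int m - 1) \<longrightarrow> x \<in> weight_span (int m - 1)"
      using inj by fast
    show "\<forall>m::nat. \<forall>y\<in>weight_span (- int m). \<exists>x\<in>weight_span (int m). y - (T ^^ m) x \<in> weight_span (- int m - 1)"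
      using surj by fast
  qed
qed

section \<open>Uniqueness: comparing an arbitrary weight filtration with the explicit one\<close>

context
  fixes W assumes W: "is_weight_filtration T U W"
begin

lemma W_sub: "subspace (W m)" and W_U: "W m \<subseteq> U"
  and W_T: "x \<in> W m \<Longrightarrow> T x \<in> W (m - 2)"
  and W_inj: "x \<in> W (int k) \<Longrightarrow> (T ^^ k) x \<in> W (- int k - 1) \<Longrightarrow> x \<in> W (int k - 1)"
  and W_surj: "y \<in> W (- int k) \<Longrightarrow> \<exists>x\<in>W (int k). y - (T ^^ k) x \<in> W (- int k - 1)"
  using W unfolding is_weight_filtration_def by (fast, fast, fast, fast, fast)

lemma W_mono: "k \<le> l \<Longrightarrow> W k \<subseteq> W l"
proof (induction l rule: int_ge_induct)
  case (step i)
  have "W i \<subseteq> W (i + 1)" using W unfolding is_weight_filtration_def by fast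
  then show ?case using step by blast
qed simp

lemma W_T_pow: "x \<in> W m \<Longrightarrow> (T ^^ k) x \<in> W (m - 2 * int k)"
proof (induction k)
  case (Suc k)
  then show ?case using W_T[of "(T ^^ k) x" "m - 2 * int k"] by (simp add: algebra_simps)
qed simp

lemma W_zero: "0 \<in> W m" using W_sub subspace_0 by blast

text \<open>Injectivity on the graded pieces pushes x down: while x lies in W (a + j) with j > 0, it
  is killed by T^(a+j) and so lies one step lower.\<close>

lemma W_ker: assumes "x \<in> U" "(T ^^ Suc a) x = 0" shows "x \<in> W (int a)"
proof -
  have desc: "x \<in> W (int a + int j) \<Longrightarrow> x \<in> W (int a)" for j
  proof (induction j)
    case (Suc j)
    have "(T ^^ (a + Suc j)) x = (T ^^ j) ((T ^^ Suc a) x)"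
      by (metis add.commute add_Suc_shift comp_apply funpow_add)
    then have "(T ^^ (a + Suc j)) x = 0" using assms(2) by (metis T_pow_zero)
    then have "(T ^^ (a + Suc j)) x \<in> W (- int (a + Suc j) - 1)" using W_zero by metis
    then have "x \<in> W (int (a + Suc j) - 1)" using Suc.prems W_inj[of x "a + Suc j"] by (simp add: algebra_simps)
    then show ?case using Suc.IH by (simp add: algebra_simps)
  qed simp
  obtain m where "W m = U" using W unfolding is_weight_filtration_def by blast
  moreover have "m \<le> int a + int (nat m)" by linarith
  ultimately have "x \<in> W (int a + int (nat m))" using W_mono assms(1) by blast
  then show ?thesis by (rule desc)
qed

text \<open>Surjectivity holds only modulo the next lower step; the error lies in W (- k - 1) and is
  absorbed by induction towards the index where \<open>W\<close> vanishes.\<close>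

lemma W_minus: assumes "y \<in> W (- int k)" shows "y \<in> (T ^^ k) ` W (int k)"
proof -
  obtain m where m: "W m = {0}"
    using W unfolding is_weight_filtration_def by (elim conjE exE)
  have "\<forall>k y. nat (- int k - m) = j \<longrightarrow> y \<in> W (- int k) \<longrightarrow> y \<in> (T ^^ k) ` W (int k)" for j
  proof (induction j)
    case 0
    show ?case
    proof (intro allI impI)
      fix k y assume "nat (- int k - m) = 0" "y \<in> W (- int k)"
      then have "- int k \<le> m" by linarith
      then have "W (- int k) \<subseteq> W m" by (rule W_mono)
      then have "y = (T ^^ k) 0" using m \<open>y \<in> W (- int k)\<close> by auto
      then show "y \<in> (T ^^ k) ` W (int k)" using W_zero[of "int k"] by (rule image_eqI)
    qed
  next
    case (Suc j)
    show ?case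
    proof (intro allI impI)
      fix k y assume k: "nat (- int k - m) = Suc j" and y: "y \<in> W (- int k)"
      obtain x where x: "x \<in> W (int k)" "y - (T ^^ k) x \<in> W (- int k - 1)" using W_surj[OF y] ..
      have e: "- int k - 1 = - int (Suc k)" by simp
      have "nat (- int (Suc k) - m) = j" using k by linarith
      from Suc.IH[rule_format, OF this x(2)[unfolded e]] obtain w where w: "w \<in> W (int (Suc k))" "y - (T ^^ k) x = (T ^^ Suc k) w" by (rule imageE)
      have "W (int (Suc k) - 2) \<subseteq> W (int k)" by (rule W_mono) simp
      then have "T w \<in> W (int k)" using W_T[OF w(1)] by (rule subsetD)
      then have xw: "x + T w \<in> W (int k)" by (rule subspace_add[OF W_sub x(1)])
      have "y = (T ^^ k) x + (T ^^ k) (T w)"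
        using w(2) funpow_swap1[of T k w] by (simp add: diff_eq_eq add.commute)
      then have "y = (T ^^ k) (x + T w)"
        by (simp add: linear_add[OF T_pow_linear])
      then show "y \<in> (T ^^ k) ` W (int k)" using xw by (rule image_eqI)
    qed
  qed
  from this[rule_format, OF refl assms] show ?thesis .
qed

lemma W_eq_weight_span: "W l = weight_span l"
proof
  show "weight_span l \<subseteq> W l"
  proof -
    have "weight_gen l \<subseteq> W l"
    proof
      fix y assume "y \<in> weight_gen l"
      then obtain a b x where y: "y = (T ^^ b) x" "x \<in> U" "(T ^^ Suc a) x = 0" "int a - 2 * int b \<le> l"
        unfolding weight_gen_def by blast
      then show "y \<in> W l" using W_T_pow[OF W_ker, of x a b] W_mono by blast
    qed
    then show ?thesis unfolding weight_span_def using W_sub by (simp add: span_minimal)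
  qed
next
  \<comment> \<open>Downward induction on j, starting from T^d = 0. Subtracting T w, where T^(a+1) x
    = T^(a+2) w, moves x into the kernel of T^(a+1), whose images under powers of T are generators;
    what remains has exponent j + 1.\<close>
  have pos: "\<forall>x. x \<in> W (int a) \<longrightarrow> (T ^^ j) x \<in> weight_span (int a - 2 * int j)" if "d = j + i" for a i j
    using that
  proof (induction i arbitrary: a j)
    case 0
    then show ?case using nil by (simp add: weight_span_def span_zero)
  next
    case (Suc i)
    show ?case
    proof (intro allI impI)
      fix x assume x: "x \<in> W (int a)"
      have "(T ^^ Suc a) x \<in> W (int a - 2 * int (Suc a))" using W_T_pow x by blast
      moreover have "int a - 2 * int (Suc a) = - int (Suc (Suc a))" by simp
      ultimately have "(T ^^ Suc a) x \<in> (T ^^ Suc (Suc a)) ` W (int (Suc (Suc a)))"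
        using W_minus[of _ "Suc (Suc a)"] by metis
      then obtain w where w: "w \<in> W (int (Suc (Suc a)))" "(T ^^ Suc a) x = (T ^^ Suc (Suc a)) w"
        by fast
      have wU: "x - T w \<in> U" using W_U[of "int a"] W_U[of "int (Suc (Suc a))"] x w(1) inv by (intro subspace_diff[OF sub]) fast+
      have "(T ^^ Suc a) (x - T w) = 0"
        unfolding linear_diff[OF T_pow_linear] w(2) by (simp add: funpow_swap1)
      then have 1: "(T ^^ j) (x - T w) \<in> weight_span (int a - 2 * int j)"
        unfolding weight_span_def by (intro span_base weight_genI[OF wU]) auto
      have "(T ^^ Suc j) w \<in> weight_span (int (Suc (Suc a)) - 2 * int (Suc j))"
        using Suc.IH[of "Suc j" "Suc (Suc a)"] Suc.prems w(1) by simp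
      then have 2: "(T ^^ j) (T w) \<in> weight_span (int a - 2 * int j)"
        by (simp add: funpow_swap1)
      have "(T ^^ j) x = (T ^^ j) (x - T w) + (T ^^ j) (T w)"
        by (simp add: linear_diff[OF T_pow_linear])
      then show "(T ^^ j) x \<in> weight_span (int a - 2 * int j)"
        using 1 2 unfolding weight_span_def by (metis span_add)
    qed
  qed
  show "W l \<subseteq> weight_span l"
  proof
    fix x assume x: "x \<in> W l"
    show "x \<in> weight_span l"
    proof (cases "l \<ge> 0")
      case True
      then show ?thesis using pos[of 0 d "nat l"] x by simp
    next
      case False
      define k where "k = nat (- l)"
      have lk: "l = - int k" using False by (simp add: k_def)
      obtain w where w: "w \<in> W (int k)" "x = (T ^^ k) w" using W_minus x lk by blast
      show ?thesis
      proof (cases "k \<le> d")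
        case True
        then show ?thesis using pos[of k "d - k" k] w lk by simp
      next
        case False
        then show ?thesis using T_pow_nil w by (simp add: weight_span_def span_zero)
      qed
    qed
  qed
qed

end

lemma weight_filtration_eq: "weight_filtration T U = weight_span"
  unfolding weight_filtration_def
  by (rule the_equality[where P = "is_weight_filtration T U"])
    (use is_weight_filtration_span W_eq_weight_span in fast)+

text \<open>One direction is W_{-1} inside T W_1; conversely x = T y with T x = 0 is the generator
  with a = b = 1. From here on images of \<open>T\<close> replace the weight filtration.\<close>

lemma weight_filtration_minus_one_iff:
  assumes "x \<in> U" "T x = 0"
  shows "x \<in> weight_filtration T U (- 1) \<longleftrightarrow> x \<in> T ` U"
proof
  assume "x \<in> weight_filtration T U (- 1)"
  then have "x \<in> weight_span (- int 1)" by (simp add: weight_filtration_eq)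
  then show "x \<in> T ` U" using weight_span_minus[of 1] weight_span_U[of 1] by auto
next
  assume "x \<in> T ` U"
  then obtain y where y: "y \<in> U" "x = T y" by blast
  then have "(T ^^ 1) y \<in> weight_gen (- 1)"
    using assms by (intro weight_genI[where a = 1]) auto
  then show "x \<in> weight_filtration T U (- 1)"
    using y by (simp add: weight_filtration_eq weight_span_def span_base)
qed

end

subsection \<open>Matrix algebra\<close>

lemma matrix_add_rdistrib: "(A + B) ** C = A ** C + B ** (C :: 'a::semiring_1^_^_)"
  by (vector matrix_matrix_mult_def sum.distrib[symmetric] distrib_right)

lemma matrix_diff_ldistrib: "A ** (B - C) = A ** B - A ** (C :: 'a::ring_1^_^_)"
  by (vector matrix_matrix_mult_def sum_subtractf[symmetric] right_diff_distrib)

lemma matrix_diff_rdistrib: "(A - B) ** C = A ** C - B ** (C :: 'a::ring_1^_^_)"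
  by (vector matrix_matrix_mult_def sum_subtractf[symmetric] left_diff_distrib)

lemma matrix_minus_left: "(- A) ** C = - (A ** (C :: 'a::ring_1^_^_))"
  by (vector matrix_matrix_mult_def sum_negf)

lemma matrix_minus_right: "A ** (- C) = - (A ** (C :: 'a::ring_1^_^_))"
  by (vector matrix_matrix_mult_def sum_negf)

lemma matrix_scaleR_left: "(k *\<^sub>R A) ** B = k *\<^sub>R (A ** (B :: 'a::real_algebra_1^_^_))"
  by (vector matrix_matrix_mult_def scaleR_sum_right)

lemma matrix_scaleR_right: "A ** (k *\<^sub>R B) = k *\<^sub>R (A ** (B :: 'a::real_algebra_1^_^_))"
  by (vector matrix_matrix_mult_def scaleR_sum_right)

lemmas mat_distribs = matrix_add_ldistrib matrix_add_rdistrib matrix_diff_ldistrib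
  matrix_diff_rdistrib matrix_minus_left matrix_minus_right matrix_scaleR_left matrix_scaleR_right

lemma trace_minus: "trace (- A) = - trace (A :: 'a::ring_1^'n^'n)"
  by (simp add: trace_def sum_negf)

lemma trace_scaleR: "trace (c *\<^sub>R A) = c *\<^sub>R trace (A :: 'a::real_algebra_1^'n^'n)"
  by (simp add: trace_def scaleR_sum_right)

lemmas trace_simps = trace_add trace_sub trace_minus trace_scaleR

lemma bounded_bilinear_matrix_mult:
  "bounded_bilinear ((**) :: 'a::{real_normed_algebra_1,euclidean_space}^'n^'m \<Rightarrow> 'a^'p^'n \<Rightarrow> 'a^'p^'m)"
proof -
  have "bilinear ((**) :: 'a^'n^'m \<Rightarrow> 'a^'p^'n \<Rightarrow> 'a^'p^'m)"
    unfolding bilinear_def by (auto intro!: linearI simp: mat_distribs)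
  then show ?thesis by (simp add: bilinear_conv_bounded_bilinear)
qed

lemma bounded_linear_trace: "bounded_linear (trace :: real^'n^'n \<Rightarrow> real)"
  by (rule linear_conv_bounded_linear[THEN iffD1]) (auto intro!: linearI simp: trace_simps)

lemma inner_matrix_eq_trace: "(A :: real^'n^'m) \<bullet> B = trace (A ** transpose B)"
  by (simp add: inner_vec_def trace_def matrix_matrix_mult_def transpose_def)

lemma norm_matrix_vector_le: "norm ((A :: real^'n^'m) *v x) \<le> norm A * norm x"
proof -
  have "(norm (A *v x))\<^sup>2 = (\<Sum>i\<in>UNIV. (A $ i \<bullet> x)\<^sup>2)"
    unfolding norm_vec_def L2_set_def by (simp add: matrix_vector_mul_component real_sqrt_pow2 sum_nonneg)
  also have "\<dots> \<le> (\<Sum>i\<in>UNIV. (norm (A $ i))\<^sup>2 * (norm x)\<^sup>2)"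
    by (intro sum_mono) (metis Cauchy_Schwarz_ineq power2_norm_eq_inner)
  also have "\<dots> = (norm A * norm x)\<^sup>2"
    unfolding norm_vec_def[of A] L2_set_def
    by (simp add: power_mult_distrib sum_distrib_right sum_nonneg)
  finally show ?thesis by (rule power2_le_imp_le) simp
qed

text \<open>The norm of a matrix is its Frobenius norm; in an orthonormal frame this bounds brackets
  in the Hodge norm.\<close>

lemma norm_matrix_mult_le: "norm ((A :: real^'n^'m) ** (B :: real^'p^'n)) \<le> norm A * norm B"
proof -
  have n: "(norm M)\<^sup>2 = (\<Sum>j\<in>UNIV. (norm (column j M))\<^sup>2)" for M :: "real^'a^'b"
  proof -
    have "(norm M)\<^sup>2 = (\<Sum>i\<in>UNIV. \<Sum>j\<in>UNIV. (M $ i $ j)\<^sup>2)"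
      unfolding power2_norm_eq_inner by (simp add: inner_vec_def power2_eq_square)
    also have "\<dots> = (\<Sum>j\<in>UNIV. \<Sum>i\<in>UNIV. (M $ i $ j)\<^sup>2)" by (rule sum.swap)
    also have "\<dots> = (\<Sum>j\<in>UNIV. (norm (column j M))\<^sup>2)"
      unfolding power2_norm_eq_inner by (simp add: inner_vec_def power2_eq_square column_def)
    finally show ?thesis .
  qed
  have c: "column j (A ** B) = A *v column j B" for j
    by (simp add: column_def matrix_matrix_mult_def matrix_vector_mult_def)
  have "(norm (A ** B))\<^sup>2 = (\<Sum>j\<in>UNIV. (norm (A *v column j B))\<^sup>2)"
    by (simp add: n[of "A ** B"] c)
  also have "\<dots> \<le> (\<Sum>j\<in>UNIV. (norm A)\<^sup>2 * (norm (column j B))\<^sup>2)"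
    by (intro sum_mono) (metis norm_matrix_vector_le norm_ge_zero power_mono power_mult_distrib)
  also have "\<dots> = (norm A * norm B)\<^sup>2"
    by (simp add: n[of B] power_mult_distrib sum_distrib_left)
  finally show ?thesis by (rule power2_le_imp_le) simp
qed

lemma mat_power_0 [simp]: "mat_power A 0 = mat 1"
  and mat_power_Suc: "mat_power A (Suc m) = A ** mat_power A m"
  unfolding mat_power_def by simp_all

lemma mat_power_add: "mat_power A (k + m) = mat_power A k ** mat_power A m"
  by (induction k) (simp_all add: mat_power_Suc matrix_mul_assoc)

lemma mat_power_zero_mono: "mat_power A k = 0 \<Longrightarrow> k \<le> m \<Longrightarrow> mat_power A m = 0"
  by (metis le_add_diff_inverse mat_power_add times0_left)

lemma mat_power_commute: "A ** B = B ** A \<Longrightarrow> mat_power A m ** B = B ** mat_power A m"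
  by (induction m) (simp_all add: mat_power_Suc matrix_mul_assoc[symmetric], metis matrix_mul_assoc)

lemma mat_power_mult_commute:
  assumes "A ** B = B ** A"
  shows "mat_power (A ** B) m = mat_power A m ** mat_power B m"
proof (induction m)
  case (Suc m)
  have "mat_power (A ** B) (Suc m) = A ** (B ** mat_power A m) ** mat_power B m"
    by (simp add: mat_power_Suc Suc matrix_mul_assoc)
  also have "B ** mat_power A m = mat_power A m ** B" using mat_power_commute[OF assms] by simp
  finally show ?case by (simp add: mat_power_Suc matrix_mul_assoc)
qed simp

text \<open>For mixed products A^i B^j (A + B)^m the induction on m just moves one factor into A^i
  or B^j; at m = 0 either i >= a or j >= b.\<close>

lemma mat_power_add_eq_0:
  fixes A B :: "'a::comm_ring_1^'n^'n"
  assumes c: "A ** B = B ** A" and A: "mat_power A a = 0" and B: "mat_power B b = 0"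
  shows "mat_power (A + B) (a + b) = 0"
proof -
  have "\<forall>i j. a + b \<le> i + j + m \<longrightarrow> mat_power A i ** mat_power B j ** mat_power (A + B) m = 0" for m
  proof (induction m)
    case 0
    show ?case
    proof (intro allI impI)
      fix i j assume "a + b \<le> i + j + 0"
      then have "a \<le> i \<or> b \<le> j" by linarith
      then show "mat_power A i ** mat_power B j ** mat_power (A + B) 0 = 0"
        using mat_power_zero_mono[OF A] mat_power_zero_mono[OF B] by auto
    qed
  next
    case (Suc m)
    show ?case
    proof (intro allI impI)
      fix i j assume ij: "a + b \<le> i + j + Suc m"
      have "mat_power A i ** mat_power B j ** mat_power (A + B) (Suc m) =
         mat_power A i ** (mat_power B j ** A) ** mat_power (A + B) m
         + mat_power A i ** (mat_power B j ** B) ** mat_power (A + B) m"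
        by (simp add: mat_power_Suc mat_distribs matrix_mul_assoc)
      also have "mat_power B j ** A = A ** mat_power B j"
        using mat_power_commute[of B A] c by simp
      also have "mat_power A i ** (A ** mat_power B j) = mat_power A (Suc i) ** mat_power B j"
        by (simp add: mat_power_Suc mat_power_commute matrix_mul_assoc)
      also have "mat_power B j ** B = mat_power B (Suc j)"
        by (simp add: mat_power_Suc mat_power_commute)
      finally show "mat_power A i ** mat_power B j ** mat_power (A + B) (Suc m) = 0"
        using Suc[rule_format, of "Suc i" j] Suc[rule_format, of i "Suc j"] ij
        by simp
    qed
  qed
  from this[rule_format, of 0 0 "a + b"] show ?thesis by simp
qed

subsection \<open>Orthonormal frames and nilpotent traces\<close>

text \<open>Gram-Schmidt for an arbitrary positive definite form.\<close>

lemma posdef_orthonormal_span: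
  fixes h :: "'a::real_vector \<Rightarrow> 'a \<Rightarrow> real"
  assumes h: "bilinear h" and sym: "\<And>x y. h x y = h y x" and pos: "\<And>x. x \<noteq> 0 \<Longrightarrow> 0 < h x x"
    and fin: "finite A"
  shows "\<exists>B. finite B \<and> span B = span A \<and> (\<forall>x\<in>B. \<forall>y\<in>B. h x y = (if x = y then 1 else 0))"
  using fin
proof (induction A rule: finite_induct)
  case empty
  show ?case by (intro exI[of _ "{}"]) simp
next
  case (insert a A)
  then obtain B where B: "finite B" "span B = span A"
    and on: "\<And>x y. x \<in> B \<Longrightarrow> y \<in> B \<Longrightarrow> h x y = (if x = y then 1 else 0)" by blast
  define w where "w = a - (\<Sum>b\<in>B. h a b *\<^sub>R b)"
  have orth: "h w b = 0" if "b \<in> B" for b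
  proof -
    have "h w b = h a b - (\<Sum>c\<in>B. h a c * h c b)"
      unfolding w_def using h that
      by (simp add: bilinear_lsub bilinear_lmul linear_sum[of "\<lambda>x. h x b"] bilinear_def)
    also have "(\<Sum>c\<in>B. h a c * h c b) = (\<Sum>c\<in>B. if c = b then h a b else 0)"
      using on that by (intro sum.cong) auto
    finally show ?thesis using that B by simp
  qed
  have wa: "(\<Sum>b\<in>B. h a b *\<^sub>R b) \<in> span B"
    by (intro span_sum span_scale span_base)
  show ?case
  proof (cases "w = 0")
    case True
    then have "a \<in> span A" using wa B by (simp add: w_def)
    then have "span (insert a A) = span A" by (simp add: span_redundant)
    then show ?thesis using B on by blast
  next
    case False
    define r where "r = sqrt (h w w)"
    have r: "r > 0" "r * r = h w w" using pos[OF False] by (auto simp: r_def)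
    define e where "e = (1 / r) *\<^sub>R w"
    have ee: "h e e = 1" using r(1) h
      by (simp add: e_def bilinear_lmul bilinear_rmul r(2)[symmetric])
    have eb: "h e b = 0" "h b e = 0" if "b \<in> B" for b
      using orth[OF that] sym[of b e] h by (auto simp: e_def bilinear_lmul)
    have "span (insert e B) = span (insert a A)"
      unfolding span_eq
    proof (intro conjI)
      have "a = r *\<^sub>R e + (\<Sum>b\<in>B. h a b *\<^sub>R b)" using r by (simp add: e_def w_def)
      moreover have "(\<Sum>b\<in>B. h a b *\<^sub>R b) \<in> span (insert e B)"
        using wa span_mono[of B "insert e B"] by blast
      ultimately have "a \<in> span (insert e B)"
        by (metis insertI1 span_add span_base span_scale)
      moreover have "A \<subseteq> span (insert e B)"
        using B(2) span_superset[of A] span_mono[of B "insert e B"] by blast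
      ultimately show "insert a A \<subseteq> span (insert e B)" by blast
      have "(\<Sum>b\<in>B. h a b *\<^sub>R b) \<in> span (insert a A)"
        using wa B span_mono[of A "insert a A"] by blast
      then have "w \<in> span (insert a A)" unfolding w_def by (intro span_diff) (simp_all add: span_base)
      then have "e \<in> span (insert a A)" unfolding e_def by (rule span_scale)
      moreover have "B \<subseteq> span (insert a A)"
        using B(2) span_superset[of B] span_mono[of A "insert a A"] by blast
      ultimately show "insert e B \<subseteq> span (insert a A)" by blast
    qed
    moreover have "e \<notin> B" using eb ee by auto
    ultimately show ?thesis
      using B(1) on ee eb by (intro exI[of _ "insert e B"]) auto
  qed
qed

text \<open>R takes coordinates in an \<open>h\<close>-orthonormal basis. Conjugation by R
  transports matrix estimates for the standard inner product to \<open>h\<close>.\<close>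

lemma posdef_frame:
  fixes h :: "real^'v \<Rightarrow> real^'v \<Rightarrow> real"
  assumes h: "bilinear h" and sym: "\<And>x y. h x y = h y x" and pos: "\<And>x. x \<noteq> 0 \<Longrightarrow> 0 < h x x"
  shows "\<exists>R R' :: real^'v^'v. R ** R' = mat 1 \<and> R' ** R = mat 1 \<and> (\<forall>x y. h x y = (R *v x) \<bullet> (R *v y))"
proof -
  obtain B where B: "finite B" "span B = span (Basis :: (real^'v) set)"
    and on: "\<And>x y. x \<in> B \<Longrightarrow> y \<in> B \<Longrightarrow> h x y = (if x = y then 1 else 0)"
    using posdef_orthonormal_span[OF h sym pos finite_Basis] by blast
  have hsum: "h (\<Sum>b\<in>B. c b *\<^sub>R b) y = (\<Sum>b\<in>B. c b * h b y)" for c y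
  proof -
    have l: "linear (\<lambda>x. h x y)" using h by (simp add: bilinear_def)
    show ?thesis by (simp add: linear_sum[OF l] linear_cmul[OF l])
  qed
  have exp: "v = (\<Sum>b\<in>B. h v b *\<^sub>R b)" for v
  proof -
    have "v \<in> span B" using B(2) by simp
    then obtain c where c: "v = (\<Sum>b\<in>B. c b *\<^sub>R b)" using B(1) by (auto simp: span_finite)
    have "h v b = c b" if "b \<in> B" for b
    proof -
      have "h v b = (\<Sum>b'\<in>B. if b' = b then c b else 0)"
        unfolding c hsum using on that by (intro sum.cong) auto
      then show ?thesis using B(1) that by simp
    qed
    then show ?thesis using c by simp
  qed
  have ind: "independent B"
  proof (rule independent_if_scalars_zero[OF B(1)])
    fix f b assume "(\<Sum>x\<in>B. f x *\<^sub>R x) = 0" "b \<in> B"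
    moreover have "h (\<Sum>x\<in>B. f x *\<^sub>R x) b = (\<Sum>x\<in>B. if x = b then f b else 0)"
      unfolding hsum using on \<open>b \<in> B\<close> by (intro sum.cong) auto
    ultimately show "f b = 0" using B(1) h by (simp add: bilinear_lzero)
  qed
  have "card B = CARD('v)"
    using dim_eq_card[OF _ ind, of "UNIV :: (real^'v) set"] B(2) by simp
  then obtain f :: "'v \<Rightarrow> real^'v" where f: "bij_betw f UNIV B"
    using finite_same_card_bij[OF finite_class.finite_UNIV B(1)] by auto
  define R :: "real^'v^'v" where "R = (\<chi> i j. h (axis j 1) (f i))"
  define R' :: "real^'v^'v" where "R' = (\<chi> i j. f j $ i)"
  have Rv: "(R *v x) $ i = h x (f i)" for x i
  proof -
    have l: "linear (\<lambda>x. h x (f i))" using h by (simp add: bilinear_def)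
    have "h x (f i) = h (\<Sum>j\<in>UNIV. x $ j *\<^sub>R axis j 1) (f i)"
      using basis_expansion[of x] by (simp add: scalar_mult_eq_scaleR)
    then show ?thesis
      by (simp add: linear_sum[OF l] linear_cmul[OF l] R_def matrix_vector_mult_def mult.commute)
  qed
  have R'v: "R' *v w = (\<Sum>i\<in>UNIV. w $ i *\<^sub>R f i)" for w
    by (simp add: R'_def matrix_vector_mult_def vec_eq_iff mult.commute)
  have "(R' ** R) *v x = x" for x
  proof -
    have "(R' ** R) *v x = (\<Sum>i\<in>UNIV. h x (f i) *\<^sub>R f i)"
      by (simp add: matrix_vector_mul_assoc[symmetric] R'v Rv)
    also have "\<dots> = (\<Sum>b\<in>B. h x b *\<^sub>R b)" by (rule sum.reindex_bij_betw[OF f])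
    finally show ?thesis using exp by simp
  qed
  then have R'R: "R' ** R = mat 1" by (simp add: matrix_eq)
  moreover have "R ** R' = mat 1" using R'R matrix_left_right_inverse by blast
  moreover have "h x y = (R *v x) \<bullet> (R *v y)" for x y
  proof -
    have "h x y = (\<Sum>b\<in>B. h x b * h b y)" using hsum[of "h x" y] exp[of x] by simp
    also have "\<dots> = (\<Sum>i\<in>UNIV. h x (f i) * h y (f i))"
      using sum.reindex_bij_betw[OF f, of "\<lambda>b. h x b * h b y"] by (simp add: sym)
    finally show ?thesis by (simp add: inner_vec_def Rv)
  qed
  ultimately show ?thesis by blast
qed

text \<open>In a frame adapted to \<open>\<Sum>m. s\<^sup>2\<^sup>m \<bar>A\<^sup>m x\<bar>\<^sup>2\<close> the nilpotent matrix \<open>A\<close> has norm at most \<open>1 / s\<close>.\<close>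

lemma trace_nilpotent:
  fixes A :: "real^'v^'v"
  assumes "mat_nilpotent A"
  shows "trace A = 0"
proof -
  obtain d where d: "mat_power A d = 0" using assms by (auto simp: mat_nilpotent_def)
  have bound: "\<bar>trace A\<bar> * s \<le> CARD('v)" if s: "s > 0" for s :: real
  proof -
    define h where "h x y = (\<Sum>m<Suc d. s^(2*m) * ((mat_power A m *v x) \<bullet> (mat_power A m *v y)))" for x y :: "real^'v"
    have h: "bilinear h"
      unfolding bilinear_def h_def
      by (auto intro!: linearI simp: matrix_vector_right_distrib inner_add_left inner_add_right
          distrib_left sum.distrib matrix_vector_mult_scaleR sum_distrib_left mult.left_commute)
    have sym: "h x y = h y x" for x y unfolding h_def by (simp add: inner_commute)
    \<comment> \<open>Shifting the index of the sum, which A^d = 0 permits, shows that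
      \<open>A\<close> contracts this norm by the factor 1 / s.\<close>
    have h0: "h x x = x \<bullet> x + s\<^sup>2 * h (A *v x) (A *v x)" for x
    proof -
      have "h (A *v x) (A *v x) = (\<Sum>m<d. s^(2*m) * ((mat_power A (Suc m) *v x) \<bullet> (mat_power A (Suc m) *v x)))"
        unfolding h_def using d
        by (simp add: matrix_vector_mul_assoc mat_power_Suc mat_power_commute)
      then have "s\<^sup>2 * h (A *v x) (A *v x) = (\<Sum>m<d. s^(2*Suc m) * ((mat_power A (Suc m) *v x) \<bullet> (mat_power A (Suc m) *v x)))"
        by (simp add: sum_distrib_left power2_eq_square mult.assoc)
      then show ?thesis
        by (simp only: h_def sum.lessThan_Suc_shift) simp
    qed
    have h_nonneg: "h x x \<ge> 0" for x unfolding h_def using s by (intro sum_nonneg) auto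
    have pos: "0 < h x x" if "x \<noteq> 0" for x
      using h0[of x] h_nonneg[of "A *v x"] s that
      by (smt (verit) inner_gt_zero_iff mult_nonneg_nonneg zero_le_power2)
    obtain R R' :: "real^'v^'v" where R: "R ** R' = mat 1" "R' ** R = mat 1"
      and hR: "\<And>x y. h x y = (R *v x) \<bullet> (R *v y)"
      using posdef_frame[OF h sym pos] by blast
    define M where "M = R ** A ** R'"
    have small: "s * norm (M *v w) \<le> norm w" for w
    proof -
      define x where "x = R' *v w"
      have Rx: "R *v x = w" by (simp add: x_def matrix_vector_mul_assoc R)
      have Mw: "M *v w = R *v (A *v x)" by (simp add: M_def x_def matrix_vector_mul_assoc matrix_mul_assoc)
      have "s\<^sup>2 * h (A *v x) (A *v x) \<le> h x x" using h0[of x] by simp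
      then have "(s * norm (M *v w))\<^sup>2 \<le> (norm w)\<^sup>2"
        by (simp add: hR Rx Mw power_mult_distrib power2_norm_eq_inner)
      then show ?thesis by (rule power2_le_imp_le) simp
    qed
    have "trace A = trace M"
      unfolding M_def using trace_mul_sym[of "R ** A" R'] R by (simp add: matrix_mul_assoc)
    also have "\<bar>trace M\<bar> \<le> (\<Sum>i\<in>UNIV. \<bar>M $ i $ i\<bar>)" unfolding trace_def by (rule sum_abs)
    also have "\<dots> \<le> (\<Sum>i\<in>(UNIV::'v set). 1 / s)"
    proof (rule sum_mono)
      fix i :: 'v
      have "M $ i $ i = (M *v axis i 1) $ i" by (simp add: matrix_vector_mult_basis column_def)
      then have "\<bar>M $ i $ i\<bar> \<le> norm (M *v axis i 1)" by (metis component_le_norm_cart)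
      then have "s * \<bar>M $ i $ i\<bar> \<le> 1"
        using small[of "axis i 1"] s by (smt (verit) mult_left_mono norm_axis_1)
      then show "\<bar>M $ i $ i\<bar> \<le> 1 / s" using s by (simp add: field_simps)
    qed
    finally show ?thesis using s by (simp add: field_simps)
  qed
  show ?thesis
  proof (rule ccontr)
    assume t: "trace A \<noteq> 0"
    define s :: real where "s = (real CARD('v) + 1) / \<bar>trace A\<bar>"
    have "s > 0" using t by (simp add: s_def)
    from bound[OF this] show False using t by (simp add: s_def)
  qed
qed

subsection \<open>Differential inequalities on a half line\<close>

lemma derivative_nonneg_mono:
  fixes f f' :: "real \<Rightarrow> real"
  assumes "\<And>x. l < x \<Longrightarrow> (f has_real_derivative f' x) (at x)"
    and "\<And>x. a \<le> x \<Longrightarrow> 0 \<le> f' x" and "l < a" "a \<le> b"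
  shows "f a \<le> f b"
proof (rule DERIV_nonneg_imp_nondecreasing[OF assms(4)])
  fix x assume "a \<le> x"
  then show "\<exists>y. (f has_real_derivative y) (at x) \<and> 0 \<le> y"
    using assms(1)[of x] assms(2)[of x] assms(3) by auto
qed

text \<open>The inequality says (1 / g)' >= 1 / K wherever g < 0, so a negative g reaches minus
  infinity in finite time, which a function on the whole half line cannot do.\<close>

lemma riccati_nonneg:
  fixes g g' :: "real \<Rightarrow> real"
  assumes der: "\<And>x. l < x \<Longrightarrow> (g has_real_derivative g' x) (at x)"
    and ric: "\<And>x. l < x \<Longrightarrow> (g x)\<^sup>2 \<le> - K * g' x" and K: "K > 0" and a: "l < a"
  shows "0 \<le> g a"
proof (rule ccontr)
  assume neg: "\<not> 0 \<le> g a"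
  have g': "g' x \<le> 0" if "l < x" for x
    using ric[OF that] K by (smt (verit) mult_pos_pos zero_le_power2 mult_minus_left)
  have dec: "g x \<le> g a" if "a \<le> x" for x
    using derivative_nonneg_mono[of l "\<lambda>x. - g x" "\<lambda>x. - g' x" a x] der g' a that
    by (auto intro!: derivative_eq_intros)
  have gneg: "g x < 0" if "a \<le> x" for x using dec[OF that] neg by linarith
  \<comment> \<open>The latest possible blow-up time, by which 1 / g would have climbed from 1 / g a
    to 0.\<close>
  define b where "b = a - K / g a"
  have ab: "a \<le> b" using neg K by (simp add: b_def field_simps)
  have "1 / g a - a / K \<le> 1 / g b - b / K"
  proof (rule DERIV_nonneg_imp_nondecreasing[OF ab])
    fix x assume x: "a \<le> x" "x \<le> b"
    have "((\<lambda>x. 1 / g x - x / K) has_real_derivative (- g' x / (g x)\<^sup>2 - 1 / K)) (at x)"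
      using gneg[OF x(1)] x(1) a K by (auto intro!: derivative_eq_intros der simp: power2_eq_square)
    moreover have "0 \<le> - g' x / (g x)\<^sup>2 - 1 / K"
      using ric[of x] gneg[OF x(1)] x(1) a K by (simp add: field_simps)
    ultimately show "\<exists>y. ((\<lambda>x. 1 / g x - x / K) has_real_derivative y) (at x) \<and> 0 \<le> y" by blast
  qed
  moreover have "b / K = a / K - 1 / g a" using K by (simp add: b_def diff_divide_distrib)
  ultimately have "0 \<le> 1 / g b" by simp
  then show False using gneg[OF ab] by (simp add: zero_le_divide_iff)
qed

text \<open>
  A logarithmically convex function increasing somewhere has logarithmic derivative bounded below
  by a positive constant from there on; this would force \<open>g\<close> to decrease at least linearly.
\<close>

lemma log_convex_nonincreasing:
  fixes f f' f'' g w :: "real \<Rightarrow> real"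
  assumes f: "\<And>x. l < x \<Longrightarrow> (f has_real_derivative f' x) (at x)"
    and df': "\<And>x. l < x \<Longrightarrow> (f' has_real_derivative f'' x) (at x)"
    and pos: "\<And>x. l < x \<Longrightarrow> 0 < f x"
    and conv: "\<And>x. l < x \<Longrightarrow> (f' x)\<^sup>2 \<le> f x * f'' x"
    and growth: "\<And>x. l < x \<Longrightarrow> f' x \<le> (4 * sqrt (w x) + 1 / x) * f x"
    and g: "\<And>x. l < x \<Longrightarrow> (g has_real_derivative - w x) (at x)"
    and g_nonneg: "\<And>x. l < x \<Longrightarrow> 0 \<le> g x"
    and l: "0 \<le> l" and a: "l < a" "a \<le> b"
  shows "f b \<le> f a"
proof -
  have "f' x \<le> 0" if x: "l < x" for x
  proof (rule ccontr)
    assume neg: "\<not> f' x \<le> 0"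
    define c where "c = f' x / f x"
    have c: "c > 0" using neg pos[OF x] by (simp add: c_def)
    have mono: "c \<le> f' y / f y" if "x \<le> y" for y
      unfolding c_def
    proof (rule derivative_nonneg_mono[OF _ _ x that])
      fix z assume "l < z"
      then show "((\<lambda>x. f' x / f x) has_real_derivative (f'' z * f z - f' z * f' z) / (f z * f z)) (at z)"
        using pos[of z] by (auto intro!: derivative_eq_intros f df')
    next
      fix z assume "x \<le> z"
      then show "0 \<le> (f'' z * f z - f' z * f' z) / (f z * f z)"
        using conv[of z] x by (simp add: power2_eq_square mult.commute)
    qed
    \<comment> \<open>Beyond 2 / c the term 1 / x accounts for at most half of the rate c; the other
      half falls to 4 sqrt (w x), whence the bound c / 8.\<close>
    define x0 where "x0 = max x (2 / c)"
    have w: "(c / 8)\<^sup>2 \<le> w y" if y: "x0 \<le> y" for y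
    proof -
      have xy: "x \<le> y" "2 / c \<le> y" "l < y" "0 < y" using y x l by (auto simp: x0_def)
      have "c \<le> f' y / f y" using mono xy by blast
      also have "\<dots> \<le> 4 * sqrt (w y) + 1 / y"
        using growth[OF xy(3)] pos[OF xy(3)] by (simp add: divide_le_eq)
      also have "1 / y \<le> c / 2" using xy c by (simp add: field_simps)
      finally have "c / 8 \<le> sqrt (w y)" by simp
      then have "(c / 8)\<^sup>2 \<le> (sqrt (w y))\<^sup>2" using c by (intro power_mono) auto
      moreover have "0 < sqrt (w y)" using \<open>c / 8 \<le> sqrt (w y)\<close> c by linarith
      ultimately show ?thesis by simp
    qed
    have lx0: "l < x0" using x by (simp add: x0_def)
    define k where "k = (c / 8)\<^sup>2"
    have k: "k > 0" using c by (simp add: k_def)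
    \<comment> \<open>Decreasing at rate at least k from x0 on, g would be at most -1 here.\<close>
    define y where "y = x0 + (g x0 + 1) / k"
    have y: "x0 \<le> y" using g_nonneg[OF lx0] k by (simp add: y_def)
    have "- g x0 - k * x0 \<le> - g y - k * y"
    proof (rule derivative_nonneg_mono[OF _ _ lx0 y])
      fix z assume "l < z"
      then show "((\<lambda>x. - g x - k * x) has_real_derivative (w z - k)) (at z)"
        by (auto intro!: derivative_eq_intros g)
    next
      fix z assume "x0 \<le> z"
      then show "0 \<le> w z - k" using w by (simp add: k_def)
    qed
    moreover have "k * y = k * x0 + g x0 + 1" using k by (simp add: y_def field_simps)
    ultimately have "g y < 0" by linarith
    then show False using g_nonneg[of y] lx0 y by simp
  qed
  then have "- f a \<le> - f b"
    using a by (intro derivative_nonneg_mono[of l "\<lambda>x. - f x" "\<lambda>x. - f' x"])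
      (auto intro!: derivative_eq_intros f)
  then show ?thesis by simp
qed

subsection \<open>The equations of a one-parameter nilpotent orbit\<close>

lemma linear_ad: "linear (ad X)"
  unfolding ad_def by (auto intro!: linearI simp: mat_distribs algebra_simps)

lemma linear_ad_left: "linear (\<lambda>Z. ad Z X)"
  unfolding ad_def by (auto intro!: linearI simp: mat_distribs algebra_simps)

lemma ad_self [simp]: "ad X X = 0" and ad_zero_left [simp]: "ad 0 X = 0" and ad_zero_right [simp]: "ad X 0 = 0"
  unfolding ad_def by simp_all

lemma ad_anti: "ad X Y = - ad Y X"
  unfolding ad_def by simp

lemmas ad_linear_simps = linear_add[OF linear_ad] linear_diff[OF linear_ad] linear_neg[OF linear_ad]
  linear_cmul[OF linear_ad] linear_add[OF linear_ad_left] linear_diff[OF linear_ad_left]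
  linear_neg[OF linear_ad_left] linear_cmul[OF linear_ad_left]

lemma ad_jacobi: "ad (ad X Y) Z = ad X (ad Y Z) - ad Y (ad X Z)"
  unfolding ad_def by (simp add: mat_distribs matrix_mul_assoc)

text \<open>
  \<open>J l\<close> is the infinitesimal Hodge operator (multiplication by \<open>\<i> (p - q) / 2\<close> on \<open>H\<^sup>p\<^sup>,\<^sup>q\<close>) and
  \<open>C l\<close> the Weil operator of the Hodge structure \<open>exp (\<i> l N) F\<close>; \<open>e\<close> is the sign \<open>(-1)^n\<close>.
\<close>

locale hodge_line =
  fixes g :: "(real^'v^'v) set" and N :: "real^'v^'v" and J C :: "real \<Rightarrow> real^'v^'v" and e l0 :: real
  assumes sub: "subspace g" and bracket: "\<And>X Y. X \<in> g \<Longrightarrow> Y \<in> g \<Longrightarrow> ad X Y \<in> g"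
    and N_g: "N \<in> g" and J_g: "\<And>l. l0 < l \<Longrightarrow> J l \<in> g"
    and ee: "e * e = 1" and l0: "0 \<le> l0"
    and CC: "\<And>l. l0 < l \<Longrightarrow> C l ** C l = e *\<^sub>R mat 1"
    and CJ: "\<And>l. l0 < l \<Longrightarrow> C l ** J l = J l ** C l"
    and CN: "\<And>l. l0 < l \<Longrightarrow> C l ** N = (N - 2 *\<^sub>R ad (J l) (ad N (J l))) ** C l"
    and triple: "\<And>l. l0 < l \<Longrightarrow> ad (J l) (ad (J l) (ad (J l) N)) = - ad (J l) N"
    and J_deriv: "\<And>l. l0 < l \<Longrightarrow> (J has_vector_derivative ad (ad N (J l)) (J l)) (at l)"
    and C_deriv: "\<And>l. l0 < l \<Longrightarrow> (C has_vector_derivative ad (ad N (J l)) (C l)) (at l)"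
    and frame: "\<And>l. l0 < l \<Longrightarrow> \<exists>R R' :: real^'v^'v. R ** R' = mat 1 \<and> R' ** R = mat 1 \<and>
       (\<forall>X\<in>g. \<forall>Y\<in>g. - e * trace (X ** C l ** Y ** C l) = (R ** X ** R') \<bullet> (R ** Y ** R'))"
    and trace_NN: "trace (N ** N) = 0"
begin

text \<open>Split N by Hodge type into parts of types (-1, 1), (0, 0) and (1, -1). Since ad J is
  multiplication by i k on type (k, -k), \<open>eta\<close> is the sum of the two outer parts,
  \<open>N0\<close> the middle part, and \<open>xi\<close> is i times a difference of the outer
  parts.\<close>

definition xi :: "real \<Rightarrow> real^'v^'v" where "xi l = ad N (J l)"
definition eta :: "real \<Rightarrow> real^'v^'v" where "eta l = ad (J l) (xi l)"
definition N0 :: "real \<Rightarrow> real^'v^'v" where "N0 l = N - eta l"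
text \<open>As C^-1 = e C, this is - trace (X C Y C^-1): the trace form made definite by the
  involution Ad C, as a Killing form is by a Cartan involution.\<close>

definition B :: "real \<Rightarrow> real^'v^'v \<Rightarrow> real^'v^'v \<Rightarrow> real" where
  "B l X Y = - e * trace (X ** C l ** Y ** C l)"

lemma B_add_left: "B l (X + Y) Z = B l X Z + B l Y Z"
  and B_add_right: "B l Z (X + Y) = B l Z X + B l Z Y"
  and B_diff_left: "B l (X - Y) Z = B l X Z - B l Y Z"
  and B_diff_right: "B l Z (X - Y) = B l Z X - B l Z Y"
  and B_minus_left: "B l (- X) Z = - B l X Z"
  and B_minus_right: "B l Z (- X) = - B l Z X"
  and B_scale_left: "B l (c *\<^sub>R X) Z = c * B l X Z"
  and B_scale_right: "B l Z (c *\<^sub>R X) = c * B l Z X"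
  unfolding B_def by (simp_all add: mat_distribs trace_simps algebra_simps)

lemmas B_simps = B_add_left B_add_right B_diff_left B_diff_right B_minus_left B_minus_right
  B_scale_left B_scale_right

lemma B_sym: "B l X Y = B l Y X"
  unfolding B_def using trace_mul_sym[of "X ** C l" "Y ** C l"] by (simp add: matrix_mul_assoc)

section \<open>Algebra and derivatives at one point of the line\<close>

context fixes l assumes l: "l0 < l"
begin

lemma g_mem: "xi l \<in> g" "eta l \<in> g" "N0 l \<in> g"
  unfolding N0_def eta_def xi_def using sub bracket N_g J_g[OF l]
  by (auto intro!: subspace_diff)

lemma ad_eta_J: "ad (eta l) (J l) = xi l"
proof -
  have "ad (eta l) (J l) = - ad (J l) (ad (J l) (- ad (J l) N))"
    unfolding eta_def xi_def by (metis ad_anti)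
  also have "\<dots> = ad (J l) (ad (J l) (ad (J l) N))" by (simp add: ad_linear_simps)
  also have "\<dots> = xi l" using triple[OF l] ad_anti[of N "J l"] by (simp add: xi_def)
  finally show ?thesis .
qed

lemma CN': "C l ** N = (N - 2 *\<^sub>R eta l) ** C l"
  unfolding eta_def xi_def by (rule CN[OF l])

text \<open>The relation for C N says that Ad C sends N to N - 2 eta. Bracketing with J, which Ad C
  fixes, shows that it sends xi to xi - 2 [eta, J] = - xi.\<close>

lemma C_xi: "C l ** xi l = - (xi l ** C l)"
proof -
  have 1: "C l ** N ** J l = (N - 2 *\<^sub>R eta l) ** J l ** C l"
    unfolding CN' by (simp add: matrix_mul_assoc[symmetric] CJ[OF l])
  have 2: "C l ** J l ** N = J l ** (N - 2 *\<^sub>R eta l) ** C l"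
    unfolding CJ[OF l] by (simp add: matrix_mul_assoc[symmetric] CN')
  have "C l ** xi l = C l ** N ** J l - C l ** J l ** N"
    unfolding xi_def ad_def by (simp add: mat_distribs matrix_mul_assoc)
  also have "\<dots> = (xi l - 2 *\<^sub>R ad (eta l) (J l)) ** C l"
    unfolding 1 2 xi_def ad_def by (simp add: mat_distribs matrix_mul_assoc algebra_simps)
  also have "\<dots> = - (xi l ** C l)"
    unfolding ad_eta_J by (simp add: mat_distribs scaleR_2)
  finally show ?thesis .
qed

lemma C_eta: "C l ** eta l = - (eta l ** C l)"
proof -
  have "C l ** eta l = (C l ** J l) ** xi l - (C l ** xi l) ** J l"
    unfolding eta_def ad_def by (simp add: mat_distribs matrix_mul_assoc)
  also have "\<dots> = J l ** (C l ** xi l) + xi l ** (C l ** J l)"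
    unfolding C_xi CJ[OF l] by (simp add: mat_distribs matrix_mul_assoc[symmetric] CJ[OF l] C_xi)
  also have "\<dots> = - (eta l ** C l)"
    unfolding C_xi CJ[OF l] unfolding eta_def ad_def by (simp add: mat_distribs matrix_mul_assoc)
  finally show ?thesis .
qed

lemma C_N0: "C l ** N0 l = N0 l ** C l"
proof -
  have "C l ** N0 l = (N - 2 *\<^sub>R eta l) ** C l + eta l ** C l"
    unfolding N0_def matrix_diff_ldistrib CN' C_eta by simp
  also have "\<dots> = (N - 2 *\<^sub>R eta l + eta l) ** C l" by (rule matrix_add_rdistrib[symmetric])
  also have "N - 2 *\<^sub>R eta l + eta l = N0 l" unfolding N0_def scaleR_2 by (rule vec_eq_iff[THEN iffD2]) simp
  finally show ?thesis .
qed

text \<open>Cyclicity of the trace, with a sign for each passage of Z across C. Elements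
  anticommuting with C act self-adjointly, and commuting ones, in the next lemma,
  skew-adjointly.\<close>

lemma B_ad_anti:
  assumes "C l ** Z = - (Z ** C l)"
  shows "B l (ad Z X) Y = B l X (ad Z Y)"
proof -
  have 1: "trace (Z ** X ** C l ** Y ** C l) = - trace (X ** C l ** Y ** Z ** C l)"
    using trace_mul_sym[of Z "X ** C l ** Y ** C l"] assms
    by (simp add: matrix_mul_assoc[symmetric] mat_distribs trace_minus)
  have "X ** Z ** C l ** Y ** C l = - (X ** (C l ** Z) ** Y ** C l)"
    by (simp add: assms mat_distribs matrix_mul_assoc)
  then have 2: "trace (X ** Z ** C l ** Y ** C l) = - trace (X ** C l ** Z ** Y ** C l)"
    by (simp add: trace_minus matrix_mul_assoc)
  show ?thesis
    unfolding B_def ad_def by (simp add: mat_distribs trace_simps matrix_mul_assoc 1 2)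
qed

lemma B_ad_comm:
  assumes "C l ** Z = Z ** C l"
  shows "B l (ad Z X) Y = - B l X (ad Z Y)"
proof -
  have 1: "trace (Z ** X ** C l ** Y ** C l) = trace (X ** C l ** Y ** Z ** C l)"
    using trace_mul_sym[of Z "X ** C l ** Y ** C l"] assms
    by (simp add: matrix_mul_assoc[symmetric])
  have "X ** Z ** C l ** Y ** C l = X ** (C l ** Z) ** Y ** C l"
    by (simp add: assms matrix_mul_assoc)
  then have 2: "trace (X ** Z ** C l ** Y ** C l) = trace (X ** C l ** Z ** Y ** C l)"
    by (simp add: matrix_mul_assoc)
  show ?thesis
    unfolding B_def ad_def by (simp add: mat_distribs trace_simps matrix_mul_assoc 1 2 algebra_simps)
qed

lemmas B_xi = B_ad_anti[OF C_xi] and B_eta = B_ad_anti[OF C_eta] and B_N0 = B_ad_comm[OF C_N0]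

lemma trace_CC: "trace (X ** C l ** C l) = e * trace X"
  by (simp add: matrix_mul_assoc[symmetric] CC[OF l] mat_distribs trace_simps)

text \<open>Ad C preserves the trace, so its eigenspaces for -1 and 1 are orthogonal under the trace
  form.\<close>

lemma trace_anti_comm:
  assumes "C l ** A = - (A ** C l)" "C l ** D = D ** C l"
  shows "trace (A ** D) = 0"
proof -
  have "e * trace (A ** D) = trace (C l ** A ** D ** C l)"
    using trace_mul_sym[of "A ** D ** C l" "C l"] by (simp add: trace_CC matrix_mul_assoc)
  also have "C l ** A ** D ** C l = - (A ** D ** C l ** C l)"
    using assms by (simp add: mat_distribs matrix_mul_assoc[symmetric])
  finally have "e * trace (A ** D) = 0" by (simp add: trace_minus trace_CC)
  then show ?thesis using ee by auto
qed

lemma B_anti: assumes "C l ** Z = - (Z ** C l)" shows "B l X Z = trace (X ** Z)"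
proof -
  have "X ** C l ** Z ** C l = - (X ** Z ** C l ** C l)"
    using assms by (simp add: mat_distribs matrix_mul_assoc[symmetric])
  then show ?thesis unfolding B_def using ee by (simp add: trace_minus trace_CC mult.assoc[symmetric])
qed

lemma B_comm: assumes "C l ** Z = Z ** C l" shows "B l X Z = - trace (X ** Z)"
proof -
  have "X ** C l ** Z ** C l = X ** Z ** C l ** C l"
    using assms by (simp add: matrix_mul_assoc[symmetric])
  then show ?thesis unfolding B_def using ee by (simp add: trace_CC mult.assoc[symmetric])
qed

lemma obtain_frame:
  obtains R R' :: "real^'v^'v" where "R ** R' = mat 1" "R' ** R = mat 1"
    "\<And>X Y. X \<in> g \<Longrightarrow> Y \<in> g \<Longrightarrow> B l X Y = (R ** X ** R') \<bullet> (R ** Y ** R')"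
  using frame[OF l] unfolding B_def by blast

lemma B_nonneg: "X \<in> g \<Longrightarrow> 0 \<le> B l X X"
  by (rule obtain_frame) simp

lemma B_pos: assumes "X \<in> g" "X \<noteq> 0" shows "0 < B l X X"
proof -
  obtain R R' :: "real^'v^'v" where R: "R ** R' = mat 1" "R' ** R = mat 1"
    and B: "\<And>X Y. X \<in> g \<Longrightarrow> Y \<in> g \<Longrightarrow> B l X Y = (R ** X ** R') \<bullet> (R ** Y ** R')"
    by (rule obtain_frame) blast
  have "R' ** (R ** X ** R') ** R = (R' ** R) ** X ** (R' ** R)" by (simp add: matrix_mul_assoc)
  then have "R' ** (R ** X ** R') ** R = X" by (simp add: R)
  then have "R ** X ** R' \<noteq> 0" using assms(2) by auto
  then show ?thesis using B[OF assms(1) assms(1)] by simp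
qed

lemma B_Cauchy_Schwarz: assumes "X \<in> g" "Y \<in> g" shows "(B l X Y)\<^sup>2 \<le> B l X X * B l Y Y"
  by (rule obtain_frame) (use assms Cauchy_Schwarz_ineq in auto)

text \<open>In the frame, \<open>B\<close> is the Frobenius inner product, for which |[z, x]| <= 2
  |z| |x|.\<close>

lemma B_growth: assumes Z: "Z \<in> g" and X: "X \<in> g"
  shows "\<bar>B l (ad Z X) X\<bar> \<le> 2 * sqrt (B l Z Z) * B l X X"
proof -
  obtain R R' :: "real^'v^'v" where R: "R ** R' = mat 1" "R' ** R = mat 1"
    and B: "\<And>X Y. X \<in> g \<Longrightarrow> Y \<in> g \<Longrightarrow> B l X Y = (R ** X ** R') \<bullet> (R ** Y ** R')"
    by (rule obtain_frame) blast
  define z x where "z = R ** Z ** R'" and "x = R ** X ** R'"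
  have m: "R ** (A ** D) ** R' = (R ** A ** R') ** (R ** D ** R')" for A D :: "real^'v^'v"
  proof -
    have "(R ** A ** R') ** (R ** D ** R') = R ** A ** (R' ** R) ** D ** R'" by (simp add: matrix_mul_assoc)
    then show ?thesis by (simp add: R matrix_mul_assoc)
  qed
  have "R ** ad Z X ** R' = z ** x - x ** z"
    unfolding ad_def z_def x_def m[symmetric] by (simp add: mat_distribs)
  then have "B l (ad Z X) X = (z ** x - x ** z) \<bullet> x"
    using B[OF bracket[OF Z X] X] by (simp add: x_def)
  also have "\<bar>\<dots>\<bar> \<le> norm (z ** x - x ** z) * norm x" by (rule Cauchy_Schwarz_ineq2)
  also have "\<dots> \<le> (norm z * norm x + norm x * norm z) * norm x"
    by (intro mult_right_mono order_trans[OF norm_triangle_ineq4] add_mono norm_matrix_mult_le) simp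
  also have "\<dots> = 2 * sqrt (z \<bullet> z) * (x \<bullet> x)"
    by (simp add: norm_eq_sqrt_inner[symmetric] power2_norm_eq_inner[symmetric] power2_eq_square)
  finally show ?thesis using B[OF Z Z] B[OF X X] by (simp add: z_def x_def)
qed

text \<open>All of \<open>xi\<close>, \<open>eta\<close>, \<open>N0\<close> have the same length:
  trace (N N) = 0 and trace-orthogonality give 0 = - |N0|^2 + |eta|^2, and |xi|^2 = trace (xi
  [N, J]) = trace ([J, xi] N) = trace (eta N).\<close>

lemma B_xi_xi: "B l (xi l) (xi l) = B l (eta l) (eta l)"
  and trace_eta_N: "trace (eta l ** N) = B l (eta l) (eta l)"
  and B_N0_N0: "B l (N0 l) (N0 l) = B l (eta l) (eta l)"
proof -
  have NN: "N = N0 l + eta l" by (simp add: N0_def)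
  have z: "trace (eta l ** N0 l) = 0" by (rule trace_anti_comm[OF C_eta C_N0])
  have z': "trace (N0 l ** eta l) = 0" using z trace_mul_sym by metis
  have ee: "B l (eta l) (eta l) = trace (eta l ** eta l)" by (rule B_anti[OF C_eta])
  show t: "trace (eta l ** N) = B l (eta l) (eta l)"
    unfolding ee by (subst NN) (simp add: mat_distribs trace_simps z)
  have "B l (xi l) (xi l) = trace (xi l ** (N ** J l)) - trace (xi l ** J l ** N)"
    unfolding B_anti[OF C_xi] by (subst (2) xi_def) (simp add: ad_def mat_distribs trace_simps matrix_mul_assoc)
  also have "trace (xi l ** (N ** J l)) = trace (J l ** xi l ** N)"
    using trace_mul_sym[of "xi l ** N" "J l"] by (simp add: matrix_mul_assoc)
  also have "trace (J l ** xi l ** N) - trace (xi l ** J l ** N) = trace (eta l ** N)"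
    unfolding eta_def ad_def by (simp add: mat_distribs trace_simps)
  finally show "B l (xi l) (xi l) = B l (eta l) (eta l)" using t by simp
  have "trace (N ** N) = trace (N0 l ** N0 l) + trace (eta l ** eta l)"
    by (subst (1 2) NN) (simp add: mat_distribs trace_simps z z')
  then show "B l (N0 l) (N0 l) = B l (eta l) (eta l)"
    using trace_NN ee B_comm[OF C_N0] by simp
qed

text \<open>The form moves only through C, with C' = [xi, C] = 2 xi C; cyclicity merges the
  contributions of its two occurrences into one bracket.\<close>

lemma B_deriv:
  assumes X: "(X has_vector_derivative X') (at l)"
  shows "((\<lambda>l. B l (X l) Y) has_real_derivative (- 2 * B l (ad (xi l) (X l)) Y + B l X' Y)) (at l)"
proof -
  note bb = bounded_bilinear.has_vector_derivative[OF bounded_bilinear_matrix_mult]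
  have C': "(C has_vector_derivative 2 *\<^sub>R (xi l ** C l)) (at l)"
    using C_deriv[OF l] unfolding xi_def[symmetric] ad_def[of "xi l"] C_xi scaleR_2 by simp
  have d: "((\<lambda>l. X l ** C l ** Y ** C l) has_vector_derivative
     (X l ** C l ** Y ** (2 *\<^sub>R (xi l ** C l)) + ((X l ** C l) ** 0 + (X l ** (2 *\<^sub>R (xi l ** C l)) + X' ** C l) ** Y) ** C l)) (at l)"
    by (intro bb X C' has_vector_derivative_const)
  have xC: "xi l ** C l = - (C l ** xi l)" by (simp add: C_xi)
  have "trace (X l ** C l ** Y ** (xi l ** C l)) = - trace (xi l ** X l ** C l ** Y ** C l)"
    using trace_mul_sym[of "xi l" "X l ** C l ** Y ** C l"]
    by (simp add: xC mat_distribs trace_minus matrix_mul_assoc)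
  then have t: "trace (X l ** C l ** Y ** (2 *\<^sub>R (xi l ** C l)) + ((X l ** C l) ** 0 + (X l ** (2 *\<^sub>R (xi l ** C l)) + X' ** C l) ** Y) ** C l)
      = - 2 * trace (ad (xi l) (X l) ** C l ** Y ** C l) + trace (X' ** C l ** Y ** C l)"
    by (simp add: ad_def mat_distribs trace_simps matrix_mul_assoc)
  have "((\<lambda>l. - e * trace (X l ** C l ** Y ** C l)) has_real_derivative
      - e * (- 2 * trace (ad (xi l) (X l) ** C l ** Y ** C l) + trace (X' ** C l ** Y ** C l))) (at l)"
    using bounded_linear.has_vector_derivative[OF bounded_linear_trace d]
    unfolding t has_real_derivative_iff_has_vector_derivative[symmetric]
    by (rule DERIV_cmult)
  then show ?thesis unfolding B_def by (simp add: algebra_simps)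
qed

lemma J_deriv': "(J has_vector_derivative - eta l) (at l)"
  using J_deriv[OF l] ad_anti[of "xi l" "J l"] by (simp add: eta_def xi_def)

lemma xi_deriv: "(xi has_vector_derivative ad (eta l) (N0 l)) (at l)"
proof -
  have "ad N (- eta l) = ad (eta l) (N0 l)"
    using ad_anti[of N "eta l"] by (simp add: N0_def ad_linear_simps)
  then show ?thesis
    using bounded_linear.has_vector_derivative[OF linear_ad[THEN linear_conv_bounded_linear[THEN iffD1]] J_deriv', of N]
    unfolding xi_def[abs_def] by simp
qed

lemma norm_deriv: "((\<lambda>l. B l X X) has_real_derivative - 2 * B l (ad (xi l) X) X) (at l)"
  using B_deriv[OF has_vector_derivative_const, of X X]
  by (simp add: B_def trace_def)

text \<open>Stated without [N, X] = 0 because Y in the twisted norm does not commute with N. If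
  [N, X] = 0, then [N0, X] = - [eta, X] and the derivative is 4 |[xi, X]|^2 + 4 |[eta, X]|^2, the
  source of log convexity.\<close>

lemma norm_deriv2:
  "((\<lambda>l. - 2 * B l (ad (xi l) X) X) has_real_derivative
     4 * B l (ad (xi l) X) (ad (xi l) X) - 4 * B l (ad (N0 l) X) (ad (eta l) X)) (at l)"
proof -
  have 1: "((\<lambda>l. ad (xi l) X) has_vector_derivative ad (ad (eta l) (N0 l)) X) (at l)"
    using bounded_linear.has_vector_derivative[OF linear_ad_left[THEN linear_conv_bounded_linear[THEN iffD1]] xi_deriv] .
  have 2: "B l (ad (ad (eta l) (N0 l)) X) X = 2 * B l (ad (N0 l) X) (ad (eta l) X)"
    unfolding ad_jacobi B_simps B_eta[of "ad (N0 l) X" X] B_N0[of "ad (eta l) X" X]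
    by (simp add: B_sym[of l "ad (eta l) X"])
  show ?thesis
    using DERIV_cmult[OF B_deriv[OF 1, of X], of "- 2"] unfolding 2 B_xi[of "ad (xi l) X" X]
    by (simp add: algebra_simps)
qed

end

section \<open>The Riccati inequality for trace (J N) and monotonicity of norms\<close>

lemma trace_JN_deriv:
  assumes l: "l0 < l"
  shows "((\<lambda>l. trace (J l ** N)) has_real_derivative - B l (eta l) (eta l)) (at l)"
proof -
  have "((\<lambda>l. J l ** N) has_vector_derivative (J l ** 0 + (- eta l) ** N)) (at l)"
    by (intro bounded_bilinear.has_vector_derivative[OF bounded_bilinear_matrix_mult]
        J_deriv'[OF l] has_vector_derivative_const)
  from bounded_linear.has_vector_derivative[OF bounded_linear_trace this]
  show ?thesis
    unfolding has_real_derivative_iff_has_vector_derivative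
    by (simp add: mat_distribs trace_minus trace_eta_N[OF l])
qed

text \<open>J moves by conjugation, J' = [xi, J]. As - trace (J J) is the squared Hodge norm of J,
  this provides the constant of the Riccati inequality.\<close>

lemma trace_JJ_const: "\<exists>c. \<forall>l\<in>{l0<..}. trace (J l ** J l) = c"
proof (rule has_field_derivative_zero_constant)
  fix l assume "l \<in> {l0<..}"
  then have l: "l0 < l" by simp
  have "((\<lambda>l. J l ** J l) has_vector_derivative (J l ** (- eta l) + (- eta l) ** J l)) (at l)"
    by (intro bounded_bilinear.has_vector_derivative[OF bounded_bilinear_matrix_mult] J_deriv'[OF l])
  from bounded_linear.has_vector_derivative[OF bounded_linear_trace this]
  have "((\<lambda>l. trace (J l ** J l)) has_real_derivative - 2 * trace (eta l ** J l)) (at l)"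
    unfolding has_real_derivative_iff_has_vector_derivative
    using trace_mul_sym[of "J l" "eta l"]
    by (simp add: mat_distribs trace_minus trace_add trace_sub)
  moreover have "trace (eta l ** J l) = 0" by (rule trace_anti_comm[OF l C_eta[OF l] CJ[OF l]])
  ultimately have "((\<lambda>l. trace (J l ** J l)) has_real_derivative 0) (at l)" by simp
  then show "((\<lambda>l. trace (J l ** J l)) has_real_derivative 0) (at l within {l0<..})"
    by (rule has_field_derivative_at_within)
qed simp

text \<open>Since eta is trace-orthogonal to J, g = trace (J N) is minus the inner product of J and
  N0, and |N0|^2 = |eta|^2 = - g'; hence g^2 <= |J|^2 (- g').\<close>

lemma trace_JN_nonneg: assumes "l0 < l" shows "0 \<le> trace (J l ** N)"
proof -
  obtain c where c: "\<And>l. l0 < l \<Longrightarrow> trace (J l ** J l) = c" using trace_JJ_const by auto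
  have BJJ: "B l (J l) (J l) = - c" if "l0 < l" for l
    using B_comm[OF that CJ[OF that], of "J l"] c[OF that] by simp
  have c0: "- c \<ge> 0" using B_nonneg[OF assms J_g[OF assms]] BJJ[OF assms] by simp
  \<comment> \<open>Here - c is |J|^2, which may vanish; adding 1 makes K positive.\<close>
  show ?thesis
  proof (rule riccati_nonneg[OF trace_JN_deriv, where K = "- c + 1"])
    fix l assume l: "l0 < l"
    have w: "0 \<le> B l (eta l) (eta l)" using B_nonneg[OF l] g_mem[OF l] by blast
    have "trace (J l ** eta l) = 0"
      using trace_anti_comm[OF l C_eta[OF l] CJ[OF l]] trace_mul_sym by metis
    then have "trace (J l ** N) = - B l (J l) (N0 l)"
      unfolding B_comm[OF l C_N0[OF l]] by (simp add: N0_def mat_distribs trace_sub)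
    then have "(trace (J l ** N))\<^sup>2 \<le> - c * B l (eta l) (eta l)"
      using B_Cauchy_Schwarz[OF l J_g[OF l] g_mem(3)[OF l]] BJJ[OF l] B_N0_N0[OF l] by simp
    then show "(trace (J l ** N))\<^sup>2 \<le> - (- c + 1) * - B l (eta l) (eta l)"
      using w by (simp add: algebra_simps)
  qed (use c0 assms in auto)
qed

theorem norm_nonincreasing:
  assumes X: "X \<in> g" "ad N X = 0" and ab: "l0 < a" "a \<le> b"
  shows "B b X X \<le> B a X X"
proof (cases "X = 0")
  case False
  show ?thesis
  proof (rule log_convex_nonincreasing[where f = "\<lambda>l. B l X X" and f' = "\<lambda>l. - 2 * B l (ad (xi l) X) X"
        and g = "\<lambda>l. trace (J l ** N)" and w = "\<lambda>l. B l (eta l) (eta l)"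
        and f'' = "\<lambda>l. 4 * B l (ad (xi l) X) (ad (xi l) X) - 4 * B l (ad (N0 l) X) (ad (eta l) X)"])
    fix l assume l: "l0 < l"
    note mem = bracket[OF g_mem(1)[OF l] X(1)] bracket[OF g_mem(2)[OF l] X(1)]
    show "(- 2 * B l (ad (xi l) X) X)\<^sup>2 \<le> B l X X *
        (4 * B l (ad (xi l) X) (ad (xi l) X) - 4 * B l (ad (N0 l) X) (ad (eta l) X))"
    proof -
      have "ad (N0 l) X = - ad (eta l) X" using X(2) by (simp add: N0_def ad_linear_simps)
      then have "0 \<le> B l X X * (- B l (ad (N0 l) X) (ad (eta l) X))"
        using B_nonneg[OF l mem(2)] B_nonneg[OF l X(1)] by (simp add: B_simps)
      moreover have "(B l (ad (xi l) X) X)\<^sup>2 \<le> B l (ad (xi l) X) (ad (xi l) X) * B l X X"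
        by (rule B_Cauchy_Schwarz[OF l mem(1) X(1)])
      ultimately show ?thesis by (simp add: power2_eq_square algebra_simps)
    qed
    show "- 2 * B l (ad (xi l) X) X \<le> (4 * sqrt (B l (eta l) (eta l)) + 1 / l) * B l X X"
    proof -
      have "0 \<le> 1 / l * B l X X" using l l0 B_nonneg[OF l X(1)] by simp
      then show ?thesis using B_growth[OF l g_mem(1)[OF l] X(1)] B_xi_xi[OF l]
        by (simp add: distrib_right)
    qed
    show "((\<lambda>l. B l X X) has_real_derivative - 2 * B l (ad (xi l) X) X) (at l)"
      by (rule norm_deriv[OF l])
    show "((\<lambda>l. - 2 * B l (ad (xi l) X) X) has_real_derivative
       4 * B l (ad (xi l) X) (ad (xi l) X) - 4 * B l (ad (N0 l) X) (ad (eta l) X)) (at l)"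
      by (rule norm_deriv2[OF l])
    show "0 < B l X X" by (rule B_pos[OF l X(1) False])
    show "((\<lambda>l. trace (J l ** N)) has_real_derivative - B l (eta l) (eta l)) (at l)"
      by (rule trace_JN_deriv[OF l])
    show "0 \<le> trace (J l ** N)" by (rule trace_JN_nonneg[OF l])
  qed (fact l0 ab)+
qed (simp add: B_def)

section \<open>Twisting by the standard orbit of weight one\<close>

lemma twist_deriv:
  fixes a a' a'' b b' b'' :: "real \<Rightarrow> real"
  assumes a: "(a has_real_derivative a' l) (at l)" and b: "(b has_real_derivative b' l) (at l)"
  shows "0 < l \<Longrightarrow> ((\<lambda>l. a l / l + l * b l) has_real_derivative a' l / l - a l / l\<^sup>2 + b l + l * b' l) (at l)"
    and "(a' has_real_derivative a'' l) (at l) \<Longrightarrow> (b' has_real_derivative b'' l) (at l) \<Longrightarrow> 0 < l \<Longrightarrow>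
      ((\<lambda>l. a' l / l - a l / l\<^sup>2 + b l + l * b' l) has_real_derivative
        a'' l / l - 2 * a' l / l\<^sup>2 + 2 * a l / l ^ 3 + 2 * b' l + l * b'' l) (at l)"
proof -
  assume l: "0 < l"
  have "((\<lambda>l. a l / l + l * b l) has_real_derivative
      ((a' l * l - a l * 1) / (l * l) + (l * b' l + 1 * b l))) (at l)"
    by (intro DERIV_add DERIV_divide DERIV_mult' DERIV_ident a b) (use l in simp)
  moreover have "(a' l * l - a l * 1) / (l * l) + (l * b' l + 1 * b l) = a' l / l - a l / l\<^sup>2 + b l + l * b' l"
    using l by (simp add: field_simps power2_eq_square)
  ultimately show "((\<lambda>l. a l / l + l * b l) has_real_derivative a' l / l - a l / l\<^sup>2 + b l + l * b' l) (at l)"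
    by metis
next
  assume a': "(a' has_real_derivative a'' l) (at l)" and b': "(b' has_real_derivative b'' l) (at l)" and l: "0 < l"
  have "((\<lambda>l. a' l / l - a l / (l * l) + b l + l * b' l) has_real_derivative
      ((a'' l * l - a' l * 1) / (l * l) - (a' l * (l * l) - a l * (l * 1 + 1 * l)) / ((l * l) * (l * l))
        + b' l + (l * b'' l + 1 * b' l))) (at l)"
    by (intro DERIV_add DERIV_diff DERIV_divide DERIV_mult' DERIV_ident a b a' b') (use l in simp_all)
  moreover have "(a'' l * l - a' l * 1) / (l * l) - (a' l * (l * l) - a l * (l * 1 + 1 * l)) / ((l * l) * (l * l))
        + b' l + (l * b'' l + 1 * b' l) = a'' l / l - 2 * a' l / l\<^sup>2 + 2 * a l / l ^ 3 + 2 * b' l + l * b'' l"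
    using l by (simp add: field_simps power2_eq_square power3_eq_cube)
  ultimately show "((\<lambda>l. a' l / l - a l / l\<^sup>2 + b l + l * b' l) has_real_derivative
        a'' l / l - 2 * a' l / l\<^sup>2 + 2 * a l / l ^ 3 + 2 * b' l + l * b'' l) (at l)"
    unfolding power2_eq_square by metis
qed

text \<open>The second derivative of |Y|^2 / l + l |X|^2, with a = |Y|^2 and b = |X|^2, as a sum of
  squares: the four brackets on the right are the squared norms of the vectors P, S, P', S' of the
  next proof.\<close>

lemma twist_identity:
  fixes l :: real
  assumes "0 < l"
  shows "(4 * p - 2 * b + 4 * t) / l - 2 * (- 2 * u) / l\<^sup>2 + 2 * a / l ^ 3 + 2 * (- 2 * v) + l * (4 * r + 4 * w) =
    4 * ((p + u / l + a / (4 * l\<^sup>2)) / l + l * (r - v / l + b / (4 * l\<^sup>2)))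
    + 4 * ((t - b / 4) / l + l * (w - b / (2 * l\<^sup>2) + a / (4 * l ^ 4)))"
  using assms by (simp add: field_simps power2_eq_square power3_eq_cube power4_eq_xxxx)

text \<open>
  The function below is the squared norm of the invariant vector \<open>Y \<otimes> e\<^sub>0 - X \<otimes> e\<^sub>1\<close> in the
  tensor product with the standard orbit of weight one, where \<open>\<bar>e\<^sub>0\<bar>\<^sup>2 = 1 / l\<close> and
  \<open>\<bar>e\<^sub>1\<bar>\<^sup>2 = l\<close>.
\<close>

lemma twisted_norm_nonincreasing:
  assumes X: "X \<in> g" "ad N X = 0" and Y: "Y \<in> g" "X = ad N Y" and nz: "X \<noteq> 0" and ab: "l0 < a" "a \<le> b"
  shows "B b Y Y / b + b * B b X X \<le> B a Y Y / a + a * B a X X"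
proof -
  define f where "f l = B l Y Y / l + l * B l X X" for l
  define x1 where "x1 l = - 2 * B l (ad (xi l) X) X" for l
  define y1 where "y1 l = - 2 * B l (ad (xi l) Y) Y" for l
  define x2 where "x2 l = 4 * B l (ad (xi l) X) (ad (xi l) X) - 4 * B l (ad (N0 l) X) (ad (eta l) X)" for l
  define y2 where "y2 l = 4 * B l (ad (xi l) Y) (ad (xi l) Y) - 4 * B l (ad (N0 l) Y) (ad (eta l) Y)" for l
  define f1 where "f1 l = y1 l / l - B l Y Y / l\<^sup>2 + B l X X + l * x1 l" for l
  define f2 where "f2 l = y2 l / l - 2 * y1 l / l\<^sup>2 + 2 * B l Y Y / l^3 + 2 * x1 l + l * x2 l" for l
  have "f b \<le> f a"
  proof (rule log_convex_nonincreasing[where f = f and f' = f1 and g = "\<lambda>l. trace (J l ** N)"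
        and w = "\<lambda>l. B l (eta l) (eta l)" and f'' = f2])
    fix l assume l: "l0 < l"
    then have lp: "0 < l" using l0 by simp
    have dX: "((\<lambda>l. B l X X) has_real_derivative x1 l) (at l)" "(x1 has_real_derivative x2 l) (at l)"
      unfolding x1_def[abs_def] x2_def by (rule norm_deriv[OF l], rule norm_deriv2[OF l])
    have dY: "((\<lambda>l. B l Y Y) has_real_derivative y1 l) (at l)" "(y1 has_real_derivative y2 l) (at l)"
      unfolding y1_def[abs_def] y2_def by (rule norm_deriv[OF l], rule norm_deriv2[OF l])
    note mem = bracket[OF g_mem(1)[OF l] X(1)] bracket[OF g_mem(2)[OF l] X(1)]
      bracket[OF g_mem(1)[OF l] Y(1)] bracket[OF g_mem(2)[OF l] Y(1)]
    show "(f has_real_derivative f1 l) (at l)"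
      unfolding f_def[abs_def] f1_def by (rule twist_deriv(1)[where a = "\<lambda>l. B l Y Y" and b = "\<lambda>l. B l X X" and a' = y1 and b' = x1 and l = l, OF dY(1) dX(1) lp])
    show "(f1 has_real_derivative f2 l) (at l)"
      unfolding f1_def[abs_def] f2_def by (rule twist_deriv(2)[where a = "\<lambda>l. B l Y Y" and b = "\<lambda>l. B l X X" and a' = y1 and b' = x1 and l = l and a'' = y2 and b'' = x2, OF dY(1) dX(1) dY(2) dX(2) lp])
    have X0: "0 < B l X X" and Y0: "0 \<le> B l Y Y" using B_pos[OF l X(1) nz] B_nonneg[OF l Y(1)] by auto
    show "0 < f l" unfolding f_def using X0 Y0 lp by (simp add: add_nonneg_pos)
    \<comment> \<open>P and S are, up to sign, the components at \<open>e\<^sub>0\<close> and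
      \<open>e\<^sub>1\<close> of the xi of the tensor product applied to the invariant vector; on
      the weight one factor, xi is 1 / (2 l) on \<open>e\<^sub>0\<close> and - 1 / (2 l) on
      \<open>e\<^sub>1\<close>.\<close>
    define P where "P = ad (xi l) Y + (1 / (2 * l)) *\<^sub>R Y"
    define S where "S = ad (xi l) X - (1 / (2 * l)) *\<^sub>R X"
    \<comment> \<open>The same for eta, which on the weight one factor sends
      \<open>e\<^sub>0\<close> to \<open>e\<^sub>1\<close> / (2 l^2) and \<open>e\<^sub>1\<close> to
      \<open>e\<^sub>0\<close> / 2.\<close>
    define P' where "P' = ad (eta l) Y - (1 / 2) *\<^sub>R X"
    define S' where "S' = ad (eta l) X - (1 / (2 * l\<^sup>2)) *\<^sub>R Y"
    have g: "P \<in> g" "S \<in> g" "P' \<in> g" "S' \<in> g"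
      unfolding P_def S_def P'_def S'_def using sub mem X(1) Y(1)
      by (auto intro!: subspace_add subspace_diff subspace_scale)
    define u v p r t w where "u = B l (ad (xi l) Y) Y" and "v = B l (ad (xi l) X) X"
      and "p = B l (ad (xi l) Y) (ad (xi l) Y)" and "r = B l (ad (xi l) X) (ad (xi l) X)"
      and "t = B l (ad (eta l) Y) (ad (eta l) Y)" and "w = B l (ad (eta l) X) (ad (eta l) X)"
    note uv = u_def[symmetric] v_def[symmetric] p_def[symmetric] r_def[symmetric] t_def[symmetric] w_def[symmetric]
    have PY: "B l P Y = u + B l Y Y / (2 * l)" "B l S X = v - B l X X / (2 * l)"
      unfolding P_def S_def B_simps uv by simp_all
    have f1: "f1 l = - 2 * (B l P Y / l + l * B l S X)"
      unfolding f1_def x1_def y1_def PY uv using lp by (simp add: field_simps power2_eq_square)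
    have N0X: "ad (N0 l) X = - ad (eta l) X" using X(2) by (simp add: N0_def ad_linear_simps)
    have N0Y: "ad (N0 l) Y = X - ad (eta l) Y" using Y(2) by (simp add: N0_def ad_linear_simps)
    \<comment> \<open>Moving N0 across the form costs a sign, moving eta does not; [N0, X] = -
      [eta, X] cancels that sign, so both terms agree.\<close>
    have "B l X X = B l (ad (N0 l) Y + ad (eta l) Y) X" by (simp add: N0Y)
    also have "\<dots> = 2 * B l Y (ad (eta l) X)"
      unfolding B_simps B_N0[OF l] B_eta[OF l] N0X by simp
    finally have XX: "B l (ad (eta l) X) Y = B l X X / 2" using B_sym by simp
    have XX': "B l X (ad (eta l) Y) = B l X X / 2" using XX B_eta[OF l] by simp
    have PP: "B l P P = p + u / l + B l Y Y / (4 * l\<^sup>2)"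
      unfolding P_def B_simps B_sym[of l Y "ad (xi l) Y"] uv
      using lp by (simp add: field_simps power2_eq_square)
    have SS: "B l S S = r - v / l + B l X X / (4 * l\<^sup>2)"
      unfolding S_def B_simps B_sym[of l X "ad (xi l) X"] uv
      using lp by (simp add: field_simps power2_eq_square)
    have PP': "B l P' P' = t - B l X X / 4"
      unfolding P'_def B_simps B_sym[of l "ad (eta l) Y" X] XX' uv by simp
    have SS': "B l S' S' = w - B l X X / (2 * l\<^sup>2) + B l Y Y / (4 * l ^ 4)"
      unfolding S'_def B_simps B_sym[of l Y "ad (eta l) X"] XX uv
      using lp by (simp add: field_simps power4_eq_xxxx power2_eq_square)
    have x2: "x2 l = 4 * r + 4 * w" unfolding x2_def N0X B_simps uv by simp
    have y2: "y2 l = 4 * p - 2 * B l X X + 4 * t"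
      unfolding y2_def N0Y B_simps XX' uv by simp
    have f2: "f2 l = 4 * (B l P P / l + l * B l S S) + 4 * (B l P' P' / l + l * B l S' S')"
      unfolding f2_def x1_def y1_def uv x2 y2 PP SS PP' SS' by (rule twist_identity[OF lp])
    \<comment> \<open>Cauchy-Schwarz in the direct sum of two copies of \<open>g\<close>, with
      weights 1 / l and l.\<close>
    have cs: "(B l P Y / l + l * B l S X)\<^sup>2 \<le> (B l Y Y / l + l * B l X X) * (B l P P / l + l * B l S S)"
    proof -
      define p y s x where "p = B l P P / l" and "y = B l Y Y / l" and "s = l * B l S S" and "x = l * B l X X"
      have nn: "0 \<le> p" "0 \<le> y" "0 \<le> s" "0 \<le> x"
        unfolding p_def y_def s_def x_def using B_nonneg[OF l] g X Y lp by auto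
      have 1: "(B l P Y / l)\<^sup>2 \<le> p * y"
        using B_Cauchy_Schwarz[OF l g(1) Y(1)] lp
        by (simp add: p_def y_def field_simps power2_eq_square)
      have 2: "(l * B l S X)\<^sup>2 \<le> s * x"
        using mult_left_mono[OF B_Cauchy_Schwarz[OF l g(2) X(1)], of "l * l"] lp
        by (simp add: s_def x_def power2_eq_square algebra_simps)
      have "\<bar>B l P Y / l\<bar> \<le> sqrt (p * y)" "\<bar>l * B l S X\<bar> \<le> sqrt (s * x)"
        using real_sqrt_le_mono[OF 1] real_sqrt_le_mono[OF 2] by simp_all
      then have "\<bar>B l P Y / l + l * B l S X\<bar> \<le> sqrt (p * y) + sqrt (s * x)" by linarith
      then have "(B l P Y / l + l * B l S X)\<^sup>2 \<le> (sqrt (p * y) + sqrt (s * x))\<^sup>2"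
        by (metis abs_ge_zero power2_abs power_mono)
      also have "\<dots> = p * y + s * x + 2 * (sqrt (p * x) * sqrt (s * y))"
        using nn by (simp add: power2_sum real_sqrt_mult power_mult_distrib)
      also have "\<dots> \<le> p * y + s * x + (p * x + s * y)"
        using sum_squares_bound[of "sqrt (p * x)" "sqrt (s * y)"] nn by simp
      finally show ?thesis by (simp add: p_def y_def s_def x_def algebra_simps)
    qed
    show "(f1 l)\<^sup>2 \<le> f l * f2 l"
    proof -
      have "0 \<le> B l P' P' / l + l * B l S' S'" using B_nonneg[OF l] g lp by simp
      then have "0 \<le> f l * (B l P' P' / l + l * B l S' S')" using \<open>0 < f l\<close> by simp
      moreover have "(- 2 * z)\<^sup>2 \<le> F * (4 * G + 4 * H)" if "z\<^sup>2 \<le> F * G" "0 \<le> F * H" for z F G H :: real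
        using that by (simp add: power2_eq_square algebra_simps)
      ultimately show ?thesis using cs unfolding f1 f2 f_def by blast
    qed
    show "f1 l \<le> (4 * sqrt (B l (eta l) (eta l)) + 1 / l) * f l"
    proof -
      define r where "r = sqrt (B l (eta l) (eta l))"
      have "- B l (ad (xi l) X) X \<le> 2 * r * B l X X" "- B l (ad (xi l) Y) Y \<le> 2 * r * B l Y Y"
        using B_growth[OF l g_mem(1)[OF l] X(1)] B_growth[OF l g_mem(1)[OF l] Y(1)] B_xi_xi[OF l]
        by (simp_all add: r_def)
      then have x: "x1 l \<le> 4 * r * B l X X" and y: "y1 l \<le> 4 * r * B l Y Y" by (simp_all add: x1_def y1_def)
      have "f1 l \<le> 4 * r * B l Y Y / l + B l X X + l * (4 * r * B l X X)"
      proof -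
        have "y1 l / l \<le> 4 * r * B l Y Y / l" using y lp by (simp add: divide_right_mono)
        moreover have "l * x1 l \<le> l * (4 * r * B l X X)" using x lp by (intro mult_left_mono) auto
        moreover have "0 \<le> B l Y Y / l\<^sup>2" using Y0 by simp
        ultimately show ?thesis unfolding f1_def by linarith
      qed
      \<comment> \<open>The middle term, from differentiating the weight l, is at most f l / l; it
        is the origin of the summand 1 / x in the growth hypothesis.\<close>
      also have "\<dots> \<le> (4 * r + 1 / l) * f l"
        unfolding f_def using lp Y0 by (simp add: field_simps)
      finally show ?thesis by (simp add: r_def)
    qed
    show "((\<lambda>l. trace (J l ** N)) has_real_derivative - B l (eta l) (eta l)) (at l)"
      by (rule trace_JN_deriv[OF l])
    show "0 \<le> trace (J l ** N)" by (rule trace_JN_nonneg[OF l])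
  qed (fact l0 ab)+
  then show ?thesis by (simp add: f_def)
qed

theorem norm_tendsto_zero:
  assumes "Y \<in> g" "ad N (ad N Y) = 0"
  shows "((\<lambda>l. B l (ad N Y) (ad N Y)) \<longlongrightarrow> 0) at_top"
proof (cases "ad N Y = 0")
  case False
  define X where "X = ad N Y"
  have X: "X \<in> g" "ad N X = 0" "X \<noteq> 0"
    unfolding X_def using bracket[OF N_g assms(1)] assms(2) False by simp_all
  define a where "a = l0 + 1"
  define c where "c = B a Y Y / a + a * B a X X"
  have "B l X X \<le> c / l" if l: "a \<le> l" for l
  proof -
    have "B l Y Y / l + l * B l X X \<le> c"
      unfolding c_def using l
      by (intro twisted_norm_nonincreasing[OF X(1,2) assms(1) X_def X(3)]) (simp_all add: a_def)
    moreover have "0 \<le> B l Y Y / l" using B_nonneg[OF _ assms(1), of l] l l0 by (simp add: a_def)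
    ultimately have "l * B l X X \<le> c" by linarith
    moreover have "0 < l" using l l0 by (simp add: a_def)
    ultimately show ?thesis by (simp add: pos_le_divide_eq mult.commute)
  qed
  then have "\<forall>\<^sub>F l in at_top. B l X X \<le> c / l" by (rule eventually_at_top_linorderI)
  moreover have "\<forall>\<^sub>F l in at_top. 0 \<le> B l X X"
    by (rule eventually_mono[OF eventually_gt_at_top[of l0]]) (rule B_nonneg[OF _ X(1)])
  moreover have "((\<lambda>l. c / l) \<longlongrightarrow> 0) at_top"
    using tendsto_divide_0[OF tendsto_const filterlim_at_top_imp_at_infinity[OF filterlim_ident]] .
  ultimately have "((\<lambda>l. B l X X) \<longlongrightarrow> 0) at_top"
    using tendsto_sandwich[of "\<lambda>_. 0" "\<lambda>l. B l X X" at_top "\<lambda>l. c / l" 0] by simp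
  then show ?thesis by (simp only: X_def)
next
  case True
  then show ?thesis by (simp add: B_def trace_def)
qed

end

subsection \<open>Complex matrices\<close>

abbreviation cscale :: "complex \<Rightarrow> complex^'m^'n \<Rightarrow> complex^'m^'n" where
  "cscale c A \<equiv> map_matrix ((*) c) A"

abbreviation mat_cnj :: "complex^'m^'n \<Rightarrow> complex^'m^'n" where
  "mat_cnj A \<equiv> map_matrix cnj A"

lemma cscale_mult_left: "cscale c A ** B = cscale c (A ** B)"
  and cscale_mult_right: "A ** cscale c B = cscale c (A ** B)"
  by (simp_all add: vec_eq_iff matrix_matrix_mult_def sum_distrib_left mult_ac)

lemma cscale_add: "cscale c (A + B) = cscale c A + cscale c B"
  and cscale_diff: "cscale c (A - B) = cscale c A - cscale c B"
  and cscale_minus: "cscale c (- A) = - cscale c A"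
  and cscale_zero [simp]: "cscale c 0 = 0"
  and cscale_cscale: "cscale c (cscale d A) = cscale (c * d) A"
  and cscale_one [simp]: "cscale 1 A = A"
  and cscale_zero_left [simp]: "cscale 0 A = 0"
  and cscale_add_left: "cscale (c + d) A = cscale c A + cscale d A"
  and cscale_diff_left: "cscale (c - d) A = cscale c A - cscale d A"
  and cscale_minus_left: "cscale (- c) A = - cscale c A"
  and cscale_scaleR: "cscale (complex_of_real r) A = r *\<^sub>R A"
  by (simp_all add: vec_eq_iff algebra_simps complex_eq_iff)

lemma cscale_sum: "cscale c (\<Sum>i\<in>S. A i) = (\<Sum>i\<in>S. cscale c (A i))"
  by (induction S rule: infinite_finite_induct) (simp_all add: cscale_add)

lemma cscale_vector: "cscale c A *v x = c *s (A *v x)"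
  by (simp add: vec_eq_iff matrix_vector_mult_def sum_distrib_left mult_ac)

lemma matrix_sum_left: "(\<Sum>i\<in>S. A i) ** (B :: 'a::ring_1^'p^'n) = (\<Sum>i\<in>S. A i ** B)"
  by (induction S rule: infinite_finite_induct) (simp_all add: matrix_add_rdistrib)

lemma matrix_sum_right: "(B :: 'a::ring_1^'n^'m) ** (\<Sum>i\<in>S. A i) = (\<Sum>i\<in>S. B ** A i)"
  by (induction S rule: infinite_finite_induct) (simp_all add: matrix_add_ldistrib)

lemma matrix_sum_vector: "(\<Sum>i\<in>S. A i) *v (x :: 'a::ring_1^'n) = (\<Sum>i\<in>S. A i *v x)"
  by (induction S rule: infinite_finite_induct) (simp_all add: matrix_vector_mult_add_rdistrib)

lemma mat_cnj_mult: "mat_cnj (A ** B) = mat_cnj A ** mat_cnj B"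
  by (simp add: vec_eq_iff matrix_matrix_mult_def)

lemma mat_cnj_add: "mat_cnj (A + B) = mat_cnj A + mat_cnj B"
  and mat_cnj_diff: "mat_cnj (A - B) = mat_cnj A - mat_cnj B"
  and mat_cnj_cscale: "mat_cnj (cscale c A) = cscale (cnj c) (mat_cnj A)"
  and mat_cnj_one [simp]: "mat_cnj (mat 1) = mat 1"
  and mat_cnj_zero [simp]: "mat_cnj 0 = 0"
  by (simp_all add: vec_eq_iff matrix_matrix_mult_def mat_def)

lemma mat_cnj_sum: "mat_cnj (\<Sum>i\<in>S. A i) = (\<Sum>i\<in>S. mat_cnj (A i))"
  by (induction S rule: infinite_finite_induct) (simp_all add: mat_cnj_add)

lemma cvec_conj_conj [simp]: "cvec_conj (cvec_conj x) = x"
  and cvec_conj_add: "cvec_conj (x + y) = cvec_conj x + cvec_conj y"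
  and cvec_conj_diff: "cvec_conj (x - y) = cvec_conj x - cvec_conj y"
  and cvec_conj_scale: "cvec_conj (c *s x) = cnj c *s cvec_conj x"
  and cvec_conj_zero [simp]: "cvec_conj 0 = 0"
  by (simp_all add: vec_eq_iff cvec_conj_def)

lemma mat_cnj_vector: "mat_cnj A *v x = cvec_conj (A *v cvec_conj x)"
  by (simp add: vec_eq_iff cvec_conj_def matrix_vector_mult_def)

lemma cvec_conj_mult: "cvec_conj (A *v x) = mat_cnj A *v cvec_conj x"
  by (simp add: mat_cnj_vector)

lemma mem_cvec_conj_image: "x \<in> cvec_conj ` S \<longleftrightarrow> cvec_conj x \<in> S"
  by (metis cvec_conj_conj image_iff)

lemma cvec_conj_subspace: "vec.subspace S \<Longrightarrow> vec.subspace (cvec_conj ` S)"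
  unfolding vec.subspace_def mem_cvec_conj_image by (simp add: cvec_conj_add cvec_conj_scale)

lemma complexify_mult: "complexify (A ** B) = complexify A ** complexify B"
  and complexify_add: "complexify (A + B) = complexify A + complexify B"
  and complexify_diff: "complexify (A - B) = complexify A - complexify B"
  and complexify_scaleR: "complexify (r *\<^sub>R A) = r *\<^sub>R complexify A"
  and complexify_one [simp]: "complexify (mat 1) = mat 1"
  and complexify_zero [simp]: "complexify 0 = 0"
  and mat_cnj_complexify [simp]: "mat_cnj (complexify A) = complexify A"
  and Re_complexify [simp]: "map_matrix Re (complexify A) = A"
  by (simp_all add: complexify_def vec_eq_iff matrix_matrix_mult_def mat_def complex_eq_iff)

lemma complexify_minus: "complexify (- A) = - complexify A"
  by (simp add: complexify_def vec_eq_iff)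

lemma complexify_inject: "complexify A = complexify B \<longleftrightarrow> A = B"
  by (metis Re_complexify)

lemma complexify_Re: "mat_cnj A = A \<Longrightarrow> complexify (map_matrix Re A) = A"
  by (simp add: complexify_def vec_eq_iff complex_eq_iff)

lemma complexify_sum: "complexify (\<Sum>i\<in>S. A i) = (\<Sum>i\<in>S. complexify (A i))"
  by (induction S rule: infinite_finite_induct) (simp_all add: complexify_add)

lemma complexify_ad: "complexify (ad A B) = complexify A ** complexify B - complexify B ** complexify A"
  by (simp add: ad_def complexify_diff complexify_mult)

definition cvec :: "real^'v \<Rightarrow> complex^'v" where
  "cvec x = (\<chi> i. complex_of_real (x $ i))"

lemma complexify_cvec: "complexify A *v cvec x = cvec (A *v x)"
  by (simp add: complexify_def cvec_def vec_eq_iff matrix_vector_mult_def)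

lemma cvec_conj_cvec [simp]: "cvec_conj (cvec x) = cvec x"
  by (simp add: cvec_conj_def cvec_def)

lemma cvec_eq_0 [simp]: "cvec x = 0 \<longleftrightarrow> x = 0"
  by (simp add: cvec_def vec_eq_iff)

lemma bilinear_ext_add_left: "bilinear_ext Q (x + x') y = bilinear_ext Q x y + bilinear_ext Q x' y"
  and bilinear_ext_add_right: "bilinear_ext Q x (y + y') = bilinear_ext Q x y + bilinear_ext Q x y'"
  and bilinear_ext_scale_left: "bilinear_ext Q (c *s x) y = c * bilinear_ext Q x y"
  and bilinear_ext_scale_right: "bilinear_ext Q x (c *s y) = c * bilinear_ext Q x y"
  and bilinear_ext_zero_left [simp]: "bilinear_ext Q 0 y = 0"
  and bilinear_ext_zero_right [simp]: "bilinear_ext Q x 0 = 0"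
  and bilinear_ext_conj: "bilinear_ext Q (cvec_conj x) (cvec_conj y) = cnj (bilinear_ext Q x y)"
  by (simp_all add: bilinear_ext_def distrib_left distrib_right sum.distrib sum_distrib_left mult_ac cvec_conj_def)

lemma bilinear_ext_sum_left: "bilinear_ext Q (\<Sum>i\<in>S. x i) y = (\<Sum>i\<in>S. bilinear_ext Q (x i) y)"
  by (induction S rule: infinite_finite_induct) (simp_all add: bilinear_ext_add_left)

lemma bilinear_ext_sum_right: "bilinear_ext Q x (\<Sum>i\<in>S. y i) = (\<Sum>i\<in>S. bilinear_ext Q x (y i))"
  by (induction S rule: infinite_finite_induct) (simp_all add: bilinear_ext_add_right)

lemma bilinear_ext_cvec:
  assumes "bilinear Q"
  shows "bilinear_ext Q (cvec x) (cvec y) = complex_of_real (Q x y)"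
proof -
  have "Q x y = Q (\<Sum>i\<in>UNIV. x $ i *\<^sub>R axis i 1) (\<Sum>j\<in>UNIV. y $ j *\<^sub>R axis j 1)"
    using basis_expansion[of x] basis_expansion[of y] by (simp add: scalar_mult_eq_scaleR)
  also have "\<dots> = (\<Sum>i\<in>UNIV. \<Sum>j\<in>UNIV. x $ i * y $ j * Q (axis i 1) (axis j 1))"
    by (simp add: bilinear_sum[OF assms] bilinear_lmul[OF assms] bilinear_rmul[OF assms]
        sum.cartesian_product mult.assoc mult.left_commute)
  finally show ?thesis by (simp add: bilinear_ext_def cvec_def)
qed

subsection \<open>Gradings by projections\<close>

locale grading =
  fixes P :: "int set" and pr :: "int \<Rightarrow> complex^'v^'v"
  assumes fin: "finite P"
    and prod: "\<And>p q. p \<in> P \<Longrightarrow> q \<in> P \<Longrightarrow> pr p ** pr q = (if p = q then pr p else 0)"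
    and total: "(\<Sum>p\<in>P. pr p) = mat 1"
begin

definition graded :: "(int \<Rightarrow> complex) \<Rightarrow> complex^'v^'v" where
  "graded c = (\<Sum>p\<in>P. cscale (c p) (pr p))"

lemma graded_pr: "q \<in> P \<Longrightarrow> graded c ** pr q = cscale (c q) (pr q)"
  and pr_graded: "q \<in> P \<Longrightarrow> pr q ** graded c = cscale (c q) (pr q)"
proof -
  assume q: "q \<in> P"
  have "(\<Sum>p\<in>P. cscale (c p) (pr p ** pr q)) = (\<Sum>p\<in>P. if p = q then cscale (c q) (pr q) else 0)"
    using q by (intro sum.cong) (auto simp: prod)
  then show "graded c ** pr q = cscale (c q) (pr q)"
    using q fin by (simp add: graded_def matrix_sum_left cscale_mult_left)
  have "(\<Sum>p\<in>P. cscale (c p) (pr q ** pr p)) = (\<Sum>p\<in>P. if p = q then cscale (c q) (pr q) else 0)"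
    using q by (intro sum.cong) (auto simp: prod)
  then show "pr q ** graded c = cscale (c q) (pr q)"
    using q fin by (simp add: graded_def matrix_sum_right cscale_mult_right)
qed

lemma graded_one: "graded (\<lambda>_. 1) = mat 1"
  by (simp add: graded_def total)

lemma graded_mult: "graded c ** graded d = graded (\<lambda>p. c p * d p)"
proof -
  have "graded c ** graded d = (\<Sum>p\<in>P. cscale (d p) (graded c ** pr p))"
    by (simp add: graded_def[of d] matrix_sum_right cscale_mult_right)
  also have "\<dots> = (\<Sum>p\<in>P. cscale (c p * d p) (pr p))"
    by (intro sum.cong) (auto simp: graded_pr cscale_cscale mult.commute)
  finally show ?thesis by (simp add: graded_def)
qed

lemma graded_scalar: "graded (\<lambda>_. a) = cscale a (mat 1)"
  unfolding graded_def by (simp add: cscale_sum[symmetric] total)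

text \<open>Inserting the sum of all \<open>pr p\<close> on both sides splits a matrix into blocks.
  On blocks, products and commutators with graded operators are scalars, so the matrix identities
  below reduce to identities in p and q.\<close>

lemma component_eqI:
  assumes "\<And>p q. p \<in> P \<Longrightarrow> q \<in> P \<Longrightarrow> pr q ** A ** pr p = pr q ** B ** pr p"
  shows "A = B"
proof -
  have *: "X = (\<Sum>q\<in>P. \<Sum>p\<in>P. pr q ** X ** pr p)" for X
  proof -
    have "X = (\<Sum>q\<in>P. pr q) ** X ** (\<Sum>p\<in>P. pr p)" by (simp add: total)
    also have "\<dots> = (\<Sum>q\<in>P. \<Sum>p\<in>P. pr q ** X ** pr p)"
      unfolding matrix_sum_left unfolding matrix_sum_right ..
    finally show ?thesis .
  qed
  show ?thesis using assms *[of A] *[of B] by (metis (no_types, lifting) sum.cong)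
qed

lemma component_left: "q \<in> P \<Longrightarrow> pr q ** (graded c ** X) ** pr p = cscale (c q) (pr q ** X ** pr p)"
  and component_right: "p \<in> P \<Longrightarrow> pr q ** (X ** graded c) ** pr p = cscale (c p) (pr q ** X ** pr p)"
proof -
  assume "q \<in> P"
  have "pr q ** (graded c ** X) ** pr p = (pr q ** graded c) ** X ** pr p" by (simp add: matrix_mul_assoc)
  then show "pr q ** (graded c ** X) ** pr p = cscale (c q) (pr q ** X ** pr p)"
    using \<open>q \<in> P\<close> by (simp add: pr_graded cscale_mult_left)
next
  assume "p \<in> P"
  have "pr q ** (X ** graded c) ** pr p = pr q ** X ** (graded c ** pr p)" by (simp add: matrix_mul_assoc)
  then show "pr q ** (X ** graded c) ** pr p = cscale (c p) (pr q ** X ** pr p)"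
    using \<open>p \<in> P\<close> by (simp add: graded_pr cscale_mult_right)
qed

lemma component_commutator:
  assumes "p \<in> P" "q \<in> P"
  shows "pr q ** (graded c ** X - X ** graded c) ** pr p = cscale (c q - c p) (pr q ** X ** pr p)"
  by (simp add: mat_distribs component_left component_right assms cscale_diff_left)

end

subsection \<open>Polarized Hodge structures\<close>

text \<open>The choice is unique for F in the period domain, where the two spaces are complementary.
  These projections serve as building blocks because their derivatives along the orbit can be
  computed directly.\<close>

definition hodge_proj :: "int \<Rightarrow> (int \<Rightarrow> (complex^'v) set) \<Rightarrow> int \<Rightarrow> complex^'v^'v" where
  "hodge_proj n F p = (SOME P. \<forall>x. P *v x \<in> F p \<and> x - P *v x \<in> cvec_conj ` F (n - p + 1))"

text \<open>\<open>F p\<close> collects the types (r, n - r) with r >= p, and its complement the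
  others; so consecutive differences project onto a single type.\<close>

definition hodge_comp :: "int \<Rightarrow> (int \<Rightarrow> (complex^'v) set) \<Rightarrow> int \<Rightarrow> complex^'v^'v" where
  "hodge_comp n F p = hodge_proj n F p - hodge_proj n F (p + 1)"

text \<open>The index range is stable under p -> n - p, the effect of complex conjugation on
  types.\<close>

definition hodge_graded :: "int \<Rightarrow> int \<Rightarrow> (int \<Rightarrow> (complex^'v) set) \<Rightarrow> (int \<Rightarrow> complex) \<Rightarrow> complex^'v^'v" where
  "hodge_graded n m F c = (\<Sum>p\<in>{n - m..m}. cscale (c p) (hodge_comp n F p))"

definition hodge_weight :: "int \<Rightarrow> int \<Rightarrow> complex" where
  "hodge_weight n p = \<i> * of_int (2 * p - n) / 2"

definition weil_weight :: "int \<Rightarrow> int \<Rightarrow> complex" where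
  "weil_weight n p = \<i> powi (2 * p - n)"

text \<open>Taking real parts loses nothing for the Hodge structures considered below: the weights
  satisfy cnj (c (n - p)) = c p, which makes the graded operator real.\<close>

definition hodge_J :: "int \<Rightarrow> int \<Rightarrow> (int \<Rightarrow> (complex^'v) set) \<Rightarrow> real^'v^'v" where
  "hodge_J n m F = map_matrix Re (hodge_graded n m F (hodge_weight n))"

definition hodge_C :: "int \<Rightarrow> int \<Rightarrow> (int \<Rightarrow> (complex^'v) set) \<Rightarrow> real^'v^'v" where
  "hodge_C n m F = map_matrix Re (hodge_graded n m F (weil_weight n))"

locale hodge_structure =
  fixes n m :: int and Q :: "real^'v \<Rightarrow> real^'v \<Rightarrow> real" and h :: "int \<Rightarrow> int \<Rightarrow> nat"
    and F :: "int \<Rightarrow> (complex^'v) set"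
  assumes pol: "polarization_form n Q" and FD: "F \<in> period_domain n Q h"
    and top: "F (n - m) = UNIV" and bot: "F (m + 1) = {0}" and nm: "n \<le> 2 * m"
begin

lemma F_subspace: "vec.subspace (F p)"
  and F_step: "F (p + 1) \<subseteq> F p"
  and riemann: "x \<in> F p \<Longrightarrow> y \<in> F (n - p + 1) \<Longrightarrow> bilinear_ext Q x y = 0"
proof -
  have *: "F \<in> compact_dual n Q h" using FD unfolding period_domain_def by (elim CollectE conjE)
  show "vec.subspace (F p)" using * unfolding compact_dual_def by (elim CollectE conjE) (erule spec)
  show "F (p + 1) \<subseteq> F p"
    using * unfolding compact_dual_def by (elim CollectE conjE) (erule_tac x = p in allE, assumption)
  show "x \<in> F p \<Longrightarrow> y \<in> F (n - p + 1) \<Longrightarrow> bilinear_ext Q x y = 0"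
    using * unfolding compact_dual_def by simp
qed

lemma F_disjoint: "F p \<inter> cvec_conj ` F (n - p + 1) = {0}"
  and F_sum: "\<exists>x\<in>F p. \<exists>y\<in>cvec_conj ` F (n - p + 1). z = x + y"
  and positive: "p + q = n \<Longrightarrow> x \<in> F p \<Longrightarrow> x \<in> cvec_conj ` F q \<Longrightarrow> x \<noteq> 0 \<Longrightarrow>
      0 < Re (\<i> powi (p - q) * bilinear_ext Q x (cvec_conj x))"
proof -
  note * = FD[unfolded period_domain_def mem_Collect_eq, THEN conjunct2]
  show "F p \<inter> cvec_conj ` F (n - p + 1) = {0}" by (rule *[THEN conjunct1, THEN spec])
  show "\<exists>x\<in>F p. \<exists>y\<in>cvec_conj ` F (n - p + 1). z = x + y"
    by (rule *[THEN conjunct2, THEN conjunct1, THEN spec, THEN spec])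
  show "p + q = n \<Longrightarrow> x \<in> F p \<Longrightarrow> x \<in> cvec_conj ` F q \<Longrightarrow> x \<noteq> 0 \<Longrightarrow>
      0 < Re (\<i> powi (p - q) * bilinear_ext Q x (cvec_conj x))"
    using *[THEN conjunct2, THEN conjunct2, rule_format, of p q x] by blast
qed

definition "G p = cvec_conj ` F (n - p + 1)"

lemma G_subspace: "vec.subspace (G p)"
  unfolding G_def by (rule cvec_conj_subspace[OF F_subspace])

lemma F_anti: "p \<le> q \<Longrightarrow> F q \<subseteq> F p"
proof (induction q rule: int_ge_induct)
  case (step i)
  then show ?case using F_step[of i] by blast
qed simp

lemma G_mono: "p \<le> q \<Longrightarrow> G p \<subseteq> G q"
  unfolding G_def by (intro image_mono F_anti) simp

lemma decomposition_unique:
  assumes "a \<in> F p" "x - a \<in> G p" "b \<in> F p" "x - b \<in> G p"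
  shows "a = b"
proof -
  have "a - b \<in> F p" by (rule vec.subspace_diff[OF F_subspace assms(1,3)])
  moreover have "(x - b) - (x - a) \<in> G p" by (rule vec.subspace_diff[OF G_subspace assms(4,2)])
  then have "a - b \<in> G p" by simp
  ultimately have "a - b = 0" using F_disjoint[of p] unfolding G_def by blast
  then show ?thesis by simp
qed

lemma hodge_proj_exists: "\<exists>P. \<forall>x. P *v x \<in> F p \<and> x - P *v x \<in> G p"
proof -
  have "\<forall>x. \<exists>a. a \<in> F p \<and> x - a \<in> G p"
  proof
    fix x
    obtain a b where "a \<in> F p" "b \<in> G p" "x = a + b" using F_sum[of p x] unfolding G_def by blast
    then show "\<exists>a. a \<in> F p \<and> x - a \<in> G p" by (intro exI[of _ a]) simp
  qed
  then obtain f where f: "\<And>x. f x \<in> F p" "\<And>x. x - f x \<in> G p" by metis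
  have "Vector_Spaces.linear (*s) (*s) f"
  proof (unfold_locales, goal_cases)
    case (1 x y)
    have "(x - f x) + (y - f y) \<in> G p" by (intro vec.subspace_add[OF G_subspace] f)
    then have "(x + y) - (f x + f y) \<in> G p" by (simp add: algebra_simps)
    moreover have "f x + f y \<in> F p" by (intro vec.subspace_add[OF F_subspace] f)
    ultimately show ?case by (rule decomposition_unique[OF f, rotated])
  next
    case (2 c x)
    have "c *s (x - f x) \<in> G p" by (intro vec.subspace_scale[OF G_subspace] f)
    then have "c *s x - c *s f x \<in> G p" by (simp add: vec.scale_right_diff_distrib)
    moreover have "c *s f x \<in> F p" by (intro vec.subspace_scale[OF F_subspace] f)
    ultimately show ?case by (rule decomposition_unique[OF f, rotated])
  qed
  then show ?thesis using f by (intro exI[of _ "matrix f"]) (simp add: matrix_works)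
qed

abbreviation "pj \<equiv> hodge_proj n F"
abbreviation "pr \<equiv> hodge_comp n F"

lemma pj_F: "pj p *v x \<in> F p" and pj_G: "x - pj p *v x \<in> G p"
  using someI_ex[OF hodge_proj_exists[of p]] unfolding hodge_proj_def G_def by blast+

lemma pj_eqI: "a \<in> F p \<Longrightarrow> x - a \<in> G p \<Longrightarrow> pj p *v x = a"
  by (rule decomposition_unique[OF pj_F pj_G])

lemma zero_F: "0 \<in> F p" and zero_G: "0 \<in> G p"
  using F_subspace G_subspace vec.subspace_0 by blast+

lemma pj_fix: "x \<in> F q \<Longrightarrow> p \<le> q \<Longrightarrow> pj p *v x = x"
  by (rule pj_eqI) (use F_anti[of p q] zero_G in auto)

lemma pj_kill: "x \<in> G q \<Longrightarrow> q \<le> p \<Longrightarrow> pj p *v x = 0"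
  by (rule pj_eqI) (use G_mono[of q p] zero_F in auto)

lemma pj_pj: "pj p ** pj q = pj (max p q)"
proof -
  have "pj p *v (pj q *v x) = pj (max p q) *v x" for x
  proof (cases "p \<le> q")
    case True
    then show ?thesis using pj_fix[OF pj_F] by simp
  next
    case False
    have "pj p *v (x - pj q *v x) = 0" using pj_kill[OF pj_G, of q p x] False by simp
    then show ?thesis using False by (simp add: vec.diff max_def)
  qed
  then show ?thesis by (simp add: matrix_eq matrix_vector_mul_assoc[symmetric])
qed

lemma pj_top: "pj (n - m) = mat 1"
  by (simp add: matrix_eq pj_eqI top zero_G)

lemma pj_bot: "pj (m + 1) = 0"
  using pj_F[of "m + 1"] bot by (simp add: matrix_eq)

text \<open>The conjugate of \<open>F p\<close> is the kernel of \<open>pj (n - p + 1)\<close>, so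
  conjugation exchanges ranges and kernels.\<close>

lemma pj_conj: "mat_cnj (pj p) = mat 1 - pj (n - p + 1)"
proof -
  have "pj (n - p + 1) *v x = x - cvec_conj (pj p *v cvec_conj x)" for x
  proof (rule pj_eqI)
    have "cvec_conj (cvec_conj x - pj p *v cvec_conj x) \<in> F (n - p + 1)"
      using pj_G[of "cvec_conj x" p] unfolding G_def mem_cvec_conj_image .
    then show "x - cvec_conj (pj p *v cvec_conj x) \<in> F (n - p + 1)" by (simp add: cvec_conj_diff)
    show "x - (x - cvec_conj (pj p *v cvec_conj x)) \<in> G (n - p + 1)"
      using pj_F[of p "cvec_conj x"] by (simp add: G_def)
  qed
  then show ?thesis
    by (simp add: matrix_eq mat_cnj_vector matrix_vector_mult_diff_rdistrib)
qed

lemma pr_conj: "mat_cnj (pr p) = pr (n - p)"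
  by (simp add: hodge_comp_def mat_cnj_diff pj_conj algebra_simps)

lemma pr_F: "pr p *v x \<in> F p"
proof -
  have "pj (p + 1) *v x \<in> F p" using pj_F[of "p + 1" x] F_step by blast
  then show ?thesis unfolding hodge_comp_def matrix_vector_mult_diff_rdistrib
    by (intro vec.subspace_diff[OF F_subspace] pj_F)
qed

lemma pr_G: "pr p *v x \<in> G (p + 1)"
proof -
  have "x - pj p *v x \<in> G (p + 1)" using pj_G[of x p] G_mono[of p "p + 1"] by auto
  then have "(x - pj (p + 1) *v x) - (x - pj p *v x) \<in> G (p + 1)"
    by (rule vec.subspace_diff[OF G_subspace pj_G])
  then show ?thesis unfolding hodge_comp_def matrix_vector_mult_diff_rdistrib by simp
qed

lemma pr_pj: "pr r ** pj p = (if p \<le> r then pr r else 0)"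
  by (cases "p \<le> r") (simp_all add: hodge_comp_def mat_distribs pj_pj max.absorb1 max.absorb2)

lemma pr_pr: "pr p ** pr q = (if p = q then pr p else 0)"
  unfolding hodge_comp_def[of n F q] matrix_diff_ldistrib pr_pj by auto

lemma pr_total: "(\<Sum>p\<in>{n - m..m}. pr p) = mat 1"
proof -
  have "(\<Sum>p\<in>{n - m..k}. pr p) = mat 1 - pj (k + 1)" if "n - m - 1 \<le> k" for k
    using that
  proof (induction k rule: int_ge_induct)
    case base
    then show ?case by (simp add: pj_top)
  next
    case (step i)
    then have "{n - m..i + 1} = insert (i + 1) {n - m..i}" by auto
    then show ?case using step by (simp add: hodge_comp_def)
  qed
  from this[of m] show ?thesis using nm by (simp add: pj_bot)
qed

sublocale grading "{n - m..m}" pr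
  by unfold_locales (auto simp: pr_pr pr_total)

lemma graded_eq: "hodge_graded n m F c = graded c"
  by (simp add: hodge_graded_def graded_def)

lemma pj_graded: "pj k = graded (\<lambda>r. if k \<le> r then 1 else 0)"
proof -
  have "pj k = (\<Sum>r\<in>{n - m..m}. pr r ** pj k)"
    unfolding matrix_sum_left[symmetric] pr_total by simp
  also have "\<dots> = graded (\<lambda>r. if k \<le> r then 1 else 0)"
    unfolding graded_def by (intro sum.cong refl) (simp add: pr_pj)
  finally show ?thesis .
qed

lemma sum_reflect: "(\<Sum>p\<in>{n - m..m}. f (n - p)) = (\<Sum>p\<in>{n - m..m}. f p)" for f :: "int \<Rightarrow> 'z::comm_monoid_add"
  by (rule sum.reindex_bij_witness[of _ "\<lambda>p. n - p" "\<lambda>p. n - p"]) auto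

lemma mat_cnj_graded: "mat_cnj (graded c) = graded (\<lambda>p. cnj (c (n - p)))"
  unfolding graded_def mat_cnj_sum mat_cnj_cscale pr_conj
  using sum_reflect[of "\<lambda>p. cscale (cnj (c (n - p))) (pr p)"] by simp

lemma cnj_hodge_weight: "cnj (hodge_weight n (n - p)) = hodge_weight n p"
  by (simp add: hodge_weight_def complex_eq_iff field_simps)

lemma powi_i_minus: "\<i> powi (- k) = cnj (\<i> powi k)"
  by (simp add: power_int_minus power_int_def complex_cnj_power divide_inverse)

lemma cnj_weil_weight: "cnj (weil_weight n (n - p)) = weil_weight n p"
proof -
  have "2 * p - n = - (2 * (n - p) - n)" by simp
  then show ?thesis unfolding weil_weight_def by (metis powi_i_minus)
qed

lemma complexify_J: "complexify (hodge_J n m F) = graded (hodge_weight n)"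
  unfolding hodge_J_def graded_eq
  by (rule complexify_Re) (simp add: mat_cnj_graded cnj_hodge_weight)

lemma complexify_C: "complexify (hodge_C n m F) = graded (weil_weight n)"
  unfolding hodge_C_def graded_eq
  by (rule complexify_Re) (simp add: mat_cnj_graded cnj_weil_weight)

lemma weil_weight_square: "weil_weight n p * weil_weight n p = complex_of_real ((- 1) powi n)"
proof -
  have "weil_weight n p * weil_weight n p = (\<i> * \<i>) powi (2 * p - n)"
    unfolding weil_weight_def by (simp only: power_int_mult_distrib)
  also have "\<dots> = (- 1) powi n"
    using power_int_minus_one_minus[of "n - 2 * p", where 'a = complex]
    by (simp add: power_int_diff power_int_mult)
  finally show ?thesis by (simp add: of_real_power_int)
qed

lemma C_C: "hodge_C n m F ** hodge_C n m F = (- 1) powi n *\<^sub>R mat 1"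
proof -
  have "complexify (hodge_C n m F ** hodge_C n m F) = complexify ((- 1) powi n *\<^sub>R mat 1)"
    unfolding complexify_mult complexify_C graded_mult weil_weight_square graded_scalar
      cscale_scaleR complexify_scaleR by simp
  then show ?thesis by (simp only: complexify_inject)
qed

lemma C_J: "hodge_C n m F ** hodge_J n m F = hodge_J n m F ** hodge_C n m F"
proof -
  have "complexify (hodge_C n m F ** hodge_J n m F) = complexify (hodge_J n m F ** hodge_C n m F)"
    unfolding complexify_mult complexify_C complexify_J graded_mult by (simp only: mult.commute)
  then show ?thesis by (simp only: complexify_inject)
qed

subsubsection \<open>Horizontal endomorphisms\<close>

context
  fixes N :: "real^'v^'v"
  assumes horizontal: "\<And>p. (*v) (complexify N) ` F p \<subseteq> F (p - 1)"
begin

lemma N_F: "x \<in> F p \<Longrightarrow> complexify N *v x \<in> F (p - 1)"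
  using horizontal by blast

lemma N_G: "x \<in> G p \<Longrightarrow> complexify N *v x \<in> G (p + 1)"
  unfolding G_def mem_cvec_conj_image cvec_conj_mult
  using N_F[of "cvec_conj x" "n - p + 1"] by (simp add: algebra_simps)

text \<open>N lowers F by one step and, being real, raises G by one, so type p goes into the
  intersection of F (p - 1) and G (p + 2), which consists of the types p - 1, p and p + 1.\<close>

lemma component_N_zero:
  assumes "\<not> (q - 1 \<le> p \<and> p \<le> q + 1)"
  shows "pr q ** complexify N ** pr p = 0"
proof -
  have "pr q *v (complexify N *v (pr p *v x)) = 0" for x
  proof -
    define v where "v = complexify N *v (pr p *v x)"
    have v: "v \<in> F (p - 1)" "v \<in> G (p + 2)"
      unfolding v_def using N_F[OF pr_F[of p x]] N_G[OF pr_G[of p x]] by (simp_all add: add.assoc)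
    consider "q + 1 \<le> p - 1" | "p + 2 \<le> q" using assms by linarith
    then have "pr q *v v = 0"
      by cases (simp_all add: hodge_comp_def matrix_vector_mult_diff_rdistrib pj_fix[OF v(1)] pj_kill[OF v(2)])
    then show ?thesis by (simp only: v_def)
  qed
  then show ?thesis by (simp add: matrix_eq matrix_vector_mul_assoc[symmetric])
qed

text \<open>Scalar identities on the blocks of N have to hold only for the type shifts -1, 0 and
  1.\<close>

lemma component_N_cong:
  assumes "\<And>k. k \<in> {- 1, 0, 1} \<Longrightarrow> q = p + k \<Longrightarrow> c = d"
  shows "cscale c (pr q ** complexify N ** pr p) = cscale d (pr q ** complexify N ** pr p)"
proof (cases "q - 1 \<le> p \<and> p \<le> q + 1")
  case True
  then have "q - p \<in> {- 1, 0, 1}" by auto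
  then show ?thesis using assms[of "q - p"] by simp
qed (simp add: component_N_zero)

lemma hodge_weight_diff: "hodge_weight n q - hodge_weight n p = \<i> * of_int (q - p)"
  by (simp add: hodge_weight_def field_simps)

lemma component_ad_J:
  assumes "p \<in> {n - m..m}" "q \<in> {n - m..m}"
  shows "pr q ** complexify (ad (hodge_J n m F) X) ** pr p =
    cscale (\<i> * of_int (q - p)) (pr q ** complexify X ** pr p)"
  unfolding complexify_ad complexify_J component_commutator[OF assms] hodge_weight_diff ..

text \<open>On a block of shift k, ad J is multiplication by i k, and (i k)^3 = - i k for k in {-1,
  0, 1}.\<close>

lemma J_triple:
  "ad (hodge_J n m F) (ad (hodge_J n m F) (ad (hodge_J n m F) N)) = - ad (hodge_J n m F) N"
proof -
  have "complexify (ad (hodge_J n m F) (ad (hodge_J n m F) (ad (hodge_J n m F) N))) = complexify (- ad (hodge_J n m F) N)"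
  proof (rule component_eqI)
    fix p q assume p: "p \<in> {n - m..m}" and q: "q \<in> {n - m..m}"
    define k where "k = \<i> * complex_of_int (q - p)"
    have "cscale (k * (k * k)) (pr q ** complexify N ** pr p) = cscale (- k) (pr q ** complexify N ** pr p)"
      by (rule component_N_cong) (auto simp: k_def)
    then show "pr q ** complexify (ad (hodge_J n m F) (ad (hodge_J n m F) (ad (hodge_J n m F) N))) ** pr p =
      pr q ** complexify (- ad (hodge_J n m F) N) ** pr p"
      unfolding complexify_minus matrix_minus_left matrix_minus_right component_ad_J[OF p q] cscale_cscale
        cscale_minus_left k_def .
  qed
  then show ?thesis by (simp only: complexify_inject)
qed

text \<open>On a block of shift k, Ad C is multiplication by i^(2k) = (-1)^k, which equals 1 - 2 k^2
  for k in {-1, 0, 1}.\<close>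

lemma C_N: "hodge_C n m F ** N = (N - 2 *\<^sub>R ad (hodge_J n m F) (ad N (hodge_J n m F))) ** hodge_C n m F"
proof -
  have A: "N - 2 *\<^sub>R ad (hodge_J n m F) (ad N (hodge_J n m F)) =
      N + 2 *\<^sub>R ad (hodge_J n m F) (ad (hodge_J n m F) N)"
    using ad_anti[of N "hodge_J n m F"] by (simp add: ad_linear_simps)
  have "complexify (hodge_C n m F ** N) =
      complexify ((N + 2 *\<^sub>R ad (hodge_J n m F) (ad (hodge_J n m F) N)) ** hodge_C n m F)"
  proof (rule component_eqI)
    fix p q assume p: "p \<in> {n - m..m}" and q: "q \<in> {n - m..m}"
    define k where "k = \<i> * complex_of_int (q - p)"
    define M where "M = pr q ** complexify N ** pr p"
    have "pr q ** complexify (hodge_C n m F ** N) ** pr p = cscale (weil_weight n q) M"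
      unfolding complexify_mult complexify_C component_left[OF q] M_def ..
    also have "\<dots> = cscale (weil_weight n p * (1 + of_real 2 * (k * k))) M"
      unfolding M_def
    proof (rule component_N_cong)
      fix j assume j: "j \<in> {- 1, 0, 1 :: int}" "q = p + j"
      have e: "2 * (p + j) - n = (2 * p - n) + 2 * j" by simp
      have "weil_weight n q = weil_weight n p * (\<i> powi 2) powi j"
        unfolding weil_weight_def j(2) e by (simp add: power_int_add power_int_mult)
      then show "weil_weight n q = weil_weight n p * (1 + of_real 2 * (k * k))"
        using j by (auto simp: k_def)
    qed
    also have "\<dots> = cscale (weil_weight n p) (M + cscale (of_real 2) (cscale k (cscale k M)))"
      by (simp only: cscale_cscale cscale_add[symmetric] distrib_left mult_1_right cscale_add_left cscale_add)
    also have "\<dots> = pr q ** complexify ((N + 2 *\<^sub>R ad (hodge_J n m F) (ad (hodge_J n m F) N)) ** hodge_C n m F) ** pr p"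
      unfolding complexify_mult complexify_C component_right[OF p] complexify_add complexify_scaleR
        matrix_add_ldistrib matrix_add_rdistrib matrix_scaleR_left matrix_scaleR_right
        component_ad_J[OF p q] M_def k_def
      by (simp only: cscale_scaleR[symmetric] cscale_add cscale_cscale mult_ac)
    finally show "pr q ** complexify (hodge_C n m F ** N) ** pr p =
      pr q ** complexify ((N + 2 *\<^sub>R ad (hodge_J n m F) (ad (hodge_J n m F) N)) ** hodge_C n m F) ** pr p" .
  qed
  then show ?thesis unfolding A by (simp only: complexify_inject)
qed

text \<open>The left side is the velocity of the projection when the filtration moves by exp (i l
  N). The right side is a commutator with the real element xi = [N, J], the same for all k; so every
  graded operator T, in particular J and C, moves by T' = [xi, T].\<close>

lemma pj_commutator:
  "cscale \<i> ((mat 1 - pj k) ** complexify N ** pj k + pj k ** complexify N ** (mat 1 - pj k)) =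
    complexify (ad N (hodge_J n m F)) ** pj k - pj k ** complexify (ad N (hodge_J n m F))"
proof (rule component_eqI)
  fix p q assume p: "p \<in> {n - m..m}" and q: "q \<in> {n - m..m}"
  define c where "c r = (if k \<le> r then 1 else 0 :: complex)" for r
  have pj: "pj k = graded c" using pj_graded[of k] unfolding c_def .
  have co: "mat 1 - pj k = graded (\<lambda>r. 1 - c r)"
    unfolding pj graded_one[symmetric] by (simp add: graded_def sum_subtractf[symmetric] cscale_diff_left)
  have xi: "ad N (hodge_J n m F) = - ad (hodge_J n m F) N" by (rule ad_anti)
  have "cscale (\<i> * ((1 - c q) * c p + c q * (1 - c p))) (pr q ** complexify N ** pr p)
      = cscale ((c p - c q) * - (\<i> * of_int (q - p))) (pr q ** complexify N ** pr p)"
    by (rule component_N_cong) (auto simp: c_def)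
  moreover have "pr q ** (cscale \<i> ((mat 1 - pj k) ** complexify N ** pj k + pj k ** complexify N ** (mat 1 - pj k))) ** pr p
      = cscale (\<i> * ((1 - c q) * c p + c q * (1 - c p))) (pr q ** complexify N ** pr p)"
    unfolding co unfolding pj
    unfolding cscale_mult_left cscale_mult_right matrix_add_ldistrib matrix_add_rdistrib
      component_right[OF p] component_left[OF q] cscale_add cscale_cscale distrib_left cscale_add_left
    by (simp only: mult_ac)
  moreover have "pr q ** (complexify (ad N (hodge_J n m F)) ** pj k - pj k ** complexify (ad N (hodge_J n m F))) ** pr p
      = cscale ((c p - c q) * - (\<i> * of_int (q - p))) (pr q ** complexify N ** pr p)"
    unfolding xi unfolding pj
    unfolding matrix_diff_ldistrib matrix_diff_rdistrib component_right[OF p] component_left[OF q]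
      complexify_minus matrix_minus_left matrix_minus_right component_ad_J[OF p q] cscale_cscale
      cscale_minus cscale_diff_left left_diff_distrib mult_minus_right cscale_minus_left
    by simp
  ultimately show "pr q ** (cscale \<i> ((mat 1 - pj k) ** complexify N ** pj k + pj k ** complexify N ** (mat 1 - pj k))) ** pr p
    = pr q ** (complexify (ad N (hodge_J n m F)) ** pj k - pj k ** complexify (ad N (hodge_J n m F))) ** pr p"
    by (simp only:)
qed

end

subsubsection \<open>The polarization\<close>

lemma bilinear_Q: "bilinear Q" and Q_sym: "Q y x = (- 1) powi n * Q x y"
  using pol unfolding polarization_form_def by blast+

lemma pr_orthogonal:
  assumes "p + q \<noteq> n" shows "bilinear_ext Q (pr p *v x) (pr q *v y) = 0"
proof (cases "p + q > n")
  case True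
  then have "pr q *v y \<in> F (n - p + 1)" using pr_F[of q y] F_anti[of "n - p + 1" q] by auto
  then show ?thesis by (rule riemann[OF pr_F])
next
  case False
  have "cvec_conj (pr p *v x) \<in> F (n - p)" "cvec_conj (pr q *v y) \<in> F (n - q)"
    using pr_G[of p x] pr_G[of q y] unfolding G_def mem_cvec_conj_image by simp_all
  moreover have "F (n - q) \<subseteq> F (n - (n - p) + 1)" using assms False by (intro F_anti) simp
  ultimately have "bilinear_ext Q (cvec_conj (pr p *v x)) (cvec_conj (pr q *v y)) = 0"
    by (intro riemann) auto
  then show ?thesis by (simp add: bilinear_ext_conj)
qed

lemma bilinear_ext_graded:
  "bilinear_ext Q (graded c *v x) (graded d *v y) =
    (\<Sum>p\<in>{n - m..m}. c p * d (n - p) * bilinear_ext Q (pr p *v x) (pr (n - p) *v y))"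
proof -
  have "bilinear_ext Q (graded c *v x) (graded d *v y) =
     (\<Sum>p\<in>{n - m..m}. \<Sum>q\<in>{n - m..m}. c p * d q * bilinear_ext Q (pr p *v x) (pr q *v y))"
    unfolding graded_def matrix_sum_vector cscale_vector bilinear_ext_sum_left
    unfolding bilinear_ext_sum_right bilinear_ext_scale_left bilinear_ext_scale_right
    by (simp add: sum_distrib_left mult.assoc mult.left_commute)
  also have "\<dots> = (\<Sum>p\<in>{n - m..m}. c p * d (n - p) * bilinear_ext Q (pr p *v x) (pr (n - p) *v y))"
  proof (rule sum.cong[OF refl])
    fix p assume "p \<in> {n - m..m}"
    then have "n - p \<in> {n - m..m}" by auto
    moreover have "(\<Sum>q\<in>{n - m..m}. c p * d q * bilinear_ext Q (pr p *v x) (pr q *v y)) =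
      (\<Sum>q\<in>{n - m..m}. if q = n - p then c p * d (n - p) * bilinear_ext Q (pr p *v x) (pr (n - p) *v y) else 0)"
      by (intro sum.cong refl) (auto simp: pr_orthogonal)
    ultimately show "(\<Sum>q\<in>{n - m..m}. c p * d q * bilinear_ext Q (pr p *v x) (pr q *v y)) =
      c p * d (n - p) * bilinear_ext Q (pr p *v x) (pr (n - p) *v y)" by simp
  qed
  finally show ?thesis .
qed

lemma J_lie: "hodge_J n m F \<in> lie_algebra_Q Q"
  unfolding lie_algebra_Q_def
proof (intro CollectI allI)
  fix x y
  have "complex_of_real (Q (hodge_J n m F *v x) y + Q x (hodge_J n m F *v y)) =
      bilinear_ext Q (graded (hodge_weight n) *v cvec x) (graded (\<lambda>_. 1) *v cvec y)
      + bilinear_ext Q (graded (\<lambda>_. 1) *v cvec x) (graded (hodge_weight n) *v cvec y)"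
    unfolding complexify_J[symmetric] graded_one complexify_cvec
    by (simp add: bilinear_ext_cvec[OF bilinear_Q])
  also have "\<dots> = (\<Sum>p\<in>{n - m..m}. (hodge_weight n p + hodge_weight n (n - p)) *
      bilinear_ext Q (pr p *v cvec x) (pr (n - p) *v cvec y))"
    unfolding bilinear_ext_graded sum.distrib[symmetric] by (simp add: distrib_right)
  also have "\<dots> = 0" by (intro sum.neutral) (simp add: hodge_weight_def field_simps)
  finally show "Q (hodge_J n m F *v x) y + Q x (hodge_J n m F *v y) = 0"
    by (simp only: of_real_eq_0_iff)
qed

lemma C_isometry: "Q (hodge_C n m F *v x) (hodge_C n m F *v y) = Q x y"
proof -
  have "weil_weight n p * weil_weight n (n - p) = 1" for p
  proof -
    have "2 * (n - p) - n = - (2 * p - n)" by simp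
    then show ?thesis unfolding weil_weight_def by (simp only: power_int_minus) simp
  qed
  then have "complex_of_real (Q (hodge_C n m F *v x) (hodge_C n m F *v y)) =
      bilinear_ext Q (graded (\<lambda>_. 1) *v cvec x) (graded (\<lambda>_. 1) *v cvec y)"
    using bilinear_ext_graded[of "weil_weight n" "cvec x" "weil_weight n" "cvec y"]
      bilinear_ext_graded[of "\<lambda>_. 1" "cvec x" "\<lambda>_. 1" "cvec y"]
    unfolding complexify_C[symmetric] complexify_cvec by (simp add: bilinear_ext_cvec[OF bilinear_Q])
  then show ?thesis by (simp add: graded_one bilinear_ext_cvec[OF bilinear_Q])
qed

lemma C_positive:
  assumes "u \<noteq> 0" shows "0 < Q (hodge_C n m F *v u) u"
proof -
  define r where "r p = Re (weil_weight n p * bilinear_ext Q (pr p *v cvec u) (pr (n - p) *v cvec u))" for p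
  have "complex_of_real (Q (hodge_C n m F *v u) u) =
     bilinear_ext Q (graded (weil_weight n) *v cvec u) (graded (\<lambda>_. 1) *v cvec u)"
    unfolding complexify_C[symmetric] complexify_cvec graded_one by (simp add: bilinear_ext_cvec[OF bilinear_Q])
  also have "\<dots> = (\<Sum>p\<in>{n - m..m}. weil_weight n p * bilinear_ext Q (pr p *v cvec u) (pr (n - p) *v cvec u))"
    unfolding bilinear_ext_graded by simp
  finally have "Q (hodge_C n m F *v u) u = Re (\<Sum>p\<in>{n - m..m}. weil_weight n p * bilinear_ext Q (pr p *v cvec u) (pr (n - p) *v cvec u))"
    by (metis Re_complex_of_real)
  then have eq: "Q (hodge_C n m F *v u) u = (\<Sum>p\<in>{n - m..m}. r p)"
    by (simp only: Re_sum r_def)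
  have rpos: "0 < r p" if "pr p *v cvec u \<noteq> 0" for p
  proof -
    have "pr (n - p) *v cvec u = cvec_conj (pr p *v cvec u)"
      by (simp add: pr_conj[symmetric] mat_cnj_vector)
    moreover have "pr p *v cvec u \<in> cvec_conj ` F (n - p)" using pr_G[of p "cvec u"] by (simp add: G_def)
    ultimately show ?thesis
      using positive[of p "n - p" "pr p *v cvec u"] pr_F that unfolding r_def weil_weight_def
      by (simp add: algebra_simps)
  qed
  have rnn: "0 \<le> r p" for p
    by (cases "pr p *v cvec u = 0") (use rpos[of p] in \<open>auto simp: r_def\<close>)
  have "\<exists>p\<in>{n - m..m}. pr p *v cvec u \<noteq> 0"
  proof (rule ccontr)
    assume "\<not> ?thesis"
    then have "(\<Sum>p\<in>{n - m..m}. pr p) *v cvec u = 0" unfolding matrix_sum_vector by simp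
    then show False using assms by (simp add: pr_total)
  qed
  then obtain p where "p \<in> {n - m..m}" "0 < r p" using rpos by blast
  then show ?thesis unfolding eq using rnn by (intro sum_pos2) auto
qed

lemma Q_C_swap: "Q (hodge_C n m F *v x) y = (- 1) powi n * Q x (hodge_C n m F *v y)"
proof -
  have "Q (hodge_C n m F *v x) y = Q (hodge_C n m F *v (hodge_C n m F *v x)) (hodge_C n m F *v y)"
    by (simp add: C_isometry)
  also have "hodge_C n m F *v (hodge_C n m F *v x) = (- 1) powi n *\<^sub>R x"
    unfolding matrix_vector_mul_assoc C_C by (simp add: scaleR_matrix_vector_assoc[symmetric])
  finally show ?thesis by (simp add: bilinear_lmul[OF bilinear_Q])
qed

lemma C_sym: "Q (hodge_C n m F *v x) y = Q (hodge_C n m F *v y) x"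
  using Q_C_swap[of x y] Q_sym[of "hodge_C n m F *v y" x]
  by (simp add: mult.assoc[symmetric])

text \<open>For the positive form H x y = Q (C x) y, the adjoint of Y in the Lie algebra is - e C Y
  C. In an H-orthonormal frame adjoints are transposes, so the twisted trace form becomes the
  Frobenius inner product.\<close>

lemma hodge_frame:
  "\<exists>R R' :: real^'v^'v. R ** R' = mat 1 \<and> R' ** R = mat 1 \<and>
     (\<forall>X\<in>lie_algebra_Q Q. \<forall>Y\<in>lie_algebra_Q Q.
       - ((- 1) powi n) * trace (X ** hodge_C n m F ** Y ** hodge_C n m F) = (R ** X ** R') \<bullet> (R ** Y ** R'))"
proof -
  define C where "C = hodge_C n m F"
  define e :: real where "e = (- 1) powi n"
  define H where "H x y = Q (C *v x) y" for x y
  have "bilinear H"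
    unfolding bilinear_def H_def
    by (auto intro!: linearI simp: matrix_vector_right_distrib matrix_vector_mult_scaleR
        bilinear_ladd[OF bilinear_Q] bilinear_radd[OF bilinear_Q] bilinear_lmul[OF bilinear_Q] bilinear_rmul[OF bilinear_Q])
  moreover have "H x y = H y x" for x y unfolding H_def C_def by (rule C_sym)
  moreover have "0 < H x x" if "x \<noteq> 0" for x unfolding H_def C_def using that by (rule C_positive)
  ultimately obtain R R' :: "real^'v^'v" where R: "R ** R' = mat 1" "R' ** R = mat 1"
    and H: "\<And>x y. H x y = (R *v x) \<bullet> (R *v y)"
    using posdef_frame[of H] by metis
  have "- e * trace (X ** C ** Y ** C) = (R ** X ** R') \<bullet> (R ** Y ** R')"
    if Y: "Y \<in> lie_algebra_Q Q" for X Y :: "real^'v^'v"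
  proof -
    define Z where "Z = - e *\<^sub>R (C ** Y ** C)"
    have adj: "H (Y *v u) v = H u (Z *v v)" for u v
    proof -
      have Zv: "Z *v v = (- e) *\<^sub>R (C *v (Y *v (C *v v)))"
        by (simp add: Z_def scaleR_matrix_vector_assoc matrix_vector_mul_assoc matrix_mul_assoc)
      have "H (Y *v u) v = e * Q (Y *v u) (C *v v)"
        unfolding H_def C_def e_def by (rule Q_C_swap)
      also have "Q (Y *v u) (C *v v) = - Q u (Y *v (C *v v))"
        using Y unfolding lie_algebra_Q_def by (simp add: eq_neg_iff_add_eq_0)
      also have "Q u (Y *v (C *v v)) = Q (C *v u) (C *v (Y *v (C *v v)))"
        unfolding C_def by (simp add: C_isometry)
      also have "e * - \<dots> = H u (Z *v v)"
        unfolding H_def Zv bilinear_rmul[OF bilinear_Q] by simp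
      finally show ?thesis .
    qed
    have "transpose (R ** Y ** R') = R ** Z ** R'"
    proof -
      have "a \<bullet> (transpose (R ** Y ** R') *v b) = a \<bullet> ((R ** Z ** R') *v b)" for a b
      proof -
        have ab: "R *v (R' *v a) = a" "R *v (R' *v b) = b" by (simp_all add: matrix_vector_mul_assoc R)
        have "a \<bullet> (transpose (R ** Y ** R') *v b) = ((R ** Y ** R') *v a) \<bullet> b"
          unfolding transpose_matrix_vector inner_commute[of a] dot_lmul_matrix by (rule inner_commute)
        also have "\<dots> = H (Y *v (R' *v a)) (R' *v b)"
          unfolding H ab by (simp add: matrix_vector_mul_assoc matrix_mul_assoc)
        also have "\<dots> = a \<bullet> ((R ** Z ** R') *v b)"
          unfolding adj unfolding H ab by (simp add: matrix_vector_mul_assoc matrix_mul_assoc)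
        finally show ?thesis .
      qed
      then have "transpose (R ** Y ** R') *v b = (R ** Z ** R') *v b" for b
        using vector_eq_ldot by blast
      then show ?thesis by (simp add: matrix_eq)
    qed
    then have "(R ** X ** R') \<bullet> (R ** Y ** R') = trace (R ** X ** (R' ** R) ** Z ** R')"
      by (simp add: inner_matrix_eq_trace matrix_mul_assoc)
    also have "\<dots> = trace (R' ** R ** X ** Z)"
      using trace_mul_sym[of "R ** X ** Z" R'] by (simp add: R matrix_mul_assoc)
    also have "\<dots> = - e * trace (X ** C ** Y ** C)"
      by (simp add: R Z_def mat_distribs trace_scaleR trace_minus matrix_mul_assoc)
    finally show ?thesis by simp
  qed
  then show ?thesis using R unfolding C_def e_def by blast
qed

end

subsection \<open>Exponentials of nilpotent matrices\<close>

lemma mat_exp_nilpotent: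
  assumes "mat_power A d = 0"
  shows "mat_exp A = (\<Sum>m<d. mat_power A m /\<^sub>R fact m)"
  unfolding mat_exp_def
  by (rule suminf_finite) (use mat_power_zero_mono[OF assms] in auto)

lemma mat_power_scaleR:
  "mat_power (r *\<^sub>R A) m = r ^ m *\<^sub>R mat_power (A :: 'a::{comm_ring_1,real_algebra_1}^'v^'v) m"
  by (induction m) (simp_all add: mat_power_Suc mat_distribs)

lemma mat_power_cscale: "mat_power (cscale c A) m = cscale (c ^ m) (mat_power A m)"
proof (induction m)
  case 0
  show ?case by (simp only: mat_power_0 power_0 cscale_one)
next
  case (Suc m)
  have "mat_power (cscale c A) (Suc m) = cscale (c * c ^ m) (mat_power A (Suc m))"
    unfolding mat_power_Suc Suc.IH cscale_mult_left cscale_mult_right cscale_cscale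
    by (simp only: mult.commute)
  then show ?case by (simp only: power_Suc)
qed

lemma mat_power_complexify: "mat_power (complexify A) m = complexify (mat_power A m)"
  by (induction m) (simp_all add: mat_power_Suc complexify_mult)

lemma mat_cnj_power: "mat_cnj (mat_power A m) = mat_power (mat_cnj A) m"
  by (induction m) (simp_all add: mat_power_Suc mat_cnj_mult)

lemma mat_cnj_scaleR: "mat_cnj (r *\<^sub>R A) = r *\<^sub>R mat_cnj A"
  by (simp add: vec_eq_iff)

lemma mat_cnj_exp:
  assumes "mat_power A d = 0"
  shows "mat_cnj (mat_exp A) = mat_exp (mat_cnj A)"
proof -
  have "mat_power (mat_cnj A) d = 0" using assms by (simp add: mat_cnj_power[symmetric])
  then show ?thesis
    by (simp add: mat_exp_nilpotent[OF assms] mat_exp_nilpotent mat_cnj_sum mat_cnj_scaleR mat_cnj_power)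
qed

lemma mat_exp_commute:
  assumes "A ** B = B ** A" "mat_power A d = 0"
  shows "mat_exp A ** B = B ** mat_exp A"
  unfolding mat_exp_nilpotent[OF assms(2)] matrix_sum_left matrix_sum_right
  by (intro sum.cong refl) (simp add: mat_distribs mat_power_commute[OF assms(1)])

lemma mat_power_deriv:
  fixes A B :: "complex^'v^'v"
  assumes c: "A ** B = B ** A"
  shows "((\<lambda>s. mat_power (A + s *\<^sub>R B) m) has_vector_derivative
    real m *\<^sub>R (B ** mat_power (A + l *\<^sub>R B) (m - 1))) (at l)"
proof (induction m)
  case 0
  show ?case by simp
next
  case (Suc m)
  define S where "S = A + l *\<^sub>R B"
  have SB: "S ** B = B ** S" unfolding S_def by (simp add: mat_distribs c)
  have "((\<lambda>s. A + s *\<^sub>R B) has_vector_derivative B) (at l)"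
    by (auto intro!: derivative_eq_intros)
  from bounded_bilinear.has_vector_derivative[OF bounded_bilinear_matrix_mult this Suc]
  have d: "((\<lambda>s. mat_power (A + s *\<^sub>R B) (Suc m)) has_vector_derivative
      S ** (real m *\<^sub>R (B ** mat_power S (m - 1))) + B ** mat_power S m) (at l)"
    unfolding mat_power_Suc S_def by simp
  have "S ** (real m *\<^sub>R (B ** mat_power S (m - 1))) = real m *\<^sub>R (B ** mat_power S m)"
  proof (cases m)
    case (Suc k)
    have "S ** (B ** mat_power S k) = B ** mat_power S (Suc k)"
      by (simp add: mat_power_Suc matrix_mul_assoc SB)
    then show ?thesis using Suc by (simp add: matrix_scaleR_right)
  qed simp
  then show ?case using d unfolding S_def[symmetric] by (simp add: scaleR_left_distrib add.commute)
qed

lemma mat_exp_deriv: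
  fixes A B :: "complex^'v^'v"
  assumes c: "A ** B = B ** A" and nil: "\<And>s. mat_power (A + s *\<^sub>R B) d = 0"
  shows "((\<lambda>s. mat_exp (A + s *\<^sub>R B)) has_vector_derivative B ** mat_exp (A + l *\<^sub>R B)) (at l)"
proof -
  \<comment> \<open>One more vanishing term, so that the differentiated sum, whose index drops by
    one, still contains the whole exponential.\<close>
  have nil': "mat_power (A + s *\<^sub>R B) (Suc d) = 0" for s by (simp add: mat_power_Suc nil)
  have "((\<lambda>s. \<Sum>m<Suc d. mat_power (A + s *\<^sub>R B) m /\<^sub>R fact m) has_vector_derivative
     (\<Sum>m<Suc d. (real m *\<^sub>R (B ** mat_power (A + l *\<^sub>R B) (m - 1))) /\<^sub>R fact m)) (at l)"
    by (intro has_vector_derivative_sum bounded_linear.has_vector_derivative[OF bounded_linear_scaleR_right] mat_power_deriv[OF c])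
  moreover have coeff: "(real (Suc m) *\<^sub>R M) /\<^sub>R fact (Suc m) = M /\<^sub>R fact m" for m and M :: "complex^'v^'v"
  proof -
    have "inverse (fact (Suc m)) * real (Suc m) = inverse (fact m)"
      unfolding fact_Suc by (simp add: field_simps del: of_nat_Suc)
    then show ?thesis by (simp only: scaleR_scaleR)
  qed
  have "(\<Sum>m<Suc d. (real m *\<^sub>R (B ** mat_power (A + l *\<^sub>R B) (m - 1))) /\<^sub>R fact m) = B ** mat_exp (A + l *\<^sub>R B)"
    unfolding mat_exp_nilpotent[OF nil] sum.lessThan_Suc_shift matrix_sum_right
    unfolding coeff matrix_scaleR_right by simp
  ultimately show ?thesis by (simp add: mat_exp_nilpotent[OF nil'] del: sum.lessThan_Suc)
qed

lemma mat_exp_zero [simp]: "mat_exp 0 = mat 1"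
  using mat_exp_nilpotent[of 0 1] by (simp add: mat_power_Suc)

lemma mat_exp_minus:
  fixes A :: "complex^'v^'v"
  assumes "mat_power A d = 0"
  shows "mat_exp A ** mat_exp (- A) = mat 1"
proof -
  define f where "f s = mat_exp (0 + s *\<^sub>R A) ** mat_exp (0 + s *\<^sub>R (- A))" for s :: real
  have nil: "mat_power (0 + s *\<^sub>R A) d = 0" "mat_power (0 + s *\<^sub>R (- A)) d = 0" for s
    using mat_power_scaleR[of s A d] mat_power_scaleR[of "- s" A d] assms by simp_all
  have "(f has_vector_derivative 0) (at s within UNIV)" for s
  proof -
    have "(f has_vector_derivative (mat_exp (0 + s *\<^sub>R A) ** ((- A) ** mat_exp (0 + s *\<^sub>R (- A)))
        + (A ** mat_exp (0 + s *\<^sub>R A)) ** mat_exp (0 + s *\<^sub>R (- A)))) (at s)"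
      unfolding f_def[abs_def]
      by (intro bounded_bilinear.has_vector_derivative[OF bounded_bilinear_matrix_mult]
          mat_exp_deriv[OF _ nil(1)] mat_exp_deriv[OF _ nil(2)]) simp_all
    moreover have "mat_exp (0 + s *\<^sub>R A) ** A = A ** mat_exp (0 + s *\<^sub>R A)"
      by (rule mat_exp_commute[OF _ nil(1)]) (simp add: mat_distribs)
    then have "mat_exp (0 + s *\<^sub>R A) ** ((- A) ** mat_exp (0 + s *\<^sub>R (- A)))
        + (A ** mat_exp (0 + s *\<^sub>R A)) ** mat_exp (0 + s *\<^sub>R (- A)) = 0"
      by (simp add: mat_distribs matrix_mul_assoc)
    ultimately show ?thesis by metis
  qed
  then obtain c where "\<And>s. f s = c"
    using has_vector_derivative_zero_constant[of UNIV f] by auto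
  then have "f 1 = f 0" by metis
  then show ?thesis by (simp add: f_def)
qed

subsection \<open>Derivatives of moving projections\<close>

lemma has_vector_derivative_iff_quotient:
  "(f has_vector_derivative D) (at x) \<longleftrightarrow> ((\<lambda>y. (f y - f x) /\<^sub>R (y - x)) \<longlongrightarrow> D) (at x)"
proof -
  have "(f has_vector_derivative D) (at x) \<longleftrightarrow>
      ((\<lambda>y. norm ((f y - f x) - (y - x) *\<^sub>R D) / norm (y - x)) \<longlongrightarrow> 0) (at x)"
    unfolding has_vector_derivative_def has_derivative_iff_norm
    using bounded_linear_scaleR_left by auto
  also have "\<dots> \<longleftrightarrow> ((\<lambda>y. norm ((f y - f x) /\<^sub>R (y - x) - D)) \<longlongrightarrow> 0) (at x)"
  proof (rule tendsto_cong)
    have "norm (f y - f x - (y - x) *\<^sub>R D) / norm (y - x) = norm ((f y - f x) /\<^sub>R (y - x) - D)" if "y \<noteq> x" for y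
    proof -
      have "(f y - f x) /\<^sub>R (y - x) - D = (f y - f x - (y - x) *\<^sub>R D) /\<^sub>R (y - x)"
        using that by (simp add: scaleR_diff_right)
      then show ?thesis by (simp add: divide_inverse mult.commute)
    qed
    then show "\<forall>\<^sub>F y in at x. norm (f y - f x - (y - x) *\<^sub>R D) / norm (y - x) = norm ((f y - f x) /\<^sub>R (y - x) - D)"
      by (auto simp: eventually_at_filter)
  qed
  also have "\<dots> \<longleftrightarrow> ((\<lambda>y. (f y - f x) /\<^sub>R (y - x)) \<longlongrightarrow> D) (at x)"
    by (simp add: tendsto_norm_zero_iff LIM_zero_iff)
  finally show ?thesis .
qed

text \<open>Once L is close to 1, |D| <= 2 |D L|, so D stays bounded and D (L - 1) tends to
  zero.\<close>

lemma tendsto_matrix_cancel: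
  fixes D L :: "'x \<Rightarrow> complex^'v^'v"
  assumes DL: "((\<lambda>y. D y ** L y) \<longlongrightarrow> R) A" and L: "(L \<longlongrightarrow> mat 1) A"
  shows "(D \<longlongrightarrow> R) A"
proof -
  obtain K where K: "K > 0" "\<And>(X :: complex^'v^'v) (Y :: complex^'v^'v). norm (X ** Y) \<le> norm X * norm Y * K"
    using bounded_bilinear.pos_bounded[OF bounded_bilinear_matrix_mult] by blast
  define e where "e y = K * norm (L y - mat 1)" for y
  have "((\<lambda>y. K * norm (L y - mat 1)) \<longlongrightarrow> K * norm (mat 1 - mat 1 :: complex^'v^'v)) A"
    by (intro tendsto_intros L)
  then have e: "(e \<longlongrightarrow> 0) A" by (simp add: e_def[abs_def])
  have step: "norm (D y ** (L y - mat 1)) \<le> norm (D y) * e y" for y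
    using K(2)[of "D y" "L y - mat 1"] by (simp add: e_def mult_ac)
  have "\<forall>\<^sub>F y in A. e y < 1 / 2" using e by (rule order_tendstoD) simp
  then have "\<forall>\<^sub>F y in A. norm (D y ** (L y - mat 1)) \<le> 2 * norm (D y ** L y) * e y"
  proof eventually_elim
    case (elim y)
    have e0: "0 \<le> e y" using K(1) by (simp add: e_def)
    have "D y ** L y - D y ** (L y - mat 1) = D y" by (simp add: mat_distribs)
    then have "norm (D y) \<le> norm (D y ** L y) + norm (D y ** (L y - mat 1))"
      using norm_triangle_ineq4[of "D y ** L y" "D y ** (L y - mat 1)"] by (simp only:)
    also have "norm (D y ** (L y - mat 1)) \<le> norm (D y) * (1 / 2)"
    proof (rule order_trans[OF step])
      show "norm (D y) * e y \<le> norm (D y) * (1 / 2)" using elim by (intro mult_left_mono) auto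
    qed
    finally have "norm (D y) \<le> 2 * norm (D y ** L y)" by linarith
    then have "norm (D y) * e y \<le> 2 * norm (D y ** L y) * e y" by (rule mult_right_mono[OF _ e0])
    with step[of y] show ?case by (rule order_trans)
  qed
  moreover have "((\<lambda>y. 2 * norm (D y ** L y) * e y) \<longlongrightarrow> 2 * norm R * 0) A"
    by (intro tendsto_intros DL e)
  then have "((\<lambda>y. 2 * norm (D y ** L y) * e y) \<longlongrightarrow> 0) A" by simp
  ultimately have "((\<lambda>y. D y ** (L y - mat 1)) \<longlongrightarrow> 0) A" by (rule Lim_null_comparison)
  from tendsto_diff[OF DL this] show ?thesis by (simp add: mat_distribs)
qed

text \<open>
  \<open>P y\<close> projects onto \<open>G y\<close> times the range of \<open>P x\<close> along \<open>H y\<close> times its kernel. Dividing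
  \<open>(P y - P x) L = G P x - P x L\<close>, where \<open>L = G P x + H (1 - P x)\<close>, by \<open>y - x\<close> avoids
  differentiating an inverse.
\<close>

lemma projection_deriv:
  fixes P G H :: "real \<Rightarrow> complex^'v^'v"
  assumes rel: "\<forall>\<^sub>F y in at x. P y ** (G y ** P x + H y ** (mat 1 - P x)) = G y ** P x"
    and G: "(G has_vector_derivative K) (at x)" "G x = mat 1"
    and H: "(H has_vector_derivative - K) (at x)" "H x = mat 1"
  shows "(P has_vector_derivative ((mat 1 - P x) ** K ** P x + P x ** K ** (mat 1 - P x))) (at x)"
proof -
  define L where "L y = G y ** P x + H y ** (mat 1 - P x)" for y
  define M where "M y = G y ** P x - P x ** L y" for y
  note bb = bounded_bilinear.has_vector_derivative[OF bounded_bilinear_matrix_mult]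
  have L': "(L has_vector_derivative (G x ** 0 + K ** P x + (H x ** (0 - 0) + (- K) ** (mat 1 - P x)))) (at x)"
    unfolding L_def[abs_def]
    by (intro has_vector_derivative_add has_vector_derivative_diff bb G H has_vector_derivative_const)
  have M': "(M has_vector_derivative (G x ** 0 + K ** P x -
      (P x ** (G x ** 0 + K ** P x + (H x ** (0 - 0) + (- K) ** (mat 1 - P x))) + 0 ** L x))) (at x)"
    unfolding M_def[abs_def]
    by (intro has_vector_derivative_diff bb G L' has_vector_derivative_const)
  have Lx: "L x = mat 1" by (simp add: L_def G H)
  have Mx: "M x = 0" by (simp add: M_def G Lx)
  have "((\<lambda>y. M y /\<^sub>R (y - x)) \<longlongrightarrow> (mat 1 - P x) ** K ** P x + P x ** K ** (mat 1 - P x)) (at x)"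
  proof -
    have "G x ** 0 + K ** P x -
      (P x ** (G x ** 0 + K ** P x + (H x ** (0 - 0) + (- K) ** (mat 1 - P x))) + 0 ** L x)
      = (mat 1 - P x) ** K ** P x + P x ** K ** (mat 1 - P x)"
      unfolding mat_distribs matrix_mul_assoc by simp
    then show ?thesis
      using M'[unfolded has_vector_derivative_iff_quotient] unfolding Mx by simp
  qed
  moreover have "\<forall>\<^sub>F y in at x. M y /\<^sub>R (y - x) = ((P y - P x) /\<^sub>R (y - x)) ** L y"
    using rel
  proof eventually_elim
    case (elim y)
    then show ?case unfolding L_def[symmetric] M_def by (simp add: mat_distribs)
  qed
  ultimately have "((\<lambda>y. ((P y - P x) /\<^sub>R (y - x)) ** L y) \<longlongrightarrow>
      (mat 1 - P x) ** K ** P x + P x ** K ** (mat 1 - P x)) (at x)"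
    by (rule Lim_transform_eventually)
  moreover have "(L \<longlongrightarrow> mat 1) (at x)"
    using has_vector_derivative_continuous[OF L'] Lx by (simp add: isCont_def)
  ultimately show ?thesis
    unfolding has_vector_derivative_iff_quotient by (rule tendsto_matrix_cancel)
qed

subsection \<open>The image of the adjoint action\<close>

text \<open>The induction is on the statement that M^i ((ad M)^k X) M^j vanishes once i + j + k >=
  2d: each ad M passes a factor M to one side, and at k = 0 one of i, j is at least d.\<close>

lemma ad_pow_zero:
  fixes M :: "real^'v^'v"
  assumes "mat_power M d = 0"
  shows "(ad M ^^ (d + d)) X = 0"
proof -
  have "\<forall>i j. d + d \<le> i + j + k \<longrightarrow> mat_power M i ** (ad M ^^ k) X ** mat_power M j = 0" for k
  proof (induction k)
    case 0
    show ?case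
    proof (intro allI impI)
      fix i j assume "d + d \<le> i + j + 0"
      then have "d \<le> i \<or> d \<le> j" by linarith
      then show "mat_power M i ** (ad M ^^ 0) X ** mat_power M j = 0"
        using mat_power_zero_mono[OF assms] by auto
    qed
  next
    case (Suc k)
    show ?case
    proof (intro allI impI)
      fix i j assume ij: "d + d \<le> i + j + Suc k"
      define Y where "Y = (ad M ^^ k) X"
      have "mat_power M i ** (ad M ^^ Suc k) X ** mat_power M j =
          (mat_power M i ** M) ** Y ** mat_power M j - mat_power M i ** Y ** (M ** mat_power M j)"
        by (simp add: ad_def Y_def[symmetric] mat_distribs matrix_mul_assoc)
      also have "mat_power M i ** M = mat_power M (Suc i)" by (simp add: mat_power_Suc mat_power_commute)
      also have "M ** mat_power M j = mat_power M (Suc j)" by (simp add: mat_power_Suc)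
      finally show "mat_power M i ** (ad M ^^ Suc k) X ** mat_power M j = 0"
        using Suc[rule_format, of "Suc i" j] Suc[rule_format, of i "Suc j"] ij by (simp add: Y_def)
    qed
  qed
  from this[rule_format, of 0 0 "d + d"] show ?thesis by simp
qed

lemma matrix_vector_minus: "(- A) *v x = - (A *v (x :: 'a::ring_1^'n))"
  by (simp add: vec_eq_iff matrix_vector_mult_def sum_negf)

lemma inner_ad_adjoint:
  fixes M Y W :: "real^'v^'v"
  shows "ad M Y \<bullet> W = Y \<bullet> ad (transpose M) W"
proof -
  have "trace (M ** Y ** transpose W) = trace (Y ** (transpose W ** M))"
    using trace_mul_sym[of M "Y ** transpose W"] by (simp add: matrix_mul_assoc)
  moreover have "transpose (ad (transpose M) W) = transpose W ** M - M ** transpose W"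
  proof -
    have "transpose (A - B) = transpose A - transpose B" for A B :: "real^'v^'v"
      by (simp add: transpose_def vec_eq_iff)
    then show ?thesis by (simp add: ad_def matrix_transpose_mul)
  qed
  ultimately show ?thesis
    by (simp add: inner_matrix_eq_trace ad_def[of M] mat_distribs trace_simps matrix_mul_assoc)
qed

text \<open>The remainder R of X orthogonal to the range in the Frobenius product satisfies [M^T, R]
  = 0, so R^T centralizes M, and |R|^2 = trace (X R^T) is zero by hypothesis.\<close>

lemma range_ad_if_orthogonal:
  assumes "\<And>Z. ad M Z = 0 \<Longrightarrow> trace (X ** Z) = 0"
  shows "X \<in> range (ad M)"
proof -
  have sub: "subspace (range (ad M))" using linear_ad linear_subspace_image subspace_UNIV by blast
  obtain P R where P: "P \<in> span (range (ad M))" and R: "\<And>w. w \<in> span (range (ad M)) \<Longrightarrow> orthogonal R w"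
    and X: "X = P + R"
    using orthogonal_subspace_decomp_exists[of "range (ad M)" X] by blast
  have "ad M Y \<bullet> R = 0" for Y
    using R[OF span_base, of "ad M Y"] by (simp add: orthogonal_def inner_commute)
  then have "Y \<bullet> ad (transpose M) R = 0" for Y by (simp add: inner_ad_adjoint)
  then have "ad (transpose M) R = 0" using inner_eq_zero_iff by blast
  then have "transpose (transpose M ** R) = transpose (R ** transpose M)" by (simp add: ad_def)
  then have "ad M (transpose R) = 0" by (simp add: matrix_transpose_mul ad_def)
  then have "X \<bullet> R = 0" using assms by (simp add: inner_matrix_eq_trace)
  moreover have "P \<bullet> R = 0" using R[OF P] by (simp add: orthogonal_def inner_commute)
  ultimately have "R \<bullet> R = 0" by (simp add: X inner_add_left)
  then show ?thesis using P X sub by (simp add: span_eq_iff[THEN iffD2])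
qed

section \<open>Descent from all matrices to the Lie algebra of Q\<close>

locale polarized_space =
  fixes n :: int and Q :: "real^'v \<Rightarrow> real^'v \<Rightarrow> real"
  assumes pol: "polarization_form n Q"
begin

lemma bil: "bilinear Q" and Q_sym: "Q y x = (- 1) powi n * Q x y"
  and nondeg: "(\<And>y. Q x y = 0) \<Longrightarrow> x = 0"
  using pol unfolding polarization_form_def by blast+

lemma nondeg': "(\<And>x. Q x y = 0) \<Longrightarrow> y = 0"
  by (rule nondeg) (simp add: Q_sym[of _ y])

lemma lie_subspace: "subspace (lie_algebra_Q Q)"
  unfolding subspace_def lie_algebra_Q_def
  by (auto simp: matrix_vector_mult_add_rdistrib scaleR_matrix_vector_assoc[symmetric]
      bilinear_ladd[OF bil] bilinear_radd[OF bil] bilinear_lmul[OF bil] bilinear_rmul[OF bil]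
      bilinear_lzero[OF bil] bilinear_rzero[OF bil] distrib_left[symmetric] algebra_simps)

lemma lieD: "X \<in> lie_algebra_Q Q \<Longrightarrow> Q (X *v x) y = - Q x (X *v y)"
  unfolding lie_algebra_Q_def by (simp add: eq_neg_iff_add_eq_0)

lemma lieI: "(\<And>x y. Q (X *v x) y = - Q x (X *v y)) \<Longrightarrow> X \<in> lie_algebra_Q Q"
  unfolding lie_algebra_Q_def by simp

lemma lie_bracket:
  assumes "X \<in> lie_algebra_Q Q" "Y \<in> lie_algebra_Q Q"
  shows "ad X Y \<in> lie_algebra_Q Q"
  by (rule lieI)
    (simp add: ad_def matrix_vector_mult_diff_rdistrib matrix_vector_mul_assoc[symmetric]
      bilinear_lsub[OF bil] bilinear_rsub[OF bil] lieD[OF assms(1)] lieD[OF assms(2)])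

text \<open>With q the Gram matrix of \<open>Q\<close>, the adjoint is q^-1 X^T q.\<close>

lemma adjoint_exists:
  "\<exists>dag. \<forall>X. (\<forall>x y. Q (X *v x) y = Q x (dag X *v y)) \<and> trace (dag X) = trace X"
proof -
  define q :: "real^'v^'v" where "q = (\<chi> i j. Q (axis i 1) (axis j 1))"
  have Qq: "Q x y = x \<bullet> (q *v y)" for x y
  proof -
    have "Q x y = Q (\<Sum>i\<in>UNIV. x $ i *\<^sub>R axis i 1) (\<Sum>j\<in>UNIV. y $ j *\<^sub>R axis j 1)"
      using basis_expansion[of x] basis_expansion[of y] by (simp add: scalar_mult_eq_scaleR)
    also have "\<dots> = (\<Sum>i\<in>UNIV. \<Sum>j\<in>UNIV. x $ i * (Q (axis i 1) (axis j 1) * y $ j))"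
      by (simp add: bilinear_sum[OF bil] bilinear_lmul[OF bil] bilinear_rmul[OF bil]
          sum.cartesian_product mult.assoc mult.commute mult.left_commute)
    finally show ?thesis by (simp add: inner_vec_def q_def matrix_vector_mult_def sum_distrib_left)
  qed
  have "inj ((*v) q)"
  proof (rule injI)
    fix x y assume "q *v x = q *v y"
    then have "Q z (x - y) = 0" for z by (simp add: Qq matrix_vector_mult_diff_distrib)
    then show "x = y" using nondeg' by fastforce
  qed
  then obtain q' where q': "q' ** q = mat 1" using matrix_left_invertible_injective by blast
  then have q'': "q ** q' = mat 1" using matrix_left_right_inverse by blast
  define dag where "dag X = q' ** transpose X ** q" for X :: "real^'v^'v"
  have "Q (X *v x) y = Q x (dag X *v y)" for X x y
  proof -
    have "Q x (dag X *v y) = x \<bullet> ((q ** q') *v (transpose X *v (q *v y)))"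
      by (simp add: Qq dag_def matrix_vector_mul_assoc matrix_mul_assoc)
    also have "\<dots> = x \<bullet> (transpose X *v (q *v y))" by (simp add: q'')
    also have "\<dots> = (X *v x) \<bullet> (q *v y)"
      unfolding transpose_matrix_vector inner_commute[of x] dot_lmul_matrix by (rule inner_commute)
    finally show ?thesis by (simp add: Qq)
  qed
  moreover have "trace (dag X) = trace X" for X
  proof -
    have "trace (dag X) = trace (q ** q' ** transpose X)"
      using trace_mul_sym[of "q' ** transpose X" q] by (simp add: dag_def matrix_mul_assoc)
    then show ?thesis by (simp add: q'' trace_def transpose_def)
  qed
  ultimately show ?thesis by blast
qed

definition "dag = (SOME dag. \<forall>X. (\<forall>x y. Q (X *v x) y = Q x (dag X *v y)) \<and> trace (dag X) = trace X)"

lemma dag: "Q (X *v x) y = Q x (dag X *v y)" and trace_dag: "trace (dag X) = trace X"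
  using someI_ex[OF adjoint_exists] unfolding dag_def[symmetric] by blast+

lemma dag_unique: assumes "\<And>x y. Q (X *v x) y = Q x (Y *v y)" shows "dag X = Y"
proof -
  have "dag X *v y - Y *v y = 0" for y
    by (rule nondeg') (simp add: bilinear_rsub[OF bil] dag[symmetric] assms)
  then show ?thesis by (simp add: matrix_eq)
qed

lemma dag_mult: "dag (X ** Y) = dag Y ** dag X"
  by (rule dag_unique) (simp add: matrix_vector_mul_assoc[symmetric] dag)

lemma dag_diff: "dag (X - Y) = dag X - dag Y"
  by (rule dag_unique) (simp add: matrix_vector_mult_diff_rdistrib bilinear_lsub[OF bil] bilinear_rsub[OF bil] dag)

lemma dag_dag: "dag (dag X) = X"
proof (rule dag_unique)
  fix x y
  have "Q (dag X *v x) y = (- 1) powi n * Q (X *v y) x" unfolding dag[of X y x] by (rule Q_sym)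
  also have "\<dots> = (- 1) powi n * ((- 1) powi n * Q x (X *v y))" by (simp add: Q_sym[of "X *v y" x])
  finally show "Q (dag X *v x) y = Q x (X *v y)" by (simp add: mult.assoc[symmetric])
qed

lemma dag_lie: "X \<in> lie_algebra_Q Q \<Longrightarrow> dag X = - X"
  by (rule dag_unique) (simp add: lieD matrix_vector_minus bilinear_rneg[OF bil])

lemma lie_part: "(1 / 2) *\<^sub>R (X - dag X) \<in> lie_algebra_Q Q"
proof (rule lieI)
  fix x y
  have *: "Q (dag X *v x) y = Q x (X *v y)" using dag[of "dag X"] by (simp add: dag_dag)
  show "Q ((1 / 2) *\<^sub>R (X - dag X) *v x) y = - Q x ((1 / 2) *\<^sub>R (X - dag X) *v y)"
    by (simp add: scaleR_matrix_vector_assoc[symmetric] matrix_vector_mult_diff_rdistrib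
      bilinear_lmul[OF bil] bilinear_rmul[OF bil] bilinear_lsub[OF bil] bilinear_rsub[OF bil] * dag[of X] field_simps)
qed

lemma dag_ad: "M \<in> lie_algebra_Q Q \<Longrightarrow> dag (ad M X) = ad M (dag X)"
  by (simp add: ad_def dag_diff dag_mult dag_lie mat_distribs)

text \<open>The part (Z - dag Z) / 2 lies in the Lie algebra, and dag commutes with ad M. Paired
  with X, both Z and - dag Z give the same trace, so testing on the Lie algebra suffices; a preimage
  Y is replaced by its part in the same way.\<close>

theorem image_ad_if_orthogonal:
  assumes X: "X \<in> lie_algebra_Q Q" and M: "M \<in> lie_algebra_Q Q"
    and orth: "\<And>Z. Z \<in> lie_algebra_Q Q \<Longrightarrow> ad M Z = 0 \<Longrightarrow> trace (X ** Z) = 0"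
  shows "X \<in> ad M ` lie_algebra_Q Q"
proof -
  have "trace (X ** Z) = 0" if Z: "ad M Z = 0" for Z
  proof -
    have dz: "dag 0 = 0" using dag_diff[of 0 0] by simp
    have "ad M (dag Z) = 0" using dag_ad[OF M, of Z] Z dz by simp
    then have "ad M ((1 / 2) *\<^sub>R (Z - dag Z)) = 0" using Z by (simp add: ad_linear_simps)
    then have "trace (X ** ((1 / 2) *\<^sub>R (Z - dag Z))) = 0" by (rule orth[OF lie_part])
    then have "trace (X ** Z) = trace (X ** dag Z)" by (simp add: mat_distribs trace_simps)
    also have "\<dots> = trace (dag (Z ** dag X))" by (simp add: dag_mult dag_dag)
    also have "\<dots> = - trace (Z ** X)" by (simp add: trace_dag dag_lie[OF X] mat_distribs trace_minus)
    finally show ?thesis using trace_mul_sym[of X Z] by simp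
  qed
  then obtain Y where Y: "X = ad M Y" using range_ad_if_orthogonal by blast
  have "ad M (dag Y) = - X" using dag_ad[OF M, of Y] dag_lie[OF X] Y by simp
  then have "ad M ((1 / 2) *\<^sub>R (Y - dag Y)) = (1 / 2) *\<^sub>R (X + X)"
    using Y by (simp add: ad_linear_simps)
  then have "X = ad M ((1 / 2) *\<^sub>R (Y - dag Y))" by (simp add: scaleR_2[symmetric])
  then show ?thesis using lie_part by (rule image_eqI)
qed

lemma relation_space_iff:
  assumes M: "(\<Sum>i\<in>I. N i) \<in> lie_algebra_Q Q" "mat_nilpotent (\<Sum>i\<in>I. N i)"
    and X: "(\<Sum>j\<in>- I. a $ j *\<^sub>R N j) \<in> lie_algebra_Q Q" "ad (\<Sum>i\<in>I. N i) (\<Sum>j\<in>- I. a $ j *\<^sub>R N j) = 0"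
  shows "a \<in> relation_space Q N I \<longleftrightarrow> (\<forall>i\<in>I. a $ i = 0) \<and>
    (\<Sum>j\<in>- I. a $ j *\<^sub>R N j) \<in> ad (\<Sum>i\<in>I. N i) ` lie_algebra_Q Q"
proof -
  obtain d where d: "mat_power (\<Sum>i\<in>I. N i) d = 0" using M(2) by (auto simp: mat_nilpotent_def)
  interpret nilpotent_on "ad (\<Sum>i\<in>I. N i)" "lie_algebra_Q Q" "d + d"
  proof (rule nilpotent_on.intro[OF linear_ad lie_subspace])
    show "ad (\<Sum>i\<in>I. N i) ` lie_algebra_Q Q \<subseteq> lie_algebra_Q Q" using lie_bracket[OF M(1)] by blast
  qed (rule ad_pow_zero[OF d])
  show ?thesis unfolding relation_space_def using weight_filtration_minus_one_iff[OF X] by simp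
qed

end

subsection \<open>Nilpotent orbits\<close>

text \<open>The orbit in purely imaginary directions: t holds the imaginary parts of the logarithmic
  coordinates, so c0 bounds the punctured polydisc from outside. The integer m bounds the range of
  \<open>F\<close>, symmetrically about n / 2.\<close>

locale orbit = polarized_space n Q
  for n :: int and Q :: "real^'v \<Rightarrow> real^'v \<Rightarrow> real" +
  fixes h :: "int \<Rightarrow> int \<Rightarrow> nat" and N :: "'k::finite \<Rightarrow> real^'v^'v"
    and F :: "int \<Rightarrow> (complex^'v) set" and m :: int and c0 :: real
  assumes N_lie: "\<And>i. N i \<in> lie_algebra_Q Q" and N_nil: "\<And>i. mat_nilpotent (N i)"
    and N_comm: "\<And>i j. N i ** N j = N j ** N i"
    and F_subspace: "\<And>p. vec.subspace (F p)"
    and N_F: "\<And>i p. (*v) (complexify (N i)) ` F p \<subseteq> F (p - 1)"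
    and F_top: "F (n - m) = UNIV" and F_bot: "F (m + 1) = {0}" and nm: "n \<le> 2 * m"
    and c0: "0 \<le> c0"
    and orbit_in_D: "\<And>t :: real^'k. (\<And>j. c0 < t $ j) \<Longrightarrow>
      (\<lambda>p. (*v) (mat_exp (cscale \<i> (complexify (\<Sum>j\<in>UNIV. t $ j *\<^sub>R N j)))) ` F p) \<in> period_domain n Q h"
begin

definition S :: "real^'k \<Rightarrow> real^'v^'v" where "S t = (\<Sum>j\<in>UNIV. t $ j *\<^sub>R N j)"
definition A :: "real^'k \<Rightarrow> complex^'v^'v" where "A t = cscale \<i> (complexify (S t))"
definition E :: "real^'k \<Rightarrow> complex^'v^'v" where "E t = mat_exp (A t)"
definition Fam :: "real^'k \<Rightarrow> int \<Rightarrow> (complex^'v) set" where "Fam t p = (*v) (E t) ` F p"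

lemma S_add: "S (t + u) = S t + S u" and S_scale: "S (r *\<^sub>R t) = r *\<^sub>R S t" and S_minus: "S (- t) = - S t"
  unfolding S_def by (simp_all add: scaleR_left_distrib sum.distrib scaleR_sum_right sum_negf)

lemma A_add: "A (t + u) = A t + A u" and A_scale: "A (r *\<^sub>R t) = r *\<^sub>R A t" and A_minus: "A (- t) = - A t"
  unfolding A_def S_add S_scale S_minus complexify_add complexify_scaleR complexify_minus
  by (simp_all add: cscale_add cscale_minus cscale_scaleR[symmetric] cscale_cscale mult.commute)

lemma S_comm: "S t ** S u = S u ** S t"
proof -
  have "S t ** N j = N j ** S t" for j
    unfolding S_def matrix_sum_left matrix_sum_right by (simp add: mat_distribs N_comm)
  then show ?thesis unfolding S_def[of u] matrix_sum_left matrix_sum_right by (simp add: mat_distribs)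
qed

lemma ad_S [simp]: "ad (S t) (S u) = 0"
  by (simp add: ad_def S_comm)

lemma A_comm: "A t ** A u = A u ** A t"
  unfolding A_def cscale_mult_left cscale_mult_right complexify_mult[symmetric] S_comm[of t u] ..

lemma S_lie: "S t \<in> lie_algebra_Q Q"
  unfolding S_def using lie_subspace N_lie by (intro subspace_sum subspace_scale) auto

lemma S_nil: "\<exists>d. \<forall>t. mat_power (S t) d = 0"
proof -
  have "\<exists>d. \<forall>t. mat_power (\<Sum>j\<in>K. t $ j *\<^sub>R N j) d = 0" if "finite K" for K
    using that
  proof (induction K rule: finite_induct)
    case empty
    show ?case by (intro exI[of _ 1]) (simp add: mat_power_Suc)
  next
    case (insert k K)
    then obtain d where d: "\<And>t. mat_power (\<Sum>j\<in>K. t $ j *\<^sub>R N j) d = 0" by blast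
    obtain e where e: "mat_power (N k) e = 0" using N_nil[of k] by (auto simp: mat_nilpotent_def)
    have "mat_power (\<Sum>j\<in>insert k K. t $ j *\<^sub>R N j) (e + d) = 0" for t
    proof -
      have "(t $ k *\<^sub>R N k) ** (\<Sum>j\<in>K. t $ j *\<^sub>R N j) = (\<Sum>j\<in>K. t $ j *\<^sub>R N j) ** (t $ k *\<^sub>R N k)"
        unfolding matrix_sum_left matrix_sum_right by (simp add: mat_distribs N_comm mult.commute)
      then have "mat_power (t $ k *\<^sub>R N k + (\<Sum>j\<in>K. t $ j *\<^sub>R N j)) (e + d) = 0"
        by (rule mat_power_add_eq_0) (simp_all add: mat_power_scaleR d e)
      then show ?thesis using insert.hyps by simp
    qed
    then show ?case by blast
  qed
  from this[OF finite_class.finite_UNIV] show ?thesis by (simp add: S_def)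
qed

lemma A_nil: "\<exists>d. \<forall>t. mat_power (A t) d = 0"
proof -
  obtain d where d: "\<And>t. mat_power (S t) d = 0" using S_nil by blast
  have "mat_power (A t) d = 0" for t
    unfolding A_def mat_power_cscale mat_power_complexify d complexify_zero cscale_zero ..
  then show ?thesis by blast
qed

lemma E_inverse: "E t ** E (- t) = mat 1" "E (- t) ** E t = mat 1"
proof -
  obtain d where "\<And>t. mat_power (A t) d = 0" using A_nil by blast
  then have *: "E t ** E (- t) = mat 1" for t
    unfolding E_def A_minus by (intro mat_exp_minus)
  then show "E t ** E (- t) = mat 1" .
  show "E (- t) ** E t = mat 1" using *[of "- t"] by simp
qed

lemma E_inverse_vec: "E t *v (E (- t) *v x) = x" "E (- t) *v (E t *v x) = x"
  by (simp_all add: matrix_vector_mul_assoc E_inverse)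

lemma E_cnj: "mat_cnj (E t) = E (- t)"
proof -
  obtain d where d: "\<And>t. mat_power (A t) d = 0" using A_nil by blast
  have "mat_cnj (A t) = A (- t)"
    by (simp add: A_minus) (simp add: A_def mat_cnj_cscale cscale_minus_left)
  then show ?thesis unfolding E_def mat_cnj_exp[OF d] by simp
qed

lemma E_deriv: "((\<lambda>s. E (t + s *\<^sub>R b)) has_vector_derivative A b ** E (t + l *\<^sub>R b)) (at l)"
proof -
  obtain d where d: "\<And>t. mat_power (A t) d = 0" using A_nil by blast
  have "mat_power (A t + s *\<^sub>R A b) d = 0" for s using d[of "t + s *\<^sub>R b"] by (simp add: A_add A_scale)
  from mat_exp_deriv[OF A_comm this] show ?thesis unfolding E_def A_add A_scale .
qed

lemma S_F: "x \<in> F p \<Longrightarrow> complexify (S t) *v x \<in> F (p - 1)"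
proof -
  assume x: "x \<in> F p"
  have "complexify (S t) *v x = (\<Sum>j\<in>UNIV. complex_of_real (t $ j) *s (complexify (N j) *v x))"
    unfolding S_def complexify_sum matrix_sum_vector complexify_scaleR cscale_scaleR[symmetric] cscale_vector ..
  also have "\<dots> \<in> F (p - 1)"
    using N_F x by (intro vec.subspace_sum[OF F_subspace] vec.subspace_scale[OF F_subspace]) blast
  finally show "complexify (S t) *v x \<in> F (p - 1)" .
qed

lemma S_Fam: "(*v) (complexify (S b)) ` Fam t p \<subseteq> Fam t (p - 1)"
proof clarify
  fix y assume "y \<in> Fam t p"
  then obtain x where x: "x \<in> F p" "y = E t *v x" unfolding Fam_def by blast
  obtain d where d: "\<And>t. mat_power (A t) d = 0" using A_nil by blast
  have "A t ** complexify (S b) = complexify (S b) ** A t"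
    unfolding A_def cscale_mult_left cscale_mult_right complexify_mult[symmetric] S_comm[of t b] ..
  then have "E t ** complexify (S b) = complexify (S b) ** E t"
    unfolding E_def using d by (intro mat_exp_commute)
  then have "complexify (S b) *v y = E t *v (complexify (S b) *v x)"
    unfolding x(2) by (simp add: matrix_vector_mul_assoc)
  then show "complexify (S b) *v y \<in> Fam t (p - 1)" unfolding Fam_def using S_F[OF x(1)] by blast
qed

definition admissible :: "real^'k \<Rightarrow> bool" where "admissible t \<longleftrightarrow> (\<forall>j. c0 < t $ j)"

lemma hodge_structure_Fam: "admissible t \<Longrightarrow> hodge_structure n m Q h (Fam t)"
proof
  assume t: "admissible t"
  show "Fam t \<in> period_domain n Q h"
    using orbit_in_D[of t] t unfolding admissible_def Fam_def[abs_def] E_def A_def S_def by simp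
  have "x \<in> range ((*v) (E t))" for x using E_inverse_vec(1)[of t x] by (metis rangeI)
  then show "Fam t (n - m) = UNIV" unfolding Fam_def F_top by auto
  show "Fam t (m + 1) = {0}" by (simp add: Fam_def F_bot)
qed (simp_all add: pol nm)

definition Jt :: "real^'k \<Rightarrow> real^'v^'v" where "Jt t = hodge_J n m (Fam t)"
definition Ct :: "real^'k \<Rightarrow> real^'v^'v" where "Ct t = hodge_C n m (Fam t)"

context
  fixes t b :: "real^'k" and l0 :: real
  assumes line: "\<And>l. l0 < l \<Longrightarrow> admissible (t + l *\<^sub>R b)"
begin

text \<open>The filtration at s arises from that at l by E (u s) E (- u l), and its complement by
  the complex conjugate E (- u s) E (u l). At s = l their velocities are i S b and - i S b, the
  opposite signs that \<open>projection_deriv\<close> requires.\<close>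

lemma proj_deriv:
  assumes l: "l0 < l"
  shows "((\<lambda>s. hodge_proj n (Fam (t + s *\<^sub>R b)) k) has_vector_derivative
    complexify (ad (S b) (Jt (t + l *\<^sub>R b))) ** hodge_proj n (Fam (t + l *\<^sub>R b)) k
    - hodge_proj n (Fam (t + l *\<^sub>R b)) k ** complexify (ad (S b) (Jt (t + l *\<^sub>R b)))) (at l)"
proof -
  define u where "u s = t + s *\<^sub>R b" for s
  define P where "P s = hodge_proj n (Fam (u s)) k" for s
  interpret hs: hodge_structure n m Q h "Fam (u l)"
    unfolding u_def by (rule hodge_structure_Fam[OF line[OF l]])
  have EG: "((\<lambda>s. E (u s) ** E (- u l)) has_vector_derivative A b) (at l)"
    and EH: "((\<lambda>s. E (- u s) ** E (u l)) has_vector_derivative - A b) (at l)"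
  proof -
    have 1: "((\<lambda>s. E (u s)) has_vector_derivative A b ** E (u l)) (at l)"
      unfolding u_def by (rule E_deriv)
    have "((\<lambda>s. E (- t + s *\<^sub>R (- b))) has_vector_derivative A (- b) ** E (- t + l *\<^sub>R (- b))) (at l)"
      by (rule E_deriv)
    then have 2: "((\<lambda>s. E (- u s)) has_vector_derivative (- A b) ** E (- u l)) (at l)"
      unfolding u_def A_minus by simp
    note bb = bounded_bilinear.has_vector_derivative[OF bounded_bilinear_matrix_mult _ has_vector_derivative_const]
    show "((\<lambda>s. E (u s) ** E (- u l)) has_vector_derivative A b) (at l)"
      using bb[OF 1, of "E (- u l)"] by (simp add: matrix_mul_assoc[symmetric] E_inverse)
    show "((\<lambda>s. E (- u s) ** E (u l)) has_vector_derivative - A b) (at l)"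
      using bb[OF 2, of "E (u l)"] by (simp add: matrix_mul_assoc[symmetric] E_inverse)
  qed
  have rel: "P s ** (E (u s) ** E (- u l) ** P l + E (- u s) ** E (u l) ** (mat 1 - P l)) = E (u s) ** E (- u l) ** P l"
    if s: "l0 < s" for s
  proof -
    interpret hs': hodge_structure n m Q h "Fam (u s)"
      unfolding u_def by (rule hodge_structure_Fam[OF line[OF s]])
    have "P s *v ((E (u s) ** E (- u l)) *v (P l *v x) + (E (- u s) ** E (u l)) *v (x - P l *v x))
        = (E (u s) ** E (- u l)) *v (P l *v x)" for x
    proof -
      have "P l *v x \<in> Fam (u l) k" unfolding P_def by (rule hs.pj_F)
      then obtain y where y: "y \<in> F k" "P l *v x = E (u l) *v y" unfolding Fam_def by blast
      have "(E (u s) ** E (- u l)) *v (P l *v x) = E (u s) *v y"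
        unfolding y(2) by (simp add: matrix_vector_mul_assoc[symmetric] E_inverse_vec)
      then have 1: "(E (u s) ** E (- u l)) *v (P l *v x) \<in> Fam (u s) k" using y(1) by (auto simp: Fam_def)
      have "cvec_conj (x - P l *v x) \<in> Fam (u l) (n - k + 1)"
        using hs.pj_G[of x k] unfolding P_def hs.G_def mem_cvec_conj_image .
      then obtain z where z: "z \<in> F (n - k + 1)" "cvec_conj (x - P l *v x) = E (u l) *v z" unfolding Fam_def by blast
      have "cvec_conj ((E (- u s) ** E (u l)) *v (x - P l *v x)) = (E (u s) ** E (- u l)) *v (E (u l) *v z)"
        unfolding cvec_conj_mult mat_cnj_mult z(2) E_cnj by simp
      also have "\<dots> = E (u s) *v z" by (simp add: matrix_vector_mul_assoc[symmetric] E_inverse_vec)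
      finally have 2: "(E (- u s) ** E (u l)) *v (x - P l *v x) \<in> hs'.G k"
        unfolding hs'.G_def mem_cvec_conj_image using z(1) by (auto simp: Fam_def)
      show ?thesis unfolding vec.add
        using hs'.pj_fix[OF 1 order_refl] hs'.pj_kill[OF 2 order_refl] by (simp add: P_def)
    qed
    moreover have "(P s ** (G ** P l + H ** (mat 1 - P l))) *v x = P s *v (G *v (P l *v x) + H *v (x - P l *v x))"
      for G H :: "complex^'v^'v" and x
      by (simp only: matrix_vector_mul_assoc[symmetric] matrix_vector_mult_add_rdistrib
          matrix_vector_mult_diff_rdistrib matrix_vector_mul_lid)
    ultimately show ?thesis by (simp only: matrix_eq matrix_vector_mul_assoc[symmetric, of _ "P l"]) simp
  qed
  have "(P has_vector_derivative ((mat 1 - P l) ** A b ** P l + P l ** A b ** (mat 1 - P l))) (at l)"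
  proof (rule projection_deriv[OF _ EG _ EH])
    have "\<forall>\<^sub>F s in at l. l0 < s" by (rule order_tendstoD(1)[OF tendsto_ident_at l])
    then show "\<forall>\<^sub>F s in at l. P s ** (E (u s) ** E (- u l) ** P l + E (- u s) ** E (u l) ** (mat 1 - P l)) = E (u s) ** E (- u l) ** P l"
      by eventually_elim (rule rel)
  qed (simp_all add: E_inverse)
  also have "(mat 1 - P l) ** A b ** P l + P l ** A b ** (mat 1 - P l) =
      complexify (ad (S b) (Jt (u l))) ** P l - P l ** complexify (ad (S b) (Jt (u l)))"
    unfolding A_def Jt_def P_def hs.pj_commutator[OF S_Fam, symmetric]
    by (simp only: cscale_mult_left cscale_mult_right cscale_add)
  finally show ?thesis unfolding P_def[abs_def] u_def .
qed

lemma graded_deriv: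
  assumes l: "l0 < l"
  shows "((\<lambda>s. hodge_graded n m (Fam (t + s *\<^sub>R b)) c) has_vector_derivative
    complexify (ad (S b) (Jt (t + l *\<^sub>R b))) ** hodge_graded n m (Fam (t + l *\<^sub>R b)) c
    - hodge_graded n m (Fam (t + l *\<^sub>R b)) c ** complexify (ad (S b) (Jt (t + l *\<^sub>R b)))) (at l)"
proof -
  define X where "X = complexify (ad (S b) (Jt (t + l *\<^sub>R b)))"
  define P where "P s k = hodge_proj n (Fam (t + s *\<^sub>R b)) k" for s k
  have lin: "bounded_linear (\<lambda>M :: complex^'v^'v. cscale r M)" for r
    by (rule linear_conv_bounded_linear[THEN iffD1])
      (auto intro!: linearI simp: cscale_add cscale_scaleR[symmetric] cscale_cscale mult.commute)
  have "((\<lambda>s. \<Sum>p\<in>{n - m..m}. cscale (c p) (P s p - P s (p + 1))) has_vector_derivative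
     (\<Sum>p\<in>{n - m..m}. cscale (c p) ((X ** P l p - P l p ** X) - (X ** P l (p + 1) - P l (p + 1) ** X)))) (at l)"
    unfolding X_def P_def
    by (intro has_vector_derivative_sum bounded_linear.has_vector_derivative[OF lin] has_vector_derivative_diff proj_deriv[OF l])
  moreover have "(\<Sum>p\<in>{n - m..m}. cscale (c p) ((X ** P l p - P l p ** X) - (X ** P l (p + 1) - P l (p + 1) ** X)))
    = X ** (\<Sum>p\<in>{n - m..m}. cscale (c p) (P l p - P l (p + 1))) - (\<Sum>p\<in>{n - m..m}. cscale (c p) (P l p - P l (p + 1))) ** X"
    unfolding matrix_sum_left matrix_sum_right sum_subtractf[symmetric]
    by (intro sum.cong refl) (simp add: cscale_mult_left cscale_mult_right cscale_diff mat_distribs)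
  ultimately show ?thesis unfolding hodge_graded_def hodge_comp_def X_def P_def by simp
qed

lemma Re_deriv:
  assumes l: "l0 < l" and T: "\<And>s. l0 < s \<Longrightarrow> hodge_graded n m (Fam (t + s *\<^sub>R b)) c = complexify (T s)"
    and Tdef: "\<And>s. T s = map_matrix Re (hodge_graded n m (Fam (t + s *\<^sub>R b)) c)"
  shows "(T has_vector_derivative ad (ad (S b) (Jt (t + l *\<^sub>R b))) (T l)) (at l)"
proof -
  have "bounded_linear (map_matrix Re :: complex^'v^'v \<Rightarrow> real^'v^'v)"
    by (rule linear_conv_bounded_linear[THEN iffD1]) (auto intro!: linearI simp: vec_eq_iff)
  from bounded_linear.has_vector_derivative[OF this graded_deriv[OF l, of c]]
  have "(T has_vector_derivative map_matrix Re (complexify (ad (S b) (Jt (t + l *\<^sub>R b))) ** complexify (T l)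
      - complexify (T l) ** complexify (ad (S b) (Jt (t + l *\<^sub>R b))))) (at l)"
    unfolding T[OF l] Tdef[symmetric] .
  then show ?thesis unfolding complexify_ad[symmetric] Re_complexify .
qed

lemma hodge_line:
  assumes l0: "0 \<le> l0"
  shows "hodge_line (lie_algebra_Q Q) (S b) (\<lambda>l. Jt (t + l *\<^sub>R b)) (\<lambda>l. Ct (t + l *\<^sub>R b)) ((- 1) powi n) l0"
proof (rule hodge_line.intro)
  show "subspace (lie_algebra_Q Q)" by (rule lie_subspace)
  show "ad X Y \<in> lie_algebra_Q Q" if "X \<in> lie_algebra_Q Q" "Y \<in> lie_algebra_Q Q" for X Y
    using that by (rule lie_bracket)
  show "S b \<in> lie_algebra_Q Q" by (rule S_lie)
  show "(- 1) powi n * (- 1) powi n = (1 :: real)" by simp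
  show "0 \<le> l0" by (rule l0)
  obtain d where d: "\<And>t. mat_power (S t) d = 0" using S_nil by blast
  have "mat_power (S b ** S b) d = 0" by (simp add: mat_power_mult_commute d)
  then show "trace (S b ** S b) = 0" by (intro trace_nilpotent) (auto simp: mat_nilpotent_def)
next
  fix l assume l: "l0 < l"
  interpret hs: hodge_structure n m Q h "Fam (t + l *\<^sub>R b)" by (rule hodge_structure_Fam[OF line[OF l]])
  show "Jt (t + l *\<^sub>R b) \<in> lie_algebra_Q Q" unfolding Jt_def by (rule hs.J_lie)
  show "Ct (t + l *\<^sub>R b) ** Ct (t + l *\<^sub>R b) = (- 1) powi n *\<^sub>R mat 1" unfolding Ct_def by (rule hs.C_C)
  show "Ct (t + l *\<^sub>R b) ** Jt (t + l *\<^sub>R b) = Jt (t + l *\<^sub>R b) ** Ct (t + l *\<^sub>R b)"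
    unfolding Ct_def Jt_def by (rule hs.C_J)
  show "Ct (t + l *\<^sub>R b) ** S b = (S b - 2 *\<^sub>R ad (Jt (t + l *\<^sub>R b)) (ad (S b) (Jt (t + l *\<^sub>R b)))) ** Ct (t + l *\<^sub>R b)"
    unfolding Ct_def Jt_def by (rule hs.C_N[OF S_Fam])
  show "ad (Jt (t + l *\<^sub>R b)) (ad (Jt (t + l *\<^sub>R b)) (ad (Jt (t + l *\<^sub>R b)) (S b))) = - ad (Jt (t + l *\<^sub>R b)) (S b)"
    unfolding Jt_def by (rule hs.J_triple[OF S_Fam])
  show "\<exists>R R' :: real^'v^'v. R ** R' = mat 1 \<and> R' ** R = mat 1 \<and> (\<forall>X\<in>lie_algebra_Q Q. \<forall>Y\<in>lie_algebra_Q Q.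
      - ((- 1) powi n) * trace (X ** Ct (t + l *\<^sub>R b) ** Y ** Ct (t + l *\<^sub>R b)) = (R ** X ** R') \<bullet> (R ** Y ** R'))"
    unfolding Ct_def by (rule hs.hodge_frame)
  show "((\<lambda>l. Jt (t + l *\<^sub>R b)) has_vector_derivative ad (ad (S b) (Jt (t + l *\<^sub>R b))) (Jt (t + l *\<^sub>R b))) (at l)"
  proof (rule Re_deriv[OF l, of "hodge_weight n"])
    fix s assume "l0 < s"
    then interpret hs': hodge_structure n m Q h "Fam (t + s *\<^sub>R b)" by (intro hodge_structure_Fam line)
    show "hodge_graded n m (Fam (t + s *\<^sub>R b)) (hodge_weight n) = complexify (Jt (t + s *\<^sub>R b))"
      by (simp add: Jt_def hs'.complexify_J hs'.graded_eq)
  qed (simp add: Jt_def hodge_J_def)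
  show "((\<lambda>l. Ct (t + l *\<^sub>R b)) has_vector_derivative ad (ad (S b) (Jt (t + l *\<^sub>R b))) (Ct (t + l *\<^sub>R b))) (at l)"
  proof (rule Re_deriv[OF l, of "weil_weight n"])
    fix s assume "l0 < s"
    then interpret hs': hodge_structure n m Q h "Fam (t + s *\<^sub>R b)" by (intro hodge_structure_Fam line)
    show "hodge_graded n m (Fam (t + s *\<^sub>R b)) (weil_weight n) = complexify (Ct (t + s *\<^sub>R b))"
      by (simp add: Ct_def hs'.complexify_C hs'.graded_eq)
  qed (simp add: Ct_def hodge_C_def)
qed

end

section \<open>Norm estimates in the cone and the comparison of images\<close>

definition hodge_norm :: "real^'k \<Rightarrow> real^'v^'v \<Rightarrow> real" where
  "hodge_norm t X = - ((- 1) powi n) * trace (X ** Ct t ** X ** Ct t)"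

lemma hodge_norm_mono:
  assumes t: "\<And>j. c0 + 1 \<le> t $ j" and b: "\<And>j. 0 \<le> b $ j" "\<And>j. b $ j \<le> 1" and s: "0 \<le> s"
    and X: "X \<in> lie_algebra_Q Q" "ad (S b) X = 0"
  shows "hodge_norm (t + s *\<^sub>R b) X \<le> hodge_norm t X"
proof -
  \<comment> \<open>Half a step back along b makes t an interior point, at parameter 1/2, of a line
    starting at 0; the margin 1 in the bound on t keeps that line admissible.\<close>
  define t' where "t' = t - (1/2) *\<^sub>R b"
  have adm: "admissible (t' + l *\<^sub>R b)" if "0 < l" for l
    unfolding admissible_def
  proof
    fix j
    have "0 \<le> l * b $ j" using that b(1)[of j] by simp
    then show "c0 < (t' + l *\<^sub>R b) $ j" using t[of j] b(2)[of j] by (simp add: t'_def)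
  qed
  interpret hl: hodge_line "lie_algebra_Q Q" "S b" "\<lambda>l. Jt (t' + l *\<^sub>R b)" "\<lambda>l. Ct (t' + l *\<^sub>R b)" "(- 1) powi n" 0
    by (rule hodge_line[OF adm]) simp_all
  have "hl.B (1/2 + s) X X \<le> hl.B (1/2) X X"
    by (rule hl.norm_nonincreasing[OF X]) (use s in auto)
  moreover have "t' + (1/2) *\<^sub>R b = t" "t' + (1/2 + s) *\<^sub>R b = t + s *\<^sub>R b"
    by (simp_all add: t'_def scaleR_left_distrib)
  ultimately show ?thesis unfolding hl.B_def hodge_norm_def by simp
qed

lemma hodge_norm_tendsto_zero:
  assumes t: "\<And>j. c0 + 1 \<le> t $ j" and b: "\<And>j. 0 \<le> b $ j"
    and Y: "Y \<in> lie_algebra_Q Q" "ad (S b) (ad (S b) Y) = 0"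
  shows "((\<lambda>l. hodge_norm (t + l *\<^sub>R b) (ad (S b) Y)) \<longlongrightarrow> 0) at_top"
proof -
  have adm: "admissible (t + l *\<^sub>R b)" if "0 < l" for l
    unfolding admissible_def
  proof
    fix j
    have "0 \<le> l * b $ j" using that b[of j] by simp
    then show "c0 < (t + l *\<^sub>R b) $ j" using t[of j] by simp
  qed
  interpret hl: hodge_line "lie_algebra_Q Q" "S b" "\<lambda>l. Jt (t + l *\<^sub>R b)" "\<lambda>l. Ct (t + l *\<^sub>R b)" "(- 1) powi n" 0
    by (rule hodge_line[OF adm]) simp_all
  show ?thesis using hl.norm_tendsto_zero[OF Y] unfolding hl.B_def hodge_norm_def .
qed

text \<open>In the frame, trace (X Z) is the Frobenius product of x with the transpose of z, which
  is as long as z.\<close>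

lemma trace_le_hodge_norm:
  assumes t: "admissible t" and X: "X \<in> lie_algebra_Q Q" and Z: "Z \<in> lie_algebra_Q Q"
  shows "(trace (X ** Z))\<^sup>2 \<le> hodge_norm t X * hodge_norm t Z" and "0 \<le> hodge_norm t X"
proof -
  interpret hs: hodge_structure n m Q h "Fam t" by (rule hodge_structure_Fam[OF t])
  obtain R R' :: "real^'v^'v" where R: "R ** R' = mat 1" "R' ** R = mat 1"
    and frame: "\<And>X Y. X \<in> lie_algebra_Q Q \<Longrightarrow> Y \<in> lie_algebra_Q Q \<Longrightarrow>
       - ((- 1) powi n) * trace (X ** Ct t ** Y ** Ct t) = (R ** X ** R') \<bullet> (R ** Y ** R')"
    using hs.hodge_frame unfolding Ct_def by blast
  define x z where "x = R ** X ** R'" and "z = R ** Z ** R'"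
  have nx: "hodge_norm t X = x \<bullet> x" and nz: "hodge_norm t Z = z \<bullet> z"
    unfolding hodge_norm_def x_def z_def using frame X Z by blast+
  have "x ** z = R ** X ** (R' ** R) ** Z ** R'" by (simp add: x_def z_def matrix_mul_assoc)
  then have "trace (x ** z) = trace (R ** (X ** Z ** R'))" by (simp add: R matrix_mul_assoc)
  also have "\<dots> = trace (X ** Z ** (R' ** R))"
    using trace_mul_sym[of R "X ** Z ** R'"] by (simp add: matrix_mul_assoc)
  finally have "trace (X ** Z) = x \<bullet> transpose z" by (simp add: R inner_matrix_eq_trace)
  moreover have "transpose z \<bullet> transpose z = z \<bullet> z"
    using trace_mul_sym[of z "transpose z"] by (simp add: inner_matrix_eq_trace)
  ultimately show "(trace (X ** Z))\<^sup>2 \<le> hodge_norm t X * hodge_norm t Z"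
    unfolding nx nz using Cauchy_Schwarz_ineq[of x "transpose z"] by simp
  show "0 \<le> hodge_norm t X" by (simp add: nx)
qed

definition ones :: "'k set \<Rightarrow> real^'k" where "ones I = (\<chi> j. if j \<in> I then 1 else 0)"

lemma S_ones: "S (ones I) = (\<Sum>i\<in>I. N i)"
proof -
  have "S (ones I) = (\<Sum>j\<in>UNIV. if j \<in> I then N j else 0)"
    unfolding S_def ones_def by (intro sum.cong) auto
  then show ?thesis by (simp add: sum.If_cases)
qed

text \<open>
  For \<open>Z\<close> commuting with \<open>N\<^sub>J\<close>, the pairing of \<open>S a\<close> with \<open>Z\<close> is bounded by the Hodge norms at
  \<open>t + l 1\<^sub>J\<close>. That of \<open>Z\<close> stays bounded, and that of \<open>S a\<close> is at most its value
  at \<open>t + l 1\<^sub>I\<close>, which tends to zero.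
\<close>

theorem image_ad_mono:
  assumes IJ: "I \<subseteq> J" and a: "S a \<in> ad (S (ones I)) ` lie_algebra_Q Q"
  shows "S a \<in> ad (S (ones J)) ` lie_algebra_Q Q"
proof (rule image_ad_if_orthogonal[OF S_lie S_lie])
  fix Z assume Z: "Z \<in> lie_algebra_Q Q" "ad (S (ones J)) Z = 0"
  obtain Y where Y: "Y \<in> lie_algebra_Q Q" "S a = ad (S (ones I)) Y" using a by blast
  define t :: "real^'k" where "t = (\<chi> j. c0 + 1)"
  have t: "c0 + 1 \<le> t $ j" for j by (simp add: t_def)
  have ones: "0 \<le> ones K $ j" "ones K $ j \<le> 1" for K j by (simp_all add: ones_def)
  have bound: "(trace (S a ** Z))\<^sup>2 \<le> hodge_norm (t + l *\<^sub>R ones I) (S a) * hodge_norm t Z" if l: "0 \<le> l" for l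
  proof -
    have tl: "c0 + 1 \<le> (t + l *\<^sub>R ones K) $ j" for K j
      using mult_nonneg_nonneg[OF l ones(1)[of K j]] by (simp add: t_def)
    have adm: "admissible (t + l *\<^sub>R ones K)" for K
      unfolding admissible_def
    proof
      fix j show "c0 < (t + l *\<^sub>R ones K) $ j" using tl[of K j] by linarith
    qed
    have split: "t + l *\<^sub>R ones J = (t + l *\<^sub>R ones I) + l *\<^sub>R ones (J - I)"
      using IJ by (auto simp: vec_eq_iff ones_def)
    have "hodge_norm (t + l *\<^sub>R ones J) (S a) \<le> hodge_norm (t + l *\<^sub>R ones I) (S a)"
      unfolding split by (rule hodge_norm_mono[OF tl ones l S_lie]) simp
    moreover have "hodge_norm (t + l *\<^sub>R ones J) Z \<le> hodge_norm t Z"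
      by (rule hodge_norm_mono[OF t ones l Z])
    moreover have "0 \<le> hodge_norm (t + l *\<^sub>R ones J) Z" "0 \<le> hodge_norm (t + l *\<^sub>R ones I) (S a)"
      using trace_le_hodge_norm(2)[OF adm] Z(1) S_lie by blast+
    ultimately have "hodge_norm (t + l *\<^sub>R ones J) (S a) * hodge_norm (t + l *\<^sub>R ones J) Z
        \<le> hodge_norm (t + l *\<^sub>R ones I) (S a) * hodge_norm t Z"
      by (intro mult_mono)
    then show ?thesis by (rule order_trans[OF trace_le_hodge_norm(1)[OF adm S_lie Z(1)]])
  qed
  have "((\<lambda>l. hodge_norm (t + l *\<^sub>R ones I) (S a)) \<longlongrightarrow> 0) at_top"
    using hodge_norm_tendsto_zero[OF t ones(1) Y(1), of I] unfolding Y(2)[symmetric] by simp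
  then have "((\<lambda>l. hodge_norm (t + l *\<^sub>R ones I) (S a) * hodge_norm t Z) \<longlongrightarrow> 0 * hodge_norm t Z) at_top"
    by (intro tendsto_intros)
  then have "(trace (S a ** Z))\<^sup>2 \<le> 0 * hodge_norm t Z"
  proof (rule tendsto_lowerbound)
    show "\<forall>\<^sub>F l in at_top. (trace (S a ** Z))\<^sup>2 \<le> hodge_norm (t + l *\<^sub>R ones I) (S a) * hodge_norm t Z"
      using bound by (rule eventually_at_top_linorderI)
  qed simp
  then show "trace (S a ** Z) = 0" by simp
qed

text \<open>If Z commutes with N j, then N j Z is nilpotent and has trace zero; the trace criterion
  puts N j in the image of ad (N j).\<close>

lemma N_in_image_ad: assumes "j \<in> J" shows "N j \<in> ad (S (ones J)) ` lie_algebra_Q Q"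
proof -
  have Nj: "N j = S (ones {j})" by (simp add: S_ones)
  obtain d where d: "mat_power (N j) d = 0" using N_nil[of j] by (auto simp: mat_nilpotent_def)
  have "S (ones {j}) \<in> ad (S (ones {j})) ` lie_algebra_Q Q"
  proof (rule image_ad_if_orthogonal[OF S_lie S_lie], unfold Nj[symmetric])
    fix Z assume "ad (N j) Z = 0"
    then have "N j ** Z = Z ** N j" by (simp add: ad_def)
    then have "mat_power (N j ** Z) d = 0" by (simp add: mat_power_mult_commute d)
    then show "trace (N j ** Z) = 0" by (intro trace_nilpotent) (auto simp: mat_nilpotent_def)
  qed
  then show ?thesis using image_ad_mono[of "{j}" J "ones {j}"] assms by (simp add: Nj)
qed

section \<open>Relation spaces and exponent monoids\<close>

lemma relation_space_orbit_iff:
  "a \<in> relation_space Q N I \<longleftrightarrow> (\<forall>i\<in>I. a $ i = 0) \<and> S a \<in> ad (S (ones I)) ` lie_algebra_Q Q"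
proof -
  define a' where "a' = (\<chi> j. if j \<in> I then 0 else a $ j)"
  have Sa': "(\<Sum>j\<in>- I. a $ j *\<^sub>R N j) = S a'"
  proof -
    have "S a' = (\<Sum>j\<in>UNIV. if j \<in> - I then a $ j *\<^sub>R N j else 0)"
      unfolding S_def a'_def by (intro sum.cong) auto
    then show ?thesis by (simp add: sum.If_cases Collect_neg_eq)
  qed
  obtain d where "\<And>t. mat_power (S t) d = 0" using S_nil by blast
  then have nil: "mat_nilpotent (S (ones I))" by (auto simp: mat_nilpotent_def)
  have "a' = a" if "\<forall>i\<in>I. a $ i = 0" using that by (auto simp: a'_def vec_eq_iff)
  then show ?thesis
    using relation_space_iff[of N I a] S_lie nil unfolding S_ones[symmetric] Sa' by auto
qed

theorem relation_space_restrict: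
  assumes IJ: "I \<subseteq> J" and a: "a \<in> relation_space Q N I"
  shows "(\<chi> j. if j \<in> J then 0 else a $ j) \<in> relation_space Q N J"
proof -
  define a' where "a' = (\<chi> j. if j \<in> J then 0 else a $ j)"
  have sub: "subspace (ad (S (ones J)) ` lie_algebra_Q Q)"
    using linear_subspace_image[OF linear_ad lie_subspace] .
  have "S a = S a' + (\<Sum>j\<in>J. a $ j *\<^sub>R N j)"
  proof -
    have "S a = (\<Sum>j\<in>UNIV. a' $ j *\<^sub>R N j + (if j \<in> J then a $ j *\<^sub>R N j else 0))"
      unfolding S_def by (intro sum.cong) (auto simp: a'_def)
    then show ?thesis by (simp add: sum.distrib S_def[symmetric] sum.If_cases)
  qed
  moreover have "S a \<in> ad (S (ones J)) ` lie_algebra_Q Q"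
    using a image_ad_mono[OF IJ] unfolding relation_space_orbit_iff by blast
  moreover have "(\<Sum>j\<in>J. a $ j *\<^sub>R N j) \<in> ad (S (ones J)) ` lie_algebra_Q Q"
    using N_in_image_ad by (intro subspace_sum[OF sub] subspace_scale[OF sub])
  ultimately have "S a' + (\<Sum>j\<in>J. a $ j *\<^sub>R N j) - (\<Sum>j\<in>J. a $ j *\<^sub>R N j) \<in> ad (S (ones J)) ` lie_algebra_Q Q"
    by (metis subspace_diff[OF sub])
  then have "S a' \<in> ad (S (ones J)) ` lie_algebra_Q Q" by (simp only: add_diff_cancel_right')
  then show ?thesis unfolding a'_def[symmetric] relation_space_orbit_iff by (simp add: a'_def)
qed

theorem exponent_monoid_anti:
  assumes IJ: "I \<subseteq> J"
  shows "exponent_monoid Q N J \<subseteq> exponent_monoid Q N I"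
proof
  fix b assume b: "b \<in> exponent_monoid Q N J"
  have "(\<Sum>j\<in>- I. a $ j * real (b $ j)) = 0" if a: "a \<in> relation_space Q N I" for a
  proof -
    have "(\<Sum>j\<in>- J. (\<chi> j. if j \<in> J then 0 else a $ j) $ j * real (b $ j)) = 0"
      using b relation_space_restrict[OF IJ a] unfolding exponent_monoid_def by blast
    \<comment> \<open>Exponents in the monoid of J vanish on J, so the indices in J - I contribute
      nothing.\<close>
    moreover have "(\<Sum>j\<in>- I. a $ j * real (b $ j)) = (\<Sum>j\<in>- J. (\<chi> j. if j \<in> J then 0 else a $ j) $ j * real (b $ j))"
    proof (rule sum.mono_neutral_cong_right)
      show "\<forall>j\<in>- I - - J. a $ j * real (b $ j) = 0"
        using b unfolding exponent_monoid_def by simp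
    qed (use IJ in auto)
    ultimately show ?thesis by simp
  qed
  then show "b \<in> exponent_monoid Q N I" using b IJ unfolding exponent_monoid_def by auto
qed

end

subsection \<open>Level sets of monomial maps\<close>

text \<open>The product runs over all coordinates, not only those outside I, so one continuous
  function serves both strata; exponents vanishing on I make the extra factors 0^0 = 1.\<close>

definition monomial :: "nat^'k \<Rightarrow> complex^'k::finite \<Rightarrow> complex" where
  "monomial B t = (\<Prod>j\<in>UNIV. t $ j ^ (B $ j))"

lemma monomial_add: "monomial (A + B) t = monomial A t * monomial B t"
  by (simp add: monomial_def power_add prod.distrib)

lemma monomial_zero: "monomial 0 t = 1"
  by (simp add: monomial_def)

lemma continuous_on_monomial: "continuous_on UNIV (monomial B)"
  unfolding monomial_def[abs_def] by (intro continuous_intros)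

lemma monomial_map_eq:
  assumes "\<forall>B\<in>set Bs. \<forall>i\<in>I. B $ i = 0"
  shows "monomial_map I Bs t = map (\<lambda>B. monomial B t) Bs"
  unfolding monomial_map_def
proof (rule map_cong[OF refl])
  fix B assume "B \<in> set Bs"
  then show "(\<Prod>j\<in>- I. t $ j ^ (B $ j)) = monomial B t"
    unfolding monomial_def using assms by (intro prod.mono_neutral_left) auto
qed

lemma submonoid_generated_superset: "S \<subseteq> submonoid_generated S"
  using submonoid_generated.add[OF _ submonoid_generated.zero] by fastforce

lemma punctured_stratum_closure:
  fixes I J :: "'k::finite set"
  assumes "I \<subseteq> J"
  shows "punctured_stratum J \<subseteq> closure (punctured_stratum I)"
proof
  fix t :: "complex^'k" assume t: "t \<in> punctured_stratum J"
  \<comment> \<open>The coordinates to be made nonzero start at 1/2, inside the unit disc.\<close>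
  define u where "u \<nu> = (\<chi> j. if j \<in> J - I then complex_of_real (inverse (real (Suc (Suc \<nu>)))) else t $ j)" for \<nu>
  have "u \<nu> \<in> punctured_stratum I" for \<nu>
  proof -
    have "norm (complex_of_real (inverse (real (Suc (Suc \<nu>))))) < 1"
      by (simp only: norm_of_real) (simp add: field_simps)
    then have "norm (u \<nu> $ j) < 1" for j
      using t unfolding punctured_stratum_def u_def by auto
    moreover have "u \<nu> $ j = 0 \<longleftrightarrow> j \<in> I" for j
      using t assms unfolding punctured_stratum_def u_def by (auto simp del: of_nat_Suc)
    ultimately show ?thesis unfolding punctured_stratum_def by simp
  qed
  moreover have "u \<longlonglongrightarrow> t"
  proof (rule vec_tendstoI)
    fix j
    show "(\<lambda>\<nu>. u \<nu> $ j) \<longlonglongrightarrow> t $ j"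
    proof (cases "j \<in> J - I")
      case True
      have "(\<lambda>\<nu>. complex_of_real (inverse (real (Suc (Suc \<nu>))))) \<longlonglongrightarrow> of_real 0"
        using LIMSEQ_Suc[OF LIMSEQ_inverse_real_of_nat] by (rule tendsto_of_real)
      moreover have "t $ j = 0" using t True unfolding punctured_stratum_def by simp
      ultimately show ?thesis using True by (simp add: u_def del: of_nat_Suc)
    next
      case False
      then have "u \<nu> $ j = t $ j" for \<nu> unfolding u_def vec_lambda_beta by (rule if_not_P)
      then show ?thesis by simp
    qed
  qed
  ultimately show "t \<in> closure (punctured_stratum I)" by (auto simp: closure_sequential)
qed

lemma monomial_constant_on_level_set:
  assumes gen: "submonoid_generated (set Bs) = exponent_monoid Q N I"
    and B: "B \<in> exponent_monoid Q N I"
    and t: "t \<in> level_set I Bs c" "t' \<in> level_set I Bs c"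
  shows "monomial B t = monomial B t'"
proof -
  have zero: "\<forall>B\<in>set Bs. \<forall>i\<in>I. B $ i = 0"
    using submonoid_generated_superset[of "set Bs"] unfolding gen exponent_monoid_def by blast
  have "map (\<lambda>B. monomial B t) Bs = map (\<lambda>B. monomial B t') Bs"
    using t unfolding level_set_def by (simp add: monomial_map_eq[OF zero])
  then have eq: "monomial B t = monomial B t'" if "B \<in> set Bs" for B using that by simp
  have "B \<in> submonoid_generated (set Bs)" using B gen by simp
  then show ?thesis
    by induction (simp_all add: monomial_zero monomial_add eq)
qed

text \<open>Monomials may vary along the sequence with c, but two sequences in the same level sets
  have equal monomials at every step; continuity carries this equality to the limits.\<close>

lemma limit_in_one_level_set:
  assumes genI: "submonoid_generated (set (Bs I)) = exponent_monoid Q N I"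
    and genJ: "submonoid_generated (set (Bs J)) = exponent_monoid Q N J"
    and sub: "exponent_monoid Q N J \<subseteq> exponent_monoid Q N I"
  shows "\<exists>d. limit_of_sets (\<lambda>\<nu>. level_set I (Bs I) (c \<nu>)) \<inter> punctured_stratum J \<subseteq> level_set J (Bs J) d"
proof -
  define L where "L = limit_of_sets (\<lambda>\<nu>. level_set I (Bs I) (c \<nu>)) \<inter> punctured_stratum J"
  have gen_exp: "set (Bs J) \<subseteq> exponent_monoid Q N J"
    using submonoid_generated_superset[of "set (Bs J)"] unfolding genJ .
  have zero: "\<forall>B\<in>set (Bs J). \<forall>i\<in>J. B $ i = 0"
    using gen_exp unfolding exponent_monoid_def by blast
  have "monomial_map J (Bs J) s = monomial_map J (Bs J) s'" if s: "s \<in> L" and s': "s' \<in> L" for s s'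
  proof -
    obtain t where t: "\<And>\<nu>. t \<nu> \<in> level_set I (Bs I) (c \<nu>)" "t \<longlonglongrightarrow> s"
      using s unfolding L_def limit_of_sets_def by blast
    obtain t' where t': "\<And>\<nu>. t' \<nu> \<in> level_set I (Bs I) (c \<nu>)" "t' \<longlonglongrightarrow> s'"
      using s' unfolding L_def limit_of_sets_def by blast
    have "monomial B s = monomial B s'" if B: "B \<in> set (Bs J)" for B
    proof -
      have "B \<in> exponent_monoid Q N I" using B gen_exp sub by blast
      then have eq: "monomial B (t \<nu>) = monomial B (t' \<nu>)" for \<nu>
        by (rule monomial_constant_on_level_set[OF genI _ t(1) t'(1)])
      have lim: "(\<lambda>\<nu>. monomial B (x \<nu>)) \<longlonglongrightarrow> monomial B y" if "x \<longlonglongrightarrow> y" for x y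
        using continuous_on_tendsto_compose[OF continuous_on_monomial that] by simp
      show ?thesis
        using lim[OF t(2)] lim[OF t'(2)] unfolding eq by (rule LIMSEQ_unique)
    qed
    then show ?thesis by (simp add: monomial_map_eq[OF zero])
  qed
  \<comment> \<open>If L is empty, any d serves.\<close>
  then obtain d where d: "\<And>s. s \<in> L \<Longrightarrow> monomial_map J (Bs J) s = d" by blast
  have "L \<subseteq> punctured_stratum J" by (simp add: L_def)
  then have "L \<subseteq> level_set J (Bs J) d" using d unfolding level_set_def by blast
  then show ?thesis unfolding L_def by blast
qed

lemma closure_subset_limit_of_sets: "closure S \<subseteq> limit_of_sets (\<lambda>_. S)"
  for S :: "(complex^'k) set"
  unfolding limit_of_sets_def by (auto simp: closure_sequential)

lemma nilpotent_orbit_imp_orbit: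
  fixes N :: "'k::finite \<Rightarrow> real^'v^'v"
  assumes pol: "polarization_form n Q" and orb: "nilpotent_orbit n Q h N F"
  shows "\<exists>m c0. orbit n Q h N F m c0"
proof -
  have cd: "F \<in> compact_dual n Q h" using orb unfolding nilpotent_orbit_def by (elim conjE)
  have sub: "vec.subspace (F p)" for p
    using cd unfolding compact_dual_def by (elim CollectE conjE) (erule spec)
  have step: "F (p + 1) \<subseteq> F p" for p
    using cd unfolding compact_dual_def by (elim CollectE conjE) (erule_tac x = p in allE, assumption)
  obtain a where a: "F a = UNIV" using cd unfolding compact_dual_def by (elim CollectE conjE exE)
  obtain b where b: "F b = {0}" using cd unfolding compact_dual_def by (elim CollectE conjE exE)
  have anti: "F q \<subseteq> F p" if "p \<le> q" for p q
    using that
  proof (induction q rule: int_ge_induct)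
    case (step i)
    then show ?case using \<open>\<And>p. F (p + 1) \<subseteq> F p\<close>[of i] by blast
  qed simp
  \<comment> \<open>The first two entries make F full at n - m and zero at m + 1; the absolute value
    ensures n <= 2 m.\<close>
  define m where "m = max (max (n - a) (b - 1)) \<bar>n\<bar>"
  have m: "n - m \<le> a" "b \<le> m + 1" "n \<le> 2 * m" by (auto simp: m_def max_def)
  have top: "F (n - m) = UNIV" using anti[OF m(1)] a by auto
  have "F (m + 1) \<subseteq> {0}" using anti[OF m(2)] b by simp
  then have bot: "F (m + 1) = {0}" using vec.subspace_0[OF sub] by blast
  obtain e where e: "e > 0" and D: "\<And>t::complex^'k. (\<And>j. 0 < norm (t $ j) \<and> norm (t $ j) < e) \<Longrightarrow>
        (\<lambda>p. (*v) (mat_exp (\<Sum>j\<in>UNIV. cscale (ell (t $ j)) (complexify (N j)))) ` F p) \<in> period_domain n Q h"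
    using orb unfolding nilpotent_orbit_def by (elim conjE exE) blast
  \<comment> \<open>exp (- 2 pi y) < e holds exactly for y > - ln e / (2 pi).\<close>
  define c0 where "c0 = max 0 (- ln e / (2 * pi))"
  have "orbit n Q h N F m c0"
  proof
    fix t :: "real^'k" assume t: "\<And>j. c0 < t $ j"
    \<comment> \<open>Positive real arguments, on which the principal logarithm is real, so that
      \<open>ell\<close> of coordinate j is i t_j.\<close>
    define u :: "complex^'k" where "u = (\<chi> j. complex_of_real (exp (- (2 * pi * t $ j))))"
    have nu: "norm (u $ j) = exp (- (2 * pi * t $ j))" for j by (simp add: u_def)
    have "norm (u $ j) < e" for j
    proof -
      have "- ln e / (2 * pi) < t $ j" using t[of j] by (simp add: c0_def)
      then have "- (2 * pi * t $ j) < ln e" by (simp add: field_simps)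
      then have "exp (- (2 * pi * t $ j)) < exp (ln e)" by (rule exp_less_mono)
      then show ?thesis using e by (simp add: nu)
    qed
    then have in_D: "(\<lambda>p. (*v) (mat_exp (\<Sum>j\<in>UNIV. cscale (ell (u $ j)) (complexify (N j)))) ` F p) \<in> period_domain n Q h"
      by (intro D) (simp add: nu)
    have ell: "ell (u $ j) = \<i> * complex_of_real (t $ j)" for j
    proof -
      have "Ln (u $ j) = complex_of_real (- (2 * pi * t $ j))"
        unfolding u_def vec_lambda_beta by (subst Ln_of_real) simp_all
      then show ?thesis unfolding ell_def by (simp add: field_simps)
    qed
    have "(\<Sum>j\<in>UNIV. cscale (ell (u $ j)) (complexify (N j))) = cscale \<i> (complexify (\<Sum>j\<in>UNIV. t $ j *\<^sub>R N j))"
      unfolding ell complexify_sum complexify_scaleR cscale_sum cscale_scaleR[symmetric] cscale_cscale ..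
    then show "(\<lambda>p. (*v) (mat_exp (cscale \<i> (complexify (\<Sum>j\<in>UNIV. t $ j *\<^sub>R N j)))) ` F p) \<in> period_domain n Q h"
      using in_D by simp
  next
    show "N i \<in> lie_algebra_Q Q" "mat_nilpotent (N i)" "N i ** N j = N j ** N i" for i j
      using orb unfolding nilpotent_orbit_def by simp_all
    show "(*v) (complexify (N i)) ` F p \<subseteq> F (p - 1)" for i p
      using orb unfolding nilpotent_orbit_def by simp
  qed (use pol sub top bot m in \<open>simp_all add: c0_def\<close>)
  then show ?thesis by blast
qed

theorem mainTheorem11:
  fixes n :: int
    and Q :: "real^'v \<Rightarrow> real^'v \<Rightarrow> real"
    and h :: "int \<Rightarrow> int \<Rightarrow> nat"
    and N :: "'k::finite \<Rightarrow> real^'v^'v"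
    and F :: "int \<Rightarrow> (complex^'v) set"
    and Bs :: "'k set \<Rightarrow> (nat^'k) list"
    and I J :: "'k set"
  assumes "polarization_form n Q"
    and "nilpotent_orbit n Q h N F"
    and generators: "\<And>K. submonoid_generated (set (Bs K)) = exponent_monoid Q N K"
    and "I \<subset> J"
  shows "punctured_stratum J \<subseteq> closure (punctured_stratum I)
    \<and> (\<forall>c. \<exists>d. closure (level_set I (Bs I) c) \<inter> punctured_stratum J \<subseteq> level_set J (Bs J) d)
    \<and> (\<forall>c :: nat \<Rightarrow> complex list. \<exists>d.
         limit_of_sets (\<lambda>\<nu>. level_set I (Bs I) (c \<nu>)) \<inter> punctured_stratum J
           \<subseteq> level_set J (Bs J) d)"
proof -
  have IJ: "I \<subseteq> J" using assms(4) by blast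
  obtain m c0 where "orbit n Q h N F m c0"
    using nilpotent_orbit_imp_orbit[OF assms(1,2)] by blast
  then have sub: "exponent_monoid Q N J \<subseteq> exponent_monoid Q N I"
    by (rule orbit.exponent_monoid_anti[OF _ IJ])
  have lim: "\<exists>d. limit_of_sets (\<lambda>\<nu>. level_set I (Bs I) (c \<nu>)) \<inter> punctured_stratum J \<subseteq> level_set J (Bs J) d" for c
    by (rule limit_in_one_level_set[OF generators generators sub])
  have "\<exists>d. closure (level_set I (Bs I) c) \<inter> punctured_stratum J \<subseteq> level_set J (Bs J) d" for c
    using lim[of "\<lambda>_. c"] closure_subset_limit_of_sets[of "level_set I (Bs I) c"] by blast
  then show ?thesis using punctured_stratum_closure[OF IJ] lim by blast
qed

end
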